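(* Let $e\in\{E,\theta\}$, let $a,b$ be complex parameters, and put $K_0=\frac{(a,b;q)_\infty}{(q;q)_\infty}$. Then $$\mathrm{U}_{q,e}(a,b;z)=\int_0^\infty\frac{(-bt;q)_\infty}{(-t;q)_\infty}\;{}_1\phi_1\!\left({b\atop -bt};q;-at\right)\kappa\!\left(\frac tz\right)\frac{dt}{t};$$ $$\mathrm{U}_{q,e}(a,b;z)=(a;q)_\infty\int_0^\infty\frac{(-bt,-\frac{aqz}{t};q)_\infty}{(-t;q)_\infty}\,\kappa\!\left(\frac tz\right)\frac{dt}{t},\qquad |aq|<1;$$ $$\mathrm{U}_{q,e}(a,b;z)=(abz;q)_\infty\int_0^\infty\frac{(-at,-bt;q)_\infty}{(-t;q)_\infty}\,\kappa\!\left(\frac tz\right)\frac{dt}{t},\qquad |abz|<1;$$ and $$\mathrm{U}_{q,e}(a,b;z)=K_0\int_0^\infty\frac{(-bqt;q)_\infty\;{}_1\phi_1\!\left({q/a\atop -bqt};q;-aqt\right)}{t+z}\,\kappa(qt)\,dt,\qquad\text{when }|a|,|b|<1.$$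
   Context: Throughout $0<q<1$; $(a;q)_\infty=\prod_{n\ge0}(1-aq^n)$, $(a;q)_n=(a;q)_\infty/(aq^n;q)_\infty$, and $(a_1,\dots,a_k;q)_n=\prod_j(a_j;q)_n$ (also for $n=\infty$). The basic hypergeometric series is $${}_r\phi_s\!\left({a_1,\ldots,a_r\atop b_1,\ldots,b_s};q;x\right)=\sum_{n=0}^\infty\frac{(a_1,\ldots,a_r;q)_n}{(b_1,\ldots,b_s,q;q)_n}\left((-1)^nq^{\binom n2}\right)^{1+s-r}x^n,$$ extended by analytic continuation in $x$ when $r=s+1$. Let $C_q=1/\sqrt{-2\pi\ln q}$, $$E_q(\tau)=\exp\left(\frac{\ln^2(\tau/\sqrt q)}{2\ln q}\right),\qquad\theta_q(\tau)=(q,-\tau,-q/\tau;q)_\infty=\sum_{n=-\infty}^\infty q^{\binom n2}\tau^n,$$ and let $\kappa(t)=C_qE_q(t)$ if $e=E$, and $\kappa(t)=\frac{-1}{\ln(q)\,\theta_q(t)}$ if $e=\theta$. The function $\mathrm{U}_{q,e}$ ($e=E,\theta$), which is in general multivalued in $z$, is the $q$-Borel-Laplace resummation of the divergent series ${}_2\phi_0(a,b;-;q;z)$ defined by $$\mathrm{U}_{q,e}(a,b;z)=\int_0^\infty{}_2\phi_1\!\left({a,b\atop 0};q;-t\right)\kappa\!\left(\frac tz\right)\frac{dt}{t}.$$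
   Formalization: The second formula is asserted where its integral converges, i.e. for |a|<1 (it diverges for 1≤|a|<1/q); the fourth needs a≠0 and |arg z|<π, since its right side is single-valued and singular for negative z; for e=θ, |arg z|<π throughout, as κ(t/z) has poles on the path for z<0. *)

theory Defs
  imports "HOL-Complex_Analysis.Complex_Analysis"
begin

definition qpoch_inf :: "real \<Rightarrow> complex \<Rightarrow> complex" where
  "qpoch_inf q a = (\<Prod>n. 1 - a * of_real q ^ n)"

text \<open>The quotient of infinite products defining the finite symbol is 0/0 when
  \<open>a = q\<^sup>-\<^sup>m\<close>; the finite product is its value in all cases.\<close>

definition qpoch :: "real \<Rightarrow> complex \<Rightarrow> nat \<Rightarrow> complex" where
  "qpoch q a n = (\<Prod>k<n. 1 - a * of_real q ^ k)"

definition qpochs_inf :: "real \<Rightarrow> complex list \<Rightarrow> complex" where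
  "qpochs_inf q as = (\<Prod>a\<leftarrow>as. qpoch_inf q a)"

definition qpochs :: "real \<Rightarrow> complex list \<Rightarrow> nat \<Rightarrow> complex" where
  "qpochs q as n = (\<Prod>a\<leftarrow>as. qpoch q a n)"

definition qhyp_series :: "complex list \<Rightarrow> complex list \<Rightarrow> real \<Rightarrow> complex \<Rightarrow> complex" where
  "qhyp_series as bs q x =
     (\<Sum>n. qpochs q as n / qpochs q (bs @ [of_real q]) n
          * ((-1) ^ n * of_real q ^ (n choose 2)) powi (1 + int (length bs) - int (length as))
          * x ^ n)"

text \<open>For \<open>r = s + 1\<close> the series converges only in the unit disc in general; the function is its
  analytic continuation to the plane cut along \<open>[1, \<infinity>)\<close>. This domain is connected and contains
  the disc, so the continuation is unique on it. Values on the cut are unspecified.\<close>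

definition qhyp :: "complex list \<Rightarrow> complex list \<Rightarrow> real \<Rightarrow> complex \<Rightarrow> complex" where
  "qhyp as bs q =
     (if length as = Suc (length bs)
      then (SOME f. f holomorphic_on (- (complex_of_real ` {1..})) \<and>
                    (\<forall>x. norm x < 1 \<longrightarrow> f x = qhyp_series as bs q x))
      else qhyp_series as bs q)"

definition C_q :: "real \<Rightarrow> real" where
  "C_q q = 1 / sqrt (- 2 * pi * ln q)"

text \<open>\<open>E\<^sub>q(\<tau>)\<close> depends on the determination of the logarithm of \<open>\<tau>\<close>, so the argument \<open>l\<close> below is
  that logarithm, and \<open>\<tau> = exp l\<close>.\<close>

definition E_q :: "real \<Rightarrow> complex \<Rightarrow> complex" where
  "E_q q l = exp ((l - of_real (ln (sqrt q))) ^ 2 / (2 * of_real (ln q)))"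

definition theta_q :: "real \<Rightarrow> complex \<Rightarrow> complex" where
  "theta_q q \<tau> = qpochs_inf q [of_real q, - \<tau>, - of_real q / \<tau>]"

datatype kernel = Kernel_E | Kernel_theta

fun kappa :: "real \<Rightarrow> kernel \<Rightarrow> complex \<Rightarrow> complex" where
  "kappa q Kernel_E l = of_real (C_q q) * E_q q l"
| "kappa q Kernel_theta l = - 1 / (of_real (ln q) * theta_q q (exp l))"

text \<open>The integrand of \<open>U\<close> and \<open>U\<close> itself, as functions of a determination \<open>w\<close> of \<open>ln z\<close>;
  \<open>ln t - w\<close> is then the logarithm of \<open>t / z\<close>.\<close>

definition U_integrand :: "real \<Rightarrow> kernel \<Rightarrow> complex \<Rightarrow> complex \<Rightarrow> complex \<Rightarrow> real \<Rightarrow> complex" where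
  "U_integrand q e a b w t =
     qhyp [a, b] [0] q (- of_real t) * kappa q e (of_real (ln t) - w) / of_real t"

definition U_q :: "real \<Rightarrow> kernel \<Rightarrow> complex \<Rightarrow> complex \<Rightarrow> complex \<Rightarrow> complex" where
  "U_q q e a b w = (LBINT t:{0<..}. U_integrand q e a b w t)"

end

theory Submission
  imports Defs "HOL-Probability.Distributions"
begin

text \<open>
  With \<open>t = exp u\<close> the measure \<open>dt/t\<close> becomes \<open>du\<close> on the whole line, and the dilation
  \<open>t \<mapsto> q t\<close> becomes the translation \<open>u \<mapsto> u + ln q\<close>, under which integrals are invariant. Both
  kernels satisfy \<open>\<kappa>(q \<tau>) = \<tau> \<kappa>(\<tau>)\<close> and \<open>\<kappa>(q / \<tau>) = \<kappa>(\<tau>)\<close> and decay like a Gaussian in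
  \<open>ln \<tau>\<close>. So in an integral of a series one may replace \<open>t\<close> by \<open>q^n t\<close> in the \<open>n\<close>-th term: the
  factor \<open>q^(n choose 2) (t/z)^n\<close> that the kernel gives off turns one \<open>q\<close>-series under the integral
  sign into another. The last three formulas compare two integrands in this way, and the convergence of
  the integral that defines \<open>U\<close> is obtained likewise (\<open>U_log_backward\<close>).

  The first formula is an identity of integrands. Jackson's transformation
  \<open>(x;q)\<^sub>\<infinity> 2\<phi>1(a,b;0;q;x) = (bx;q)\<^sub>\<infinity> 1\<phi>1(b;bx;q;ax)\<close> holds in the unit disc, its right-hand side is
  entire in \<open>x\<close>, and \<open>(x;q)\<^sub>\<infinity>\<close> vanishes only on \<open>[1,\<infinity>)\<close>. This both shows that the continuation
  of \<open>2\<phi>1\<close> exists and computes it (\<open>qhyp_21_eq_jackson\<close>).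

  A limiting case of Jackson's transformation (\<open>jackson_sums\<close>) yields the next two formulas. For the
  second it gives \<open>2\<phi>1(a,b;0;q;-t) = (a;q)\<^sub>\<infinity> \<Sum> a^n/(q;q)\<^sub>n G(q^n t)\<close> with
  \<open>G(t) = (-bt;q)\<^sub>\<infinity>/(-t;q)\<^sub>\<infinity>\<close>; rescaling moves all terms to \<open>G(t)\<close>, and Euler's expansion sums
  the coefficients to \<open>(-aqz/t;q)\<^sub>\<infinity>\<close>. If \<open>|a| \<ge> 1\<close>, the resulting integrand is comparable to \<open>a^m\<close>
  near \<open>q^m t\<close> and hence not integrable (\<open>second_form_not_integrable\<close>), so the formula for
  \<open>|aq| < 1\<close>, which presupposes integrability, reduces to \<open>|a| < 1\<close>. For the third formula, both
  \<open>U\<close> and the integral of \<open>(-at,-bt;q)\<^sub>\<infinity>/(-t;q)\<^sub>\<infinity> \<kappa>(t/z)\<close> are rescaled in the opposite direction; the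
  two power series in \<open>az\<close> obtained under the integral sign differ by the factor \<open>(abz;q)\<^sub>\<infinity>\<close>,
  again by \<open>jackson_sums\<close>.

  For the fourth formula, the coefficient of \<open>x^k\<close> in \<open>2\<phi>1\<close> is a constant times the value at
  \<open>y = q^k\<close> of \<open>(qy;q)\<^sub>\<infinity>/((ay;q)\<^sub>\<infinity>(by;q)\<^sub>\<infinity>)\<close>, which is analytic on the closed unit disc when
  \<open>|a|, |b| < 1\<close>. Expanding it in powers of \<open>y\<close> gives the partial fraction expansion of \<open>2\<phi>1\<close> with
  poles \<open>q^-j\<close>. In each partial fraction the ray of integration is rotated by \<open>arg z\<close>, which meets
  no pole for \<open>|arg z| < \<pi>\<close> (\<open>stieltjes_kernel_rotation\<close>); the substitution of \<open>1/(q^j t)\<close>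
  for \<open>t\<close> with the reflection symmetry of the kernel then gives the common denominator \<open>t + z\<close>.
\<close>

section \<open>Exchanging sums, integrals and contours\<close>

text \<open>A bound by a product of two summable sequences makes the double series absolutely convergent, so that
  it may be summed by rows, by columns or along the diagonals \<open>n + m = k\<close>.\<close>

lemma double_series_rearrange:
  fixes F :: "nat \<Rightarrow> nat \<Rightarrow> complex" and A B :: "nat \<Rightarrow> real"
  assumes bound: "\<And>n m. norm (F n m) \<le> A n * B m"
    and A: "summable A" "\<And>n. 0 \<le> A n" and B: "summable B" "\<And>m. 0 \<le> B m"
  obtains S where "(\<lambda>k. \<Sum>n\<le>k. F n (k - n)) sums S"
    and "(\<lambda>n. \<Sum>m. F n m) sums S" and "(\<lambda>m. \<Sum>n. F n m) sums S"
    and "\<And>n. summable (\<lambda>m. F n m)" and "\<And>m. summable (\<lambda>n. F n m)"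
proof -
  have As: "A summable_on UNIV" and Bs: "B summable_on UNIV"
    using A B by (simp_all add: summable_on_UNIV_nonneg_real_iff)
  have "(\<lambda>(n, m). A n * B m) summable_on UNIV \<times> UNIV"
    using A(2) B(2)
    by (intro summable_on_SigmaI[where g = "\<lambda>n. A n * infsum B UNIV"])
       (auto intro!: has_sum_cmult_right summable_on_cmult_left has_sum_infsum As Bs)
  hence abs: "(\<lambda>p. norm (case p of (n, m) \<Rightarrow> F n m)) summable_on UNIV \<times> UNIV"
    by (rule summable_on_comparison_test) (use bound in auto)
  hence smF: "(\<lambda>(n, m). F n m) summable_on UNIV \<times> UNIV"
    by (rule abs_summable_summable)
  define S where "S = infsum (\<lambda>(n, m). F n m) (UNIV \<times> UNIV)"
  have hs: "((\<lambda>(n, m). F n m) has_sum S) (UNIV \<times> UNIV)"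
    unfolding S_def using smF by (rule has_sum_infsum)
  have row: "summable (\<lambda>m. norm (F n m))" for n
    by (rule summable_comparison_test'[OF summable_mult[OF B(1), of "A n"]]) (use bound in auto)
  have col: "summable (\<lambda>n. norm (F n m))" for m
    by (rule summable_comparison_test'[OF summable_mult2[OF A(1), of "B m"]]) (use bound in auto)
  have rowhs: "((\<lambda>m. F n m) has_sum (\<Sum>m. F n m)) UNIV" for n
    using norm_summable_imp_has_sum[OF row summable_sums[OF summable_norm_cancel[OF row]]] .
  have colhs: "((\<lambda>n. F n m) has_sum (\<Sum>n. F n m)) UNIV" for m
    using norm_summable_imp_has_sum[OF col summable_sums[OF summable_norm_cancel[OF col]]] .
  have 1: "((\<lambda>n. \<Sum>m. F n m) has_sum S) UNIV"
    by (rule has_sum_Sigma'[OF hs]) (use rowhs in auto)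
  have hs2: "((\<lambda>(m, n). F n m) has_sum S) (UNIV \<times> UNIV)"
    using hs by (subst has_sum_swap) (simp add: case_prod_unfold)
  have 2: "((\<lambda>m. \<Sum>n. F n m) has_sum S) UNIV"
    by (rule has_sum_Sigma'[OF hs2]) (use colhs in auto)
  have bij: "bij_betw (\<lambda>(k, n). (n, k - n)) (SIGMA k:UNIV. {..k}) (UNIV \<times> (UNIV :: nat set))"
    by (rule bij_betwI[where g = "\<lambda>(n, m). (n + m, n)"]) auto
  have "((\<lambda>(k, n). F n (k - n)) has_sum S) (SIGMA k:UNIV. {..k})"
    using has_sum_reindex_bij_betw[OF bij, of "\<lambda>(n, m). F n m" S] hs
    by (simp add: case_prod_unfold)
  hence 3: "((\<lambda>k. \<Sum>n\<le>k. F n (k - n)) has_sum S) UNIV"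
    by (rule has_sum_Sigma') (auto intro: has_sum_finite)
  show ?thesis
    by (rule that[OF has_sum_imp_sums[OF 3] has_sum_imp_sums[OF 1] has_sum_imp_sums[OF 2]])
       (use row col in \<open>auto intro: summable_norm_cancel\<close>)
qed

lemma prod_lessThan_add:
  fixes f :: "nat \<Rightarrow> 'a :: comm_monoid_mult"
  shows "(\<Prod>k<n + m. f k) = (\<Prod>k<n. f k) * (\<Prod>k<m. f (n + k))"
  by (induction m) (simp_all add: mult.assoc)

text \<open>Used to move an arbitrary point into a compact period strip.\<close>

lemma periodic_int:
  fixes \<rho> :: "complex \<Rightarrow> 'a"
  assumes "\<And>l. \<rho> (l + c) = \<rho> l" shows "\<rho> (l + of_int n * c) = \<rho> l"
proof (induction n arbitrary: l rule: int_induct[of _ 0])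
  case (step1 i)
  have "l + of_int (i + 1) * c = (l + c) + of_int i * c" by (simp add: algebra_simps)
  thus ?case using step1(2)[of "l + c"] assms by metis
next
  case (step2 i)
  have "l + of_int (i - 1) * c = (l - c) + of_int i * c" by (simp add: algebra_simps)
  hence "\<rho> (l + of_int (i - 1) * c) = \<rho> (l - c)" using step2(2)[of "l - c"] by metis
  thus ?case using assms[of "l - c"] by simp
qed simp

text \<open>On a compact interval this is integration by substitution; both sides are continuous along the
  exhaustion of the line by \<open>[-n, n]\<close>.\<close>

lemma distr_exp_lborel:
  "distr (density lborel (\<lambda>u. ennreal (exp u))) borel (exp :: real \<Rightarrow> real)
     = density lborel (\<lambda>t. ennreal (indicator {0<..} t))" (is "distr ?M borel exp = ?N")
proof (rule measure_eqI)
  fix A :: "real set" assume "A \<in> sets (distr ?M borel exp)"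
  hence A [measurable]: "A \<in> sets borel" by simp
  have piece: "emeasure ?M (exp -` A \<inter> {- real n..real n})
      = emeasure lborel (A \<inter> {exp (- real n)..exp (real n)})" for n
  proof -
    have [measurable]: "exp -` A \<inter> {- real n..real n} \<in> sets borel"
      using measurable_sets[of "exp :: real \<Rightarrow> real" borel borel A] by simp
    have "emeasure lborel (A \<inter> {exp (- real n)..exp (real n)})
        = (\<integral>\<^sup>+t. indicator (A \<inter> {exp (- real n)..exp (real n)}) t \<partial>lborel)"
      by (rule nn_integral_indicator[symmetric]) auto
    also have "\<dots> = (\<integral>\<^sup>+t. (indicator A t :: real) * indicator {exp (- real n)..exp (real n)} t \<partial>lborel)"
      by (intro nn_integral_cong) (auto split: split_indicator)
    also have "\<dots> = (\<integral>\<^sup>+u. (indicator A (exp u) :: real) * exp u * indicator {- real n..real n} u \<partial>lborel)"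
      by (rule nn_integral_substitution)
         (auto intro!: derivative_eq_intros continuous_intros simp: set_borel_measurable_def)
    also have "\<dots> = emeasure ?M (exp -` A \<inter> {- real n..real n})"
      by (subst emeasure_density) (auto intro!: nn_integral_cong simp: indicator_def)
    finally show ?thesis ..
  qed
  have "emeasure (distr ?M borel exp) A = emeasure ?M (exp -` A)"
    by (subst emeasure_distr) auto
  also have "exp -` A = (\<Union>n. exp -` A \<inter> {- real n..real n})"
  proof (intro equalityI subsetI)
    fix u :: real assume "u \<in> exp -` A"
    obtain n where "\<bar>u\<bar> \<le> real n" using real_arch_simple by blast
    with \<open>u \<in> exp -` A\<close> show "u \<in> (\<Union>n. exp -` A \<inter> {- real n..real n})"
      by (intro UN_I[of n]) auto
  qed auto
  also have "emeasure ?M \<dots> = (SUP n. emeasure ?M (exp -` A \<inter> {- real n..real n}))"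
    using measurable_sets[of "exp :: real \<Rightarrow> real" borel borel A]
    by (intro SUP_emeasure_incseq[symmetric]) (auto simp: incseq_def image_subset_iff)
  also have "\<dots> = (SUP n. emeasure lborel (A \<inter> {exp (- real n)..exp (real n)}))"
    by (simp only: piece)
  also have "\<dots> = emeasure lborel (\<Union>n. A \<inter> {exp (- real n)..exp (real n)})"
  proof (rule SUP_emeasure_incseq)
    show "incseq (\<lambda>n. A \<inter> {exp (- real n)..exp (real n)})"
      unfolding incseq_def by (intro allI impI Int_mono order_refl) auto
  qed auto
  also have "(\<Union>n. A \<inter> {exp (- real n)..exp (real n)}) = A \<inter> {0<..}"
  proof (intro equalityI subsetI)
    fix t assume t: "t \<in> A \<inter> {0<..}"
    obtain n where n: "\<bar>ln t\<bar> \<le> real n" using real_arch_simple by blast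
    have "exp (- real n) \<le> exp (ln t)" "exp (ln t) \<le> exp (real n)"
      unfolding exp_le_cancel_iff using n by auto
    with t show "t \<in> (\<Union>n. A \<inter> {exp (- real n)..exp (real n)})"
      by (intro UN_I[of n]) auto
  next
    fix t assume "t \<in> (\<Union>n. A \<inter> {exp (- real n)..exp (real n)})"
    then obtain n where "t \<in> A" "exp (- real n) \<le> t" by auto
    thus "t \<in> A \<inter> {0<..}" using exp_gt_zero[of "- real n"] by (auto simp del: exp_gt_zero)
  qed
  also have "emeasure lborel (A \<inter> {0<..}) = emeasure ?N A"
  proof -
    have "emeasure ?N A = (\<integral>\<^sup>+t. ennreal (indicator {0<..} t) * indicator A t \<partial>lborel)"
      by (rule emeasure_density) auto
    also have "\<dots> = (\<integral>\<^sup>+t. indicator (A \<inter> {0<..}) t \<partial>lborel)"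
      by (intro nn_integral_cong) (auto split: split_indicator)
    also have "\<dots> = emeasure lborel (A \<inter> {0<..})"
      by (rule nn_integral_indicator) auto
    finally show ?thesis ..
  qed
  finally show "emeasure (distr ?M borel exp) A = emeasure ?N A" .
qed simp

text \<open>Integrability is an equivalence here because non-integrability on one side has to be carried over to
  the other as well; measurability passes between \<open>f\<close> and \<open>F\<close> along \<open>exp\<close> and \<open>ln\<close>.\<close>

lemma exp_substitution:
  fixes f F :: "real \<Rightarrow> complex"
  assumes F: "\<And>u. F u = f (exp u) * of_real (exp u)"
  shows "set_integrable lborel {0<..} f \<longleftrightarrow> integrable lborel F"
    and "(LBINT t:{0<..}. f t) = integral\<^sup>L lborel F"
proof -
  let ?M = "density lborel (\<lambda>u. ennreal (exp u))"
    and ?N = "density lborel (\<lambda>t. ennreal (indicator {0<..} t))"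
  define g where "g t = indicator {0<..} t *\<^sub>R f t" for t :: real
  have gF: "exp u *\<^sub>R g (exp u) = F u" for u
    by (simp add: g_def F scaleR_conv_of_real)
  have gg: "indicator {0<..} t *\<^sub>R g t = g t" for t
    by (simp add: g_def indicator_def)
  have main: "(integrable lborel g \<longleftrightarrow> integrable lborel F) \<and> integral\<^sup>L lborel g = integral\<^sup>L lborel F"
    if [measurable]: "g \<in> borel_measurable borel"
  proof -
    have "integrable lborel g \<longleftrightarrow> integrable ?N g"
      by (subst integrable_density) (auto simp: gg)
    also have "\<dots> \<longleftrightarrow> integrable ?M (\<lambda>u. g (exp u))"
      unfolding distr_exp_lborel[symmetric] by (subst integrable_distr_eq) auto
    also have "\<dots> \<longleftrightarrow> integrable lborel F"
      by (subst integrable_density) (auto simp: gF)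
    finally have 1: "integrable lborel g \<longleftrightarrow> integrable lborel F" .
    have "integral\<^sup>L lborel g = integral\<^sup>L ?N g"
      by (subst integral_density) (auto simp: gg)
    also have "\<dots> = integral\<^sup>L ?M (\<lambda>u. g (exp u))"
      unfolding distr_exp_lborel[symmetric] by (subst integral_distr) auto
    also have "\<dots> = integral\<^sup>L lborel F"
      by (subst integral_density) (auto simp: gF)
    finally show ?thesis using 1 by blast
  qed
  have meas: "g \<in> borel_measurable borel \<longleftrightarrow> F \<in> borel_measurable borel"
  proof
    assume [measurable]: "g \<in> borel_measurable borel"
    show "F \<in> borel_measurable borel" unfolding gF[symmetric] by measurable
  next
    assume [measurable]: "F \<in> borel_measurable borel"
    have "g = (\<lambda>t. indicator {0<..} t *\<^sub>R (F (ln t) / of_real t))"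
      by (rule ext) (auto simp: g_def F indicator_def)
    also have "\<dots> \<in> borel_measurable borel" by measurable
    finally show "g \<in> borel_measurable borel" .
  qed
  have "(integrable lborel g \<longleftrightarrow> integrable lborel F) \<and> integral\<^sup>L lborel g = integral\<^sup>L lborel F"
  proof (cases "g \<in> borel_measurable borel")
    case True
    thus ?thesis by (rule main)
  next
    case False
    hence "\<not> integrable lborel g" "\<not> integrable lborel F" using meas by auto
    thus ?thesis by (simp add: not_integrable_integral_eq)
  qed
  thus "set_integrable lborel {0<..} f \<longleftrightarrow> integrable lborel F"
    and "(LBINT t:{0<..}. f t) = integral\<^sup>L lborel F"
    unfolding set_integrable_def set_lebesgue_integral_def g_def by auto
qed

text \<open>The tool for rescaling a series term by term: translations and reflections preserve \<open>\<integral>f\<close> and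
  \<open>\<integral>|f|\<close> of each single term, so Fubini's condition for the terms \<open>g n\<close> is at the same time
  Fubini's condition for their transforms \<open>f n\<close>. Only the former is ever estimated, whichever of the
  two is easier to bound.\<close>

lemma integral_series_affine:
  fixes g f :: "nat \<Rightarrow> real \<Rightarrow> complex"
  assumes meas: "\<And>n. g n \<in> borel_measurable borel"
    and bound: "\<And>n u. norm (g n u) \<le> A n * h u"
    and A: "summable A" and h: "integrable lborel h"
    and f: "\<And>n u. f n u = g n (\<tau> n + c * u)" and c: "\<bar>c\<bar> = 1"
    and summable_f: "\<And>u. summable (\<lambda>n. norm (f n u))"
  shows "integrable lborel (\<lambda>u. \<Sum>n. f n u)" and "integrable lborel (\<lambda>u. \<Sum>n. g n u)"
    and "(\<lambda>n. integral\<^sup>L lborel (g n)) sums integral\<^sup>L lborel (\<lambda>u. \<Sum>n. g n u)"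
    and "integral\<^sup>L lborel (\<lambda>u. \<Sum>n. f n u) = integral\<^sup>L lborel (\<lambda>u. \<Sum>n. g n u)"
proof -
  have c0: "c \<noteq> 0" using c by auto
  have int_g: "integrable lborel (g n)" for n
    using meas[of n] by (intro Bochner_Integration.integrable_bound[OF integrable_mult_right[OF h, of "A n"]])
       (auto intro!: AE_I2 order_trans[OF bound])
  have int_f: "integrable lborel (f n)" for n
    using lborel_integrable_real_affine[OF int_g c0, of n "\<tau> n"] by (simp add: f[abs_def])
  have norm_g: "(\<integral>u. norm (g n u) \<partial>lborel) \<le> A n * integral\<^sup>L lborel h" for n
  proof -
    have "(\<integral>u. norm (g n u) \<partial>lborel) \<le> (\<integral>u. A n * h u \<partial>lborel)"
      by (intro integral_mono integrable_norm int_g integrable_mult_right h bound)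
    thus ?thesis by simp
  qed
  have eq: "integral\<^sup>L lborel (f n) = integral\<^sup>L lborel (g n)" for n
    using lborel_integral_real_affine[OF c0, of "g n" "\<tau> n"] c by (simp add: f[abs_def])
  have norm_eq: "(\<integral>u. norm (f n u) \<partial>lborel) = (\<integral>u. norm (g n u) \<partial>lborel)" for n
    using lborel_integral_real_affine[OF c0, of "\<lambda>u. norm (g n u)" "\<tau> n"] c by (simp add: f[abs_def])
  have sum_g: "summable (\<lambda>n. \<integral>u. norm (g n u) \<partial>lborel)"
    by (rule summable_comparison_test'[OF summable_mult2[OF A, of "integral\<^sup>L lborel h"]])
       (use norm_g in \<open>auto simp: integral_nonneg_AE\<close>)
  have summable_g: "summable (\<lambda>n. norm (g n u))" for u
    by (rule summable_comparison_test'[OF summable_mult2[OF A, of "h u"]]) (use bound in auto)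
  show "integrable lborel (\<lambda>u. \<Sum>n. f n u)"
    using int_f summable_f sum_g unfolding norm_eq[symmetric] by (intro integrable_suminf) auto
  show "integrable lborel (\<lambda>u. \<Sum>n. g n u)"
    using int_g summable_g sum_g by (intro integrable_suminf) auto
  show "(\<lambda>n. integral\<^sup>L lborel (g n)) sums integral\<^sup>L lborel (\<lambda>u. \<Sum>n. g n u)"
    using int_g summable_g sum_g by (intro sums_integral) auto
  have "integral\<^sup>L lborel (\<lambda>u. \<Sum>n. f n u) = (\<Sum>n. integral\<^sup>L lborel (f n))"
    using int_f summable_f sum_g unfolding norm_eq[symmetric] by (intro integral_suminf) auto
  also have "\<dots> = integral\<^sup>L lborel (\<lambda>u. \<Sum>n. g n u)"
    unfolding eq using int_g summable_g sum_g by (intro integral_suminf[symmetric]) auto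
  finally show "integral\<^sup>L lborel (\<lambda>u. \<Sum>n. f n u) = integral\<^sup>L lborel (\<lambda>u. \<Sum>n. g n u)" .
qed

text \<open>A \<open>1\<phi>1\<close> whose lower parameter is \<open>-bt\<close> has a vanishing denominator when \<open>-b t q^k = 1\<close>. This
  happens for countably many \<open>t\<close> only, which the integrals do not notice.\<close>

lemma lborel_discrete_difference:
  fixes F H :: "real \<Rightarrow> complex"
  assumes "countable X" "\<And>u. u \<notin> X \<Longrightarrow> F u = H u"
  shows "integrable lborel F \<longleftrightarrow> integrable lborel H" "integral\<^sup>L lborel F = integral\<^sup>L lborel H"
proof -
  show "integrable lborel F \<longleftrightarrow> integrable lborel H"
    by (rule integrable_discrete_difference[of X]) (use assms in auto)
  show "integral\<^sup>L lborel F = integral\<^sup>L lborel H"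
    by (rule integral_discrete_difference[of X]) (use assms in auto)
qed

text \<open>On the convex set \<open>S\<close> the integrand has a primitive \<open>G\<close>, so the integrals over \<open>[-n, n]\<close> at the two
  heights differ by increments of \<open>G\<close> along the vertical segments above \<open>n\<close> and \<open>-n\<close>. By the mean
  value inequality these are at most \<open>h (\<plusminus>n) |\<eta>|\<close>, which tends to 0.\<close>

lemma contour_shift_horizontal:
  fixes g :: "complex \<Rightarrow> complex" and \<eta> :: real
  assumes hol: "g holomorphic_on S" and S: "open S" "convex S"
    and sub: "\<And>x s. s \<in> {0..1} \<Longrightarrow> Complex x (s * \<eta>) \<in> S"
    and bound: "\<And>x s. s \<in> {0..1} \<Longrightarrow> norm (g (Complex x (s * \<eta>))) \<le> h x"
    and h: "(h \<longlongrightarrow> 0) at_top" "(h \<longlongrightarrow> 0) at_bot" "integrable lborel h"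
  shows "(LBINT x. g (Complex x 0)) = (LBINT x. g (Complex x \<eta>))"
proof -
  obtain G where G: "\<And>z. z \<in> S \<Longrightarrow> (G has_field_derivative g z) (at z within S)"
    using holomorphic_convex_primitive'[OF S(2,1) hol] by blast
  have G': "(G has_field_derivative g z) (at z)" if "z \<in> S" for z
    using G[OF that] at_within_open[OF that S(1)] by simp
  have cont: "continuous_on S g" using hol by (rule holomorphic_on_imp_continuous_on)
  have line: "continuous_on UNIV (\<lambda>x. g (Complex x (s * \<eta>)))" if "s \<in> {0..1}" for s
  proof (rule continuous_on_compose2[OF cont])
    show "continuous_on UNIV (\<lambda>x. Complex x (s * \<eta>))"
      unfolding Complex_eq by (intro continuous_intros)
  qed (use sub that in auto)
  have int: "integrable lborel (\<lambda>x. g (Complex x (s * \<eta>)))" if "s \<in> {0..1}" for s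
  proof (rule Bochner_Integration.integrable_bound[OF h(3)])
    show "(\<lambda>x. g (Complex x (s * \<eta>))) \<in> borel_measurable lborel"
      using borel_measurable_continuous_onI[OF line[OF that]] by simp
    show "AE x in lborel. norm (g (Complex x (s * \<eta>))) \<le> norm (h x)"
      using bound[OF that] by (intro AE_I2) (auto intro: order_trans[OF _ abs_ge_self])
  qed
  define I where "I s n = (\<integral>x. indicator {- real n..real n} x *\<^sub>R g (Complex x (s * \<eta>)) \<partial>lborel)"
    for s and n :: nat
  have FTC: "I s n = G (Complex (real n) (s * \<eta>)) - G (Complex (- real n) (s * \<eta>))"
    if "s \<in> {0..1}" for s n
    unfolding I_def
  proof (rule integral_FTC_Icc)
    fix x :: real
    have "((\<lambda>x. Complex x (s * \<eta>)) has_vector_derivative 1) (at x within {- real n..real n})"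
      unfolding Complex_eq by (auto intro!: derivative_eq_intros)
    from field_vector_diff_chain_within[OF this has_field_derivative_at_within[OF G'[OF sub[OF that]]]]
    show "((\<lambda>x. G (Complex x (s * \<eta>))) has_vector_derivative g (Complex x (s * \<eta>)))
        (at x within {- real n..real n})"
      by (simp add: o_def)
  qed (use continuous_on_subset[OF line[OF that]] in auto)
  have lim: "I s \<longlonglongrightarrow> (LBINT x. g (Complex x (s * \<eta>)))" if s: "s \<in> {0..1}" for s
    unfolding I_def
  proof (rule integral_dominated_convergence[OF _ _ h(3)])
    show "AE x in lborel. (\<lambda>n. indicator {- real n..real n} x *\<^sub>R g (Complex x (s * \<eta>)))
        \<longlonglongrightarrow> g (Complex x (s * \<eta>))"
    proof (intro AE_I2 tendsto_eventually)
      fix x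
      obtain N where "\<bar>x\<bar> \<le> real N" using real_arch_simple by blast
      thus "\<forall>\<^sub>F n in sequentially. indicator {- real n..real n} x *\<^sub>R g (Complex x (s * \<eta>))
          = g (Complex x (s * \<eta>))"
        by (intro eventually_sequentiallyI[of N]) (auto simp: indicator_def)
    qed
    show "AE x in lborel. norm (indicator {- real n..real n} x *\<^sub>R g (Complex x (s * \<eta>))) \<le> h x" for n
      using bound[OF s] by (intro AE_I2) (auto simp: indicator_def intro: order_trans[OF norm_ge_zero])
  qed (use int[OF s] in auto)
  have vertical: "norm (G (Complex x \<eta>) - G (Complex x 0)) \<le> h x * \<bar>\<eta>\<bar>" for x
  proof -
    have seg: "\<exists>s\<in>{0..1}. z = Complex x (s * \<eta>)" if "z \<in> closed_segment (Complex x 0) (Complex x \<eta>)" for z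
      using that by (auto simp: closed_segment_def complex_eq_iff intro!: bexI) (auto simp: algebra_simps)
    have "norm (G (Complex x \<eta>) - G (Complex x 0)) \<le> h x * norm (Complex x \<eta> - Complex x 0)"
    proof (rule field_differentiable_bound)
      fix z assume "z \<in> closed_segment (Complex x 0) (Complex x \<eta>)"
      then obtain s where s: "s \<in> {0..1}" "z = Complex x (s * \<eta>)" using seg by blast
      show "(G has_field_derivative g z) (at z within closed_segment (Complex x 0) (Complex x \<eta>))"
        unfolding s(2) by (rule has_field_derivative_at_within[OF G'[OF sub[OF s(1)]]])
      show "norm (g z) \<le> h x" unfolding s(2) by (rule bound[OF s(1)])
    qed auto
    also have "norm (Complex x \<eta> - Complex x 0) = \<bar>\<eta>\<bar>"
      by (simp add: cmod_def)
    finally show ?thesis .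
  qed
  have "(\<lambda>n. I 1 n - I 0 n) \<longlonglongrightarrow> 0"
  proof (rule Lim_null_comparison)
    show "\<forall>\<^sub>F n in sequentially. norm (I 1 n - I 0 n) \<le> h (real n) * \<bar>\<eta>\<bar> + h (- real n) * \<bar>\<eta>\<bar>"
    proof (intro always_eventually allI)
      fix n
      have "I 1 n - I 0 n = (G (Complex (real n) \<eta>) - G (Complex (real n) 0))
          - (G (Complex (- real n) \<eta>) - G (Complex (- real n) 0))"
        using FTC[of 1 n] FTC[of 0 n] by simp
      thus "norm (I 1 n - I 0 n) \<le> h (real n) * \<bar>\<eta>\<bar> + h (- real n) * \<bar>\<eta>\<bar>"
        using order_trans[OF norm_triangle_ineq4 add_mono[OF vertical[of "real n"] vertical[of "- real n"]]]
        by simp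
    qed
    have "(\<lambda>n. h (real n)) \<longlonglongrightarrow> 0"
      using h(1) filterlim_real_sequentially by (rule filterlim_compose)
    moreover have "(\<lambda>n. h (- real n)) \<longlonglongrightarrow> 0"
      using h(2) by (rule filterlim_compose)
        (simp add: filterlim_uminus_at_bot filterlim_real_sequentially)
    ultimately show "(\<lambda>n. h (real n) * \<bar>\<eta>\<bar> + h (- real n) * \<bar>\<eta>\<bar>) \<longlonglongrightarrow> 0"
      by (auto intro!: tendsto_eq_intros)
  qed
  moreover have "(\<lambda>n. I 1 n - I 0 n) \<longlonglongrightarrow> (LBINT x. g (Complex x \<eta>)) - (LBINT x. g (Complex x 0))"
    using tendsto_diff[OF lim[of 1] lim[of 0]] by simp
  ultimately show ?thesis
    using LIMSEQ_unique by fastforce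
qed

section \<open>Infinite \<open>q\<close>-products\<close>

locale q_base =
  fixes q :: real
  assumes q_pos: "0 < q" and q_less_1: "q < 1"
begin

abbreviation qc :: complex where "qc \<equiv> complex_of_real q"

definition euler_coeff :: "nat \<Rightarrow> complex" where
  "euler_coeff n = (-1) ^ n * qc ^ (n choose 2) / qpoch q qc n"

lemma qpoch_0 [simp]: "qpoch q a 0 = 1"
  by (simp add: qpoch_def)

lemma qpoch_Suc: "qpoch q a (Suc n) = qpoch q a n * (1 - a * qc ^ n)"
  by (simp add: qpoch_def)

lemma qpoch_zero_arg [simp]: "qpoch q 0 n = 1"
  by (simp add: qpoch_def)

lemma qpoch_add: "qpoch q a (n + m) = qpoch q a n * qpoch q (a * qc ^ n) m"
  by (induction m) (simp_all add: qpoch_Suc power_add mult_ac)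

lemma norm_qc: "norm qc = q"
  using q_pos by simp

lemma norm_qc_power [simp]: "norm (qc ^ n) = q ^ n"
  using q_pos by (simp add: norm_power)

lemma qpow_pos: "0 < q ^ n" and qpow_le_1: "q ^ n \<le> 1"
  using q_pos q_less_1 by (simp_all add: power_le_one)

lemma qc_power_neq_1: "qc ^ Suc n \<noteq> 1"
proof
  assume "qc ^ Suc n = 1"
  hence "q ^ Suc n = 1" by (metis of_real_eq_1_iff of_real_power)
  thus False using q_pos q_less_1 by (metis power_Suc_less_one less_irrefl)
qed

lemma qpoch_qq_nonzero [simp]: "qpoch q qc n \<noteq> 0"
  using qc_power_neq_1 by (auto simp: qpoch_def)

lemma qpoch_qq_Suc: "qpoch q qc (Suc n) = qpoch q qc n * (1 - qc ^ Suc n)"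
  by (simp add: qpoch_Suc)

lemma convergent_prod_qpoch: "convergent_prod (\<lambda>n. 1 - a * qc ^ n)"
proof (intro abs_convergent_prod_imp_convergent_prod summable_imp_abs_convergent_prod)
  have "summable (\<lambda>n. norm a * q ^ n)"
    using q_pos q_less_1 by (intro summable_mult summable_geometric) auto
  thus "summable (\<lambda>n. norm (1 - a * qc ^ n - 1))"
    by (simp add: norm_mult)
qed

lemma qpoch_tendsto: "(\<lambda>n. qpoch q a n) \<longlonglongrightarrow> qpoch_inf q a"
  unfolding qpoch_def qpoch_inf_def
  by (rule LIMSEQ_lessThan_iff_atMost[THEN iffD2, OF convergent_prod_LIMSEQ[OF convergent_prod_qpoch]])

lemma qpoch_inf_eq_0_iff: "qpoch_inf q a = 0 \<longleftrightarrow> (\<exists>k. a * qc ^ k = 1)"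
proof -
  have "(\<lambda>n. 1 - a * qc ^ n) has_prod qpoch_inf q a"
    unfolding qpoch_inf_def by (rule convergent_prod_has_prod[OF convergent_prod_qpoch])
  from has_prod_eq_0_iff[OF this] show ?thesis by (auto simp: image_iff)
qed

lemma qpoch_inf_nonzero_if_norm_less_1:
  assumes "norm a < 1" shows "qpoch_inf q a \<noteq> 0"
proof
  assume "qpoch_inf q a = 0"
  then obtain k where "a * qc ^ k = 1" by (auto simp: qpoch_inf_eq_0_iff)
  hence "norm a * q ^ k = 1" by (metis norm_mult norm_qc_power norm_one)
  moreover have "norm a * q ^ k \<le> norm a * 1"
    using qpow_le_1 by (intro mult_left_mono) auto
  ultimately show False using assms by simp
qed

lemma qpoch_inf_split: "qpoch_inf q a = qpoch q a n * qpoch_inf q (a * qc ^ n)"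
proof -
  have "(\<lambda>m. qpoch q a (n + m)) \<longlonglongrightarrow> qpoch_inf q a"
    using LIMSEQ_ignore_initial_segment[OF qpoch_tendsto, of a n] by (simp add: add.commute)
  moreover have "(\<lambda>m. qpoch q a (n + m)) \<longlonglongrightarrow> qpoch q a n * qpoch_inf q (a * qc ^ n)"
    unfolding qpoch_add by (intro tendsto_intros qpoch_tendsto)
  ultimately show ?thesis by (rule LIMSEQ_unique)
qed

lemma qpoch_inf_step: "qpoch_inf q a = (1 - a) * qpoch_inf q (a * qc)"
  using qpoch_inf_split[of a 1] by (simp add: qpoch_def)

lemma qpoch_inf_0 [simp]: "qpoch_inf q 0 = 1"
  by (simp add: qpoch_inf_def)

lemma qpoch_ratio_bounded: "\<exists>C>0. \<forall>n. norm (qpoch q a n / qpoch q qc n) \<le> C"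
proof -
  have nz: "qpoch_inf q qc \<noteq> 0"
    using q_pos q_less_1 by (intro qpoch_inf_nonzero_if_norm_less_1) simp
  have "(\<lambda>n. qpoch q a n / qpoch q qc n) \<longlonglongrightarrow> qpoch_inf q a / qpoch_inf q qc"
    by (intro tendsto_intros qpoch_tendsto nz)
  hence "Bseq (\<lambda>n. qpoch q a n / qpoch q qc n)"
    by (intro convergent_imp_Bseq) (auto simp: convergent_def)
  thus ?thesis by (auto simp: Bseq_def)
qed

lemma qpoch_bounded: "\<exists>C>0. \<forall>n. norm (qpoch q a n) \<le> C"
proof -
  have "Bseq (\<lambda>n. qpoch q a n)"
    using qpoch_tendsto by (intro convergent_imp_Bseq) (auto simp: convergent_def)
  thus ?thesis by (auto simp: Bseq_def)
qed

lemma choose_two_Suc: "Suc n choose 2 = (n choose 2) + n"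
  by (simp add: numeral_2_eq_2)

text \<open>The ratio of consecutive terms is \<open>q^n X\<close>, which tends to 0.\<close>

lemma summable_q_gauss: "summable (\<lambda>n. q ^ (n choose 2) * X ^ n)" if "0 \<le> X" for X :: real
proof -
  have "(\<lambda>n. q ^ n * X) \<longlonglongrightarrow> 0 * X"
    using q_pos q_less_1 by (intro tendsto_intros LIMSEQ_power_zero) auto
  hence "eventually (\<lambda>n. q ^ n * X < 1/2) sequentially"
    by (rule order_tendstoD) auto
  then obtain N where N: "\<And>n. n \<ge> N \<Longrightarrow> q ^ n * X < 1/2"
    by (auto simp: eventually_sequentially)
  show ?thesis
  proof (rule summable_ratio_test[of "1/2" N])
    fix n assume "n \<ge> N"
    have "norm (q ^ (Suc n choose 2) * X ^ Suc n) = (q ^ n * X) * norm (q ^ (n choose 2) * X ^ n)"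
      using q_pos that by (simp add: choose_two_Suc power_add abs_mult)
    also have "\<dots> \<le> 1/2 * norm (q ^ (n choose 2) * X ^ n)"
      using N[OF \<open>n \<ge> N\<close>] by (intro mult_right_mono) auto
    finally show "norm (q ^ (Suc n choose 2) * X ^ Suc n) \<le> 1/2 * norm (q ^ (n choose 2) * X ^ n)" .
  qed simp
qed

lemma summable_norm_euler: "summable (\<lambda>n. norm (euler_coeff n * x ^ n))"
proof -
  obtain C where C: "C > 0" "\<And>n. norm (qpoch q 0 n / qpoch q qc n) \<le> C"
    using qpoch_ratio_bounded[of 0] by blast
  show ?thesis
  proof (rule summable_comparison_test')
    show "summable (\<lambda>n. C * (q ^ (n choose 2) * norm x ^ n))"
      by (intro summable_mult summable_q_gauss) auto
    fix n
    have "norm (euler_coeff n * x ^ n)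
        = norm (qpoch q 0 n / qpoch q qc n) * (q ^ (n choose 2) * norm x ^ n)"
      by (simp add: euler_coeff_def norm_mult norm_divide norm_power del: norm_qc_power)
         (simp add: q_pos less_imp_le)
    also have "\<dots> \<le> C * (q ^ (n choose 2) * norm x ^ n)"
      using C q_pos by (intro mult_right_mono) auto
    finally show "norm (norm (euler_coeff n * x ^ n)) \<le> C * (q ^ (n choose 2) * norm x ^ n)" by simp
  qed
qed

lemma euler_coeff_0 [simp]: "euler_coeff 0 = 1"
  by (simp add: euler_coeff_def numeral_2_eq_2)

lemma euler_coeff_Suc: "(1 - qc ^ Suc n) * euler_coeff (Suc n) = - (qc ^ n) * euler_coeff n"
  using qc_power_neq_1[of n] qpoch_qq_nonzero[of n]
  by (simp add: euler_coeff_def qpoch_qq_Suc choose_two_Suc power_add field_simps)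

text \<open>A \<open>q\<close>-difference equation of first order determines a function that is continuous at 0: iterating
  it moves the argument to 0 while the coefficients build up infinite products.\<close>

lemma q_iteration_limit:
  assumes "isCont S 0" "S 0 = 1"
    and "\<And>n. qpoch q b n * S x = qpoch q a n * S (x * qc ^ n)"
  shows "qpoch_inf q b * S x = qpoch_inf q a"
proof -
  have "(\<lambda>n. x * qc ^ n) \<longlonglongrightarrow> x * 0"
    using q_pos q_less_1 by (intro tendsto_intros LIMSEQ_power_zero) auto
  hence "(\<lambda>n. S (x * qc ^ n)) \<longlonglongrightarrow> 1"
    using isCont_tendsto_compose[OF assms(1), of "\<lambda>n. x * qc ^ n"] assms(2) by simp
  hence "(\<lambda>n. qpoch q a n * S (x * qc ^ n)) \<longlonglongrightarrow> qpoch_inf q a * 1"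
    by (intro tendsto_intros qpoch_tendsto)
  moreover have "(\<lambda>n. qpoch q b n * S x) \<longlonglongrightarrow> qpoch_inf q b * S x"
    by (intro tendsto_intros qpoch_tendsto)
  ultimately show ?thesis
    using assms(3) LIMSEQ_unique by (metis (no_types, lifting) LIMSEQ_unique ext mult.right_neutral)
qed

lemma isCont_power_series_0:
  fixes c :: "nat \<Rightarrow> complex"
  assumes "summable (\<lambda>n. c n * K ^ n)" "K \<noteq> 0"
  shows "isCont (\<lambda>x. \<Sum>n. c n * x ^ n) 0"
  using assms by (intro isCont_powser[of c K]) auto

text \<open>Euler's expansion of \<open>(x;q)\<^sub>\<infinity>\<close>: the series satisfies \<open>S(x) = (1 - x) S(qx)\<close>, as its coefficients
  satisfy the corresponding recursion.\<close>

theorem euler_sums: "(\<lambda>n. euler_coeff n * x ^ n) sums qpoch_inf q x"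
proof -
  define S where "S y = (\<Sum>n. euler_coeff n * y ^ n)" for y
  have sm: "summable (\<lambda>n. euler_coeff n * y ^ n)" for y
    using summable_norm_euler by (rule summable_norm_cancel)
  have step: "S y = (1 - y) * S (y * qc)" for y
  proof -
    have "(\<lambda>n. euler_coeff (Suc n) * y ^ Suc n) sums (S y - 1)"
      using sm[of y, THEN summable_sums] unfolding S_def[symmetric]
      by (subst sums_Suc_iff) simp
    moreover have "(\<lambda>n. euler_coeff (Suc n) * (y * qc) ^ Suc n) sums (S (y * qc) - 1)"
      using sm[of "y * qc", THEN summable_sums] unfolding S_def[symmetric]
      by (subst sums_Suc_iff) simp
    ultimately have "(\<lambda>n. euler_coeff (Suc n) * y ^ Suc n - euler_coeff (Suc n) * (y * qc) ^ Suc n)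
        sums ((S y - 1) - (S (y * qc) - 1))"
      by (rule sums_diff)
    moreover have "euler_coeff (Suc n) * y ^ Suc n - euler_coeff (Suc n) * (y * qc) ^ Suc n
        = (- y) * (euler_coeff n * (y * qc) ^ n)" for n
    proof -
      have "euler_coeff (Suc n) * y ^ Suc n - euler_coeff (Suc n) * (y * qc) ^ Suc n
        = ((1 - qc ^ Suc n) * euler_coeff (Suc n)) * y ^ Suc n"
        by (simp add: power_mult_distrib algebra_simps)
      also have "\<dots> = (- y) * (euler_coeff n * (y * qc) ^ n)"
        unfolding euler_coeff_Suc by (simp add: power_mult_distrib)
      finally show ?thesis .
    qed
    moreover have "(\<lambda>n. (- y) * (euler_coeff n * (y * qc) ^ n)) sums ((- y) * S (y * qc))"
      using sm[of "y * qc", THEN summable_sums] unfolding S_def[symmetric] by (rule sums_mult)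
    ultimately have "(S y - 1) - (S (y * qc) - 1) = (- y) * S (y * qc)"
      using sums_unique2 by simp
    thus ?thesis by (simp add: algebra_simps)
  qed
  have it: "qpoch q 0 n * S x = qpoch q x n * S (x * qc ^ n)" for n
  proof (induction n)
    case (Suc n)
    show ?case using Suc step[of "x * qc ^ n"] by (simp add: qpoch_Suc mult_ac)
  qed simp
  have "isCont S 0"
    unfolding S_def using sm[of 1] by (intro isCont_power_series_0[of _ 1]) auto
  moreover have "S 0 = 1"
    unfolding S_def powser_zero by simp
  ultimately have "S x = qpoch_inf q x"
    using q_iteration_limit[OF _ _ it] by simp
  thus ?thesis using sm[of x, THEN summable_sums] by (simp add: S_def)
qed

text \<open>The product is the sum of Euler's everywhere convergent power series, which spares estimates for the
  convergence of the product.\<close>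

lemma qpoch_inf_holomorphic [holomorphic_intros]:
  assumes "f holomorphic_on A"
  shows "(\<lambda>x. qpoch_inf q (f x)) holomorphic_on A"
proof -
  have "qpoch_inf q holomorphic_on UNIV"
  proof -
    have sm: "summable (\<lambda>n. euler_coeff n * y ^ n)" for y
      using summable_norm_euler by (rule summable_norm_cancel)
    have "(\<lambda>w. \<Sum>n. euler_coeff n * w ^ n) field_differentiable at x" for x
      unfolding field_differentiable_def
      by (rule exI, rule termdiffs_strong_converges_everywhere[OF sm])
    moreover have "(\<lambda>w. \<Sum>n. euler_coeff n * w ^ n) = qpoch_inf q"
      by (rule ext) (rule sums_unique[OF euler_sums, symmetric])
    ultimately show ?thesis
      unfolding holomorphic_on_def by (metis field_differentiable_at_within)
  qed
  from holomorphic_on_compose_gen[OF assms this] show ?thesis by (simp add: o_def)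
qed

lemma qpoch_inf_continuous [continuous_intros]:
  assumes "continuous_on A f"
  shows "continuous_on A (\<lambda>x. qpoch_inf q (f x))"
proof -
  have "continuous_on UNIV (qpoch_inf q)"
    by (rule holomorphic_on_imp_continuous_on[OF qpoch_inf_holomorphic[OF holomorphic_on_ident]])
  from continuous_on_compose2[OF this assms] show ?thesis by simp
qed

lemma summable_qbinomial:
  assumes "norm x < 1"
  shows "summable (\<lambda>n. norm (qpoch q a n / qpoch q qc n * x ^ n))"
proof -
  obtain C where C: "C > 0" "\<And>n. norm (qpoch q a n / qpoch q qc n) \<le> C"
    using qpoch_ratio_bounded[of a] by blast
  show ?thesis
  proof (rule summable_comparison_test')
    show "summable (\<lambda>n. C * norm x ^ n)"
      using assms by (intro summable_mult summable_geometric) auto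
    show "norm (norm (qpoch q a n / qpoch q qc n * x ^ n)) \<le> C * norm x ^ n" for n
      using mult_right_mono[OF C(2)[of n], of "norm (x ^ n)"]
      by (simp add: norm_mult norm_power norm_divide)
  qed
qed

text \<open>The \<open>q\<close>-binomial theorem, from \<open>(1 - x) S(x) = (1 - ax) S(qx)\<close>.\<close>

theorem qbinomial_sums:
  assumes "norm x < 1"
  shows "(\<lambda>n. qpoch q a n / qpoch q qc n * x ^ n) sums (qpoch_inf q (a * x) / qpoch_inf q x)"
proof -
  define c where "c n = qpoch q a n / qpoch q qc n" for n
  define S where "S y = (\<Sum>n. c n * y ^ n)" for y
  have sm: "summable (\<lambda>n. c n * y ^ n)" if "norm y < 1" for y
    using summable_qbinomial[OF that, of a] unfolding c_def by (rule summable_norm_cancel)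
  have c_rec: "(1 - qc ^ Suc n) * c (Suc n) = (1 - a * qc ^ n) * c n" for n
    using qc_power_neq_1[of n] by (simp add: c_def qpoch_Suc field_simps)
  have step: "(1 - y) * S y = (1 - a * y) * S (y * qc)" if y: "norm y < 1" for y
  proof -
    have yq: "norm (y * qc) < 1"
      using y q_pos q_less_1 by (simp add: norm_mult) (smt (verit) mult_le_cancel_left2 norm_ge_zero)
    note s1 = sm[OF y, THEN summable_sums, folded S_def]
    note s2 = sm[OF yq, THEN summable_sums, folded S_def]
    have "(\<lambda>n. c (Suc n) * y ^ Suc n) sums (S y - 1)"
      using s1 by (subst sums_Suc_iff) (simp add: c_def)
    moreover have "(\<lambda>n. c (Suc n) * (y * qc) ^ Suc n) sums (S (y * qc) - 1)"
      using s2 by (subst sums_Suc_iff) (simp add: c_def)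
    ultimately have "(\<lambda>n. c (Suc n) * y ^ Suc n - c (Suc n) * (y * qc) ^ Suc n)
        sums ((S y - 1) - (S (y * qc) - 1))"
      by (rule sums_diff)
    moreover have "c (Suc n) * y ^ Suc n - c (Suc n) * (y * qc) ^ Suc n
        = y * (c n * y ^ n) - (a * y) * (c n * (y * qc) ^ n)" for n
    proof -
      have "c (Suc n) * y ^ Suc n - c (Suc n) * (y * qc) ^ Suc n
        = ((1 - qc ^ Suc n) * c (Suc n)) * y ^ Suc n"
        by (simp add: power_mult_distrib algebra_simps)
      also have "\<dots> = y * (c n * y ^ n) - (a * y) * (c n * (y * qc) ^ n)"
        unfolding c_rec by (simp add: power_mult_distrib algebra_simps)
      finally show ?thesis .
    qed
    moreover have "(\<lambda>n. y * (c n * y ^ n) - (a * y) * (c n * (y * qc) ^ n))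
        sums (y * S y - (a * y) * S (y * qc))"
      by (intro sums_diff sums_mult s1 s2)
    ultimately have "(S y - 1) - (S (y * qc) - 1) = y * S y - (a * y) * S (y * qc)"
      using sums_unique2 by simp
    thus ?thesis by (simp add: algebra_simps)
  qed
  have it: "qpoch q x n * S x = qpoch q (a * x) n * S (x * qc ^ n)" for n
  proof (induction n)
    case (Suc n)
    have "norm (x * qc ^ n) \<le> norm x * 1"
      unfolding norm_mult norm_qc_power using qpow_le_1 by (intro mult_left_mono) auto
    hence "norm (x * qc ^ n) < 1" using assms by simp
    from step[OF this] Suc show ?case by (simp add: qpoch_Suc mult_ac) (metis mult.commute mult.left_commute)
  qed simp
  have "isCont S 0"
    unfolding S_def using sm[of "1/2"] by (intro isCont_power_series_0[of _ "1/2"]) auto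
  moreover have "S 0 = 1"
    unfolding S_def powser_zero by (simp add: c_def)
  ultimately have "qpoch_inf q x * S x = qpoch_inf q (a * x)"
    using it by (rule q_iteration_limit)
  hence "S x = qpoch_inf q (a * x) / qpoch_inf q x"
    using qpoch_inf_nonzero_if_norm_less_1[OF assms] by (simp add: field_simps)
  thus ?thesis using sm[OF assms, THEN summable_sums] by (simp add: S_def c_def)
qed

section \<open>Jackson's transformations and the continuation of \<open>2\<phi>1\<close>\<close>

text \<open>The substitution of \<open>q X\<close> for \<open>X\<close>. A \<open>q\<close>-difference equation between formal power series is a
  recursion for the coefficients, but it is multiplied by a series more easily than the recursion is
  convolved with a sequence.\<close>

definition fps_dilate :: "complex fps \<Rightarrow> complex fps" where
  "fps_dilate f = Abs_fps (\<lambda>n. qc ^ n * fps_nth f n)"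

lemma fps_nth_dilate [simp]: "fps_nth (fps_dilate f) n = qc ^ n * fps_nth f n"
  by (simp add: fps_dilate_def)

lemma fps_dilate_mult: "fps_dilate (f * g) = fps_dilate f * fps_dilate g"
proof (rule fps_ext)
  fix n
  have "qc ^ n * (\<Sum>i=0..n. fps_nth f i * fps_nth g (n - i))
      = (\<Sum>i=0..n. (qc ^ i * fps_nth f i) * (qc ^ (n - i) * fps_nth g (n - i)))"
    unfolding sum_distrib_left
  proof (rule sum.cong)
    fix i assume "i \<in> {0..n}"
    hence "qc ^ n = qc ^ i * qc ^ (n - i)" by (simp flip: power_add)
    thus "qc ^ n * (fps_nth f i * fps_nth g (n - i))
      = (qc ^ i * fps_nth f i) * (qc ^ (n - i) * fps_nth g (n - i))" by simp
  qed simp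
  thus "fps_nth (fps_dilate (f * g)) n = fps_nth (fps_dilate f * fps_dilate g) n"
    by (simp add: fps_mult_nth)
qed

lemma fps_dilate_euler:
  "Abs_fps (\<lambda>n. euler_coeff n * p ^ n)
     = (1 - fps_const p * fps_X) * fps_dilate (Abs_fps (\<lambda>n. euler_coeff n * p ^ n))"
proof (rule fps_ext)
  let ?\<epsilon> = "Abs_fps (\<lambda>n. euler_coeff n * p ^ n)"
  fix n
  show "fps_nth ?\<epsilon> n = fps_nth ((1 - fps_const p * fps_X) * fps_dilate ?\<epsilon>) n"
  proof (cases n)
    case (Suc m)
    have "(1 - qc ^ Suc m) * euler_coeff (Suc m) * p ^ Suc m = - (qc ^ m) * euler_coeff m * p ^ Suc m"
      by (simp only: euler_coeff_Suc)
    thus ?thesis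
      by (simp add: Suc algebra_simps)
  qed (simp add: algebra_simps)
qed

text \<open>Gauss's finite form of the \<open>q\<close>-binomial theorem,
  \<open>(a;q)\<^sub>n = \<Sum> [n,i] (-1)^i q^(i choose 2) a^i\<close>. The factors have the generating functions
  \<open>(aX;q)\<^sub>\<infinity>\<close> and \<open>1/(X;q)\<^sub>\<infinity>\<close>, whose \<open>q\<close>-difference equations combine to one of first order for
  the product.\<close>

lemma gauss_convolution:
  "(\<Sum>i\<le>n. (euler_coeff i * a ^ i) * (1 / qpoch q qc (n - i))) = qpoch q a n / qpoch q qc n"
proof -
  let ?T = fps_dilate and ?X = "fps_X :: complex fps" and ?c = "fps_const :: complex \<Rightarrow> _"
  define \<epsilon> where "\<epsilon> = Abs_fps (\<lambda>n. euler_coeff n * a ^ n)"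
  define \<beta> where "\<beta> = Abs_fps (\<lambda>n. 1 / qpoch q qc n)"
  have beta: "(1 - ?X) * \<beta> = ?T \<beta>"
  proof (rule fps_ext)
    fix n
    show "fps_nth ((1 - ?X) * \<beta>) n = fps_nth (?T \<beta>) n"
      by (cases n) (use qc_power_neq_1 in \<open>simp_all add: \<beta>_def qpoch_qq_Suc field_simps del: power_Suc\<close>)
  qed
  have "(1 - ?X) * (\<epsilon> * \<beta>) = ((1 - ?c a * ?X) * ?T \<epsilon>) * ((1 - ?X) * \<beta>)"
    using fps_dilate_euler[of a, folded \<epsilon>_def] by (metis mult.assoc mult.commute)
  hence prod: "(1 - ?X) * (\<epsilon> * \<beta>) = (1 - ?c a * ?X) * ?T (\<epsilon> * \<beta>)"
    unfolding beta fps_dilate_mult by (simp only: mult.assoc)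
  have rec: "fps_nth (\<epsilon> * \<beta>) (Suc n) * (1 - qc ^ Suc n) = (1 - a * qc ^ n) * fps_nth (\<epsilon> * \<beta>) n" for n
    using arg_cong[OF prod, of "\<lambda>f. fps_nth f (Suc n)"]
    by (simp add: left_diff_distrib mult.assoc del: power_Suc) (simp add: algebra_simps)
  have "fps_nth (\<epsilon> * \<beta>) n = qpoch q a n / qpoch q qc n"
  proof (induction n)
    case (Suc n)
    thus ?case using rec[of n] qc_power_neq_1[of n]
      by (simp add: qpoch_qq_Suc qpoch_Suc[of a] eq_divide_eq mult_ac del: power_Suc)
  qed (simp add: \<epsilon>_def \<beta>_def)
  thus ?thesis by (simp add: \<epsilon>_def \<beta>_def fps_mult_nth atMost_atLeast0)
qed

lemma qpoch_qq_C_recursion: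
  assumes "qpoch q C (Suc n) \<noteq> 0"
  shows "X * y / (qpoch q qc (Suc n) * qpoch q C (Suc n)) * ((1 - qc ^ Suc n) * (1 - C * qc ^ n))
       = y * (X / (qpoch q qc n * qpoch q C n))"
proof -
  have cancel: "X * y / (A * d * (B * d')) * (d * d') = y * (X / (A * B))"
    if "d \<noteq> 0" "d' \<noteq> 0" for A B d d' :: complex
    using that by (simp add: field_simps)
  show ?thesis
    unfolding qpoch_qq_Suc qpoch_Suc[of C] using assms qc_power_neq_1[of n]
    by (intro cancel) (auto simp: qpoch_Suc)
qed

text \<open>The coefficient form of \<open>jackson_sums\<close>. The recursion of \<open>u\<close> is a \<open>q\<close>-difference equation of second
  order for its generating function \<open>\<phi>\<close>. By \<open>\<epsilon>(X) = (1 - pX) \<epsilon>(qX)\<close>, the factor \<open>1 - pX\<close> moves from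
  \<open>\<phi>(X)\<close> to \<open>\<psi>(q^2 X)\<close> when one passes to \<open>\<psi> = \<epsilon> \<phi>\<close>, so the coefficients of \<open>\<psi>\<close> obey a two-term
  recursion again, namely that of \<open>v\<close>.\<close>

lemma jackson_convolution:
  fixes C p r :: complex
  assumes C: "\<And>n. qpoch q C n \<noteq> 0"
  defines "u \<equiv> \<lambda>n. (\<Prod>k<n. p - r * qc ^ k) / (qpoch q qc n * qpoch q C n)"
  defines "v \<equiv> \<lambda>n. (-1) ^ n * qc ^ (n choose 2) * (\<Prod>k<n. r - C * p * qc ^ k)
                      / (qpoch q qc n * qpoch q C n)"
  shows "(\<Sum>i\<le>n. (euler_coeff i * p ^ i) * u (n - i)) = v n"
proof -
  define \<phi> where "\<phi> = Abs_fps u"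
  define \<epsilon> where "\<epsilon> = Abs_fps (\<lambda>n. euler_coeff n * p ^ n)"
  let ?T = fps_dilate and ?X = "fps_X :: complex fps" and ?c = "fps_const :: complex \<Rightarrow> _"
  define \<psi> where "\<psi> = \<epsilon> * \<phi>"
  have u_rec: "u (Suc n) * ((1 - qc ^ Suc n) * (1 - C * qc ^ n)) = (p - r * qc ^ n) * u n" for n
    unfolding u_def prod.lessThan_Suc by (rule qpoch_qq_C_recursion[OF C])
  have v_rec: "v (Suc n) * ((1 - qc ^ Suc n) * (1 - C * qc ^ n))
      = - (qc ^ n * (r - C * p * qc ^ n)) * v n" for n
  proof -
    have "v (Suc n) = ((-1) ^ n * qc ^ (n choose 2) * (\<Prod>k<n. r - C * p * qc ^ k))
        * (- (qc ^ n * (r - C * p * qc ^ n))) / (qpoch q qc (Suc n) * qpoch q C (Suc n))"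
      unfolding v_def prod.lessThan_Suc choose_two_Suc power_add by simp
    from this qpoch_qq_C_recursion[OF C[of "Suc n"]] show ?thesis
      unfolding v_def by presburger
  qed
  have eps: "\<epsilon> = (1 - ?c p * ?X) * ?T \<epsilon>"
    unfolding \<epsilon>_def by (rule fps_dilate_euler)
  have Teps: "?T \<epsilon> = (1 - ?c (p * qc) * ?X) * ?T (?T \<epsilon>)"
  proof -
    have "?T \<epsilon> = ?T (1 - ?c p * ?X) * ?T (?T \<epsilon>)"
      using eps fps_dilate_mult by metis
    moreover have "?T (1 - ?c p * ?X) = 1 - ?c (p * qc) * ?X"
      by (rule fps_ext) (auto simp: fps_X_def)
    ultimately show ?thesis by simp
  qed
  have phi: "(1 - ?c p * ?X) * \<phi> = (?c (1 + C / qc) - ?c r * ?X) * ?T \<phi> - ?c (C / qc) * ?T (?T \<phi>)"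
  proof (rule fps_ext)
    fix n
    show "fps_nth ((1 - ?c p * ?X) * \<phi>) n
        = fps_nth ((?c (1 + C / qc) - ?c r * ?X) * ?T \<phi> - ?c (C / qc) * ?T (?T \<phi>)) n"
    proof (cases n)
      case 0
      show ?thesis using q_pos by (simp add: 0 \<phi>_def algebra_simps)
    next
      case (Suc m)
      have "C = (C / qc) * qc" using q_pos by simp
      \<comment> \<open>writing \<open>C = C' q\<close> removes the division by \<open>q\<close> from a polynomial identity\<close>
      then obtain C' where C': "C = C' * qc" by blast
      show ?thesis using u_rec[of m] q_pos
        by (simp add: Suc \<phi>_def C' algebra_simps)
    qed
  qed
  have psi: "\<psi> = (?c (1 + C / qc) - ?c r * ?X) * ?T \<psi>
      - ?c (C / qc) * (1 - ?c (p * qc) * ?X) * ?T (?T \<psi>)"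
  proof -
    have "\<psi> = ?T \<epsilon> * ((1 - ?c p * ?X) * \<phi>)"
      unfolding \<psi>_def using eps by (metis mult.assoc mult.commute)
    also have "\<dots> = (?c (1 + C / qc) - ?c r * ?X) * (?T \<epsilon> * ?T \<phi>)
        - ?c (C / qc) * (?T \<epsilon> * ?T (?T \<phi>))"
      unfolding phi by (simp only: algebra_simps)
    also have "?T \<epsilon> * ?T (?T \<phi>) = (1 - ?c (p * qc) * ?X) * (?T (?T \<epsilon>) * ?T (?T \<phi>))"
      by (subst Teps) (simp only: mult.assoc)
    finally show ?thesis
      unfolding \<psi>_def fps_dilate_mult by (simp only: mult.assoc)
  qed
  have w_rec: "fps_nth \<psi> (Suc n) * ((1 - qc ^ Suc n) * (1 - C * qc ^ n))
      = - (qc ^ n * (r - C * p * qc ^ n)) * fps_nth \<psi> n" for n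
  proof -
    have "fps_nth \<psi> (Suc n) = (1 + C / qc) * (qc ^ Suc n * fps_nth \<psi> (Suc n)) - r * (qc ^ n * fps_nth \<psi> n)
        - (C / qc) * (qc ^ Suc n * (qc ^ Suc n * fps_nth \<psi> (Suc n))
           - (p * qc) * (qc ^ n * (qc ^ n * fps_nth \<psi> n)))"
      by (subst psi) (simp add: algebra_simps)
    moreover have "C = (C / qc) * qc" using q_pos by simp
    then obtain C' where "C = C' * qc" by blast
    ultimately show ?thesis using q_pos by (simp add: algebra_simps)
  qed
  have "fps_nth \<psi> n = v n"
  proof (induction n)
    case 0
    show ?case by (simp add: \<psi>_def \<epsilon>_def \<phi>_def u_def v_def numeral_2_eq_2)
  next
    case (Suc n)
    have "1 - C * qc ^ n \<noteq> 0" using C[of "Suc n"] by (auto simp: qpoch_Suc)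
    moreover have "1 - qc ^ Suc n \<noteq> 0" using qc_power_neq_1[of n] by simp
    ultimately show ?case using w_rec[of n] v_rec[of n] Suc
      by (metis (no_types, lifting) mult_cancel_right mult_eq_0_iff)
  qed
  thus ?thesis by (simp add: \<psi>_def \<epsilon>_def \<phi>_def fps_mult_nth atMost_atLeast0)
qed

lemma summable_jackson_lhs:
  fixes C p r :: complex
  assumes C: "\<And>n. qpoch q C n \<noteq> 0" and p: "norm p < 1"
  shows "summable (\<lambda>n. norm ((\<Prod>k<n. p - r * qc ^ k) / (qpoch q qc n * qpoch q C n)))"
proof -
  define u where "u n = (\<Prod>k<n. p - r * qc ^ k) / (qpoch q qc n * qpoch q C n)" for n
  define \<rho> where "\<rho> n = (p - r * qc ^ n) / ((1 - qc ^ Suc n) * (1 - C * qc ^ n))" for n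
  have ratio: "u (Suc n) = \<rho> n * u n" for n
    by (simp add: u_def \<rho>_def qpoch_qq_Suc qpoch_Suc[of C] mult_ac del: power_Suc)
  have qn: "(\<lambda>n. qc ^ n) \<longlonglongrightarrow> 0"
    using q_pos q_less_1 by (intro LIMSEQ_power_zero) auto
  have "(\<lambda>n. norm (\<rho> n)) \<longlonglongrightarrow> norm ((p - r * 0) / ((1 - 0) * (1 - C * 0)))"
    unfolding \<rho>_def
    by (rule tendsto_norm tendsto_divide tendsto_diff tendsto_mult tendsto_const qn LIMSEQ_Suc[OF qn])+ simp
  moreover obtain c where c: "norm p < c" "c < 1" using dense[OF p] by blast
  ultimately have "eventually (\<lambda>n. norm (\<rho> n) < c) sequentially"
    by (intro order_tendstoD) auto
  then obtain N where N: "\<And>n. n \<ge> N \<Longrightarrow> norm (\<rho> n) < c"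
    by (auto simp: eventually_sequentially)
  have "summable (\<lambda>n. norm (u n))"
  proof (rule summable_ratio_test[OF c(2)])
    show "norm (norm (u (Suc n))) \<le> c * norm (norm (u n))" if "n \<ge> N" for n
      using N[OF that] by (simp add: ratio norm_mult mult_right_mono)
  qed
  thus ?thesis by (simp add: u_def)
qed

text \<open>The limiting case \<open>A \<rightarrow> 0\<close> of Jackson's transformation of \<open>2\<phi>1(A,B;C;q;Z)\<close>, namely
  \<open>(Z;q)\<^sub>\<infinity> 2\<phi>1(0,B;C;q;Z) = 1\<phi>1(C/B;C;q;BZ)\<close>, written with \<open>p = Z\<close> and \<open>r = BZ\<close>. These
  parameters make both sides polynomial in \<open>p\<close> and \<open>r\<close> term by term, and so cover the degenerate cases
  \<open>p = 0\<close> and \<open>r = 0\<close>, where \<open>B\<close> and \<open>C/B\<close> do not exist.\<close>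

theorem jackson_sums:
  fixes C p r :: complex
  assumes C: "\<And>n. qpoch q C n \<noteq> 0" and p: "norm p < 1"
  shows "(\<lambda>n. (-1) ^ n * qc ^ (n choose 2) * (\<Prod>k<n. r - C * p * qc ^ k)
                      / (qpoch q qc n * qpoch q C n))
     sums (qpoch_inf q p * (\<Sum>n. (\<Prod>k<n. p - r * qc ^ k) / (qpoch q qc n * qpoch q C n)))"
  using Cauchy_product_sums[OF summable_norm_euler[of p] summable_jackson_lhs[OF C p, of r]]
    euler_sums[of p, THEN sums_unique]
  unfolding jackson_convolution[OF C] by simp

lemma norm_qpoch_inf_le: "norm (qpoch_inf q (y * qc ^ n)) \<le> (\<Sum>m. norm (euler_coeff m * y ^ m))"
proof -
  have le: "norm (euler_coeff m * (y * qc ^ n) ^ m) \<le> norm (euler_coeff m * y ^ m)" for m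
  proof -
    have "norm (euler_coeff m * (y * qc ^ n) ^ m) = norm (euler_coeff m * y ^ m) * (q ^ n) ^ m"
      by (simp only: power_mult_distrib norm_mult norm_power norm_qc_power mult.assoc[symmetric])
         (simp add: q_pos less_imp_le)
    also have "\<dots> \<le> norm (euler_coeff m * y ^ m) * 1"
      using q_pos qpow_le_1[of "n * m"] by (intro mult_left_mono) (auto simp: power_mult)
    finally show ?thesis by simp
  qed
  have "norm (qpoch_inf q (y * qc ^ n)) \<le> (\<Sum>m. norm (euler_coeff m * (y * qc ^ n) ^ m))"
    unfolding sums_unique[OF euler_sums] by (rule summable_norm[OF summable_norm_euler])
  also have "\<dots> \<le> (\<Sum>m. norm (euler_coeff m * y ^ m))"
    by (intro suminf_le le summable_norm_euler)
  finally show ?thesis .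
qed

text \<open>The \<open>n\<close>-th term of \<open>(c;q)\<^sub>\<infinity> 1\<phi>1(b;c;q;y)\<close>, with \<open>(c;q)\<^sub>\<infinity>/(c;q)\<^sub>n\<close> replaced by
  \<open>(c q^n;q)\<^sub>\<infinity>\<close> and thus without denominators that can vanish.\<close>

definition jackson_term :: "complex \<Rightarrow> complex \<Rightarrow> complex \<Rightarrow> nat \<Rightarrow> complex" where
  "jackson_term b c y n = qpoch q b n * euler_coeff n * y ^ n * qpoch_inf q (c * qc ^ n)"

lemma summable_norm_jackson_term: "summable (\<lambda>n. norm (jackson_term b c y n))"
proof -
  obtain C where C: "C > 0" "\<And>n. norm (qpoch q b n) \<le> C"
    using qpoch_bounded by blast
  define D where "D = (\<Sum>m. norm (euler_coeff m * c ^ m))"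
  show ?thesis
  proof (rule summable_comparison_test')
    show "summable (\<lambda>n. C * norm (euler_coeff n * y ^ n) * D)"
      by (intro summable_mult summable_mult2 summable_norm_euler)
    show "norm (norm (jackson_term b c y n)) \<le> C * norm (euler_coeff n * y ^ n) * D" for n
      using C(1) mult_mono[OF mult_mono[OF C(2)[of n] order_refl[of "norm (euler_coeff n * y ^ n)"]]
          norm_qpoch_inf_le[of c n]]
      by (simp add: jackson_term_def D_def norm_mult mult_ac)
  qed
qed

lemma qhyp_11_eq_jackson_series:
  assumes c: "qpoch_inf q c \<noteq> 0"
  shows "qpoch_inf q c * qhyp [b] [c] q y = (\<Sum>n. jackson_term b c y n)"
proof -
  have "qpoch q b n / (qpoch q c n * qpoch q qc n) * ((-1) ^ n * qc ^ (n choose 2)) * y ^ n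
      = jackson_term b c y n / qpoch_inf q c" for n
    using c qpoch_inf_split[of c n] by (simp add: jackson_term_def euler_coeff_def mult_ac)
  hence "qhyp [b] [c] q y = (\<Sum>n. jackson_term b c y n / qpoch_inf q c)"
    by (simp add: qhyp_def qhyp_series_def qpochs_def)
  also have "\<dots> = (\<Sum>n. jackson_term b c y n) / qpoch_inf q c"
    by (rule suminf_divide[OF summable_norm_cancel[OF summable_norm_jackson_term]])
  finally show ?thesis using c by simp
qed

text \<open>Expand \<open>(a;q)\<^sub>k\<close> by Gauss's formula and sum first over \<open>k - n\<close>: the inner series is a
  \<open>q\<close>-binomial series with sum \<open>(bxq^n;q)\<^sub>\<infinity>/(x;q)\<^sub>\<infinity>\<close>.\<close>

theorem jackson_transformation:
  assumes x: "norm x < 1"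
  shows "(\<lambda>k. qpoch q a k * qpoch q b k / qpoch q qc k * x ^ k)
           sums ((\<Sum>n. jackson_term b (b * x) (a * x) n) / qpoch_inf q x)"
proof -
  obtain C where C: "C > 0" "\<And>n. norm (qpoch q b n) \<le> C"
    using qpoch_bounded by blast
  define F where "F n m = (euler_coeff n * (a * x) ^ n) * (qpoch q b (n + m) * (x ^ m / qpoch q qc m))" for n m
  obtain S where S1: "(\<lambda>k. \<Sum>n\<le>k. F n (k - n)) sums S" and S2: "(\<lambda>n. \<Sum>m. F n m) sums S"
  proof (rule double_series_rearrange)
    show "norm (F n m) \<le> norm (euler_coeff n * (a * x) ^ n)
        * (C * norm (qpoch q 0 m / qpoch q qc m * x ^ m))" for n m
      unfolding F_def norm_mult[of "euler_coeff n * (a * x) ^ n"] norm_mult[of "qpoch q b (n + m)"]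
      using C(1) C(2)[of "n + m"] by (intro mult_left_mono mult_mono) auto
    show "summable (\<lambda>m. C * norm (qpoch q 0 m / qpoch q qc m * x ^ m))"
      by (intro summable_mult summable_qbinomial x)
  qed (use C summable_norm_euler in auto)
  have row: "(\<Sum>m. F n m) = jackson_term b (b * x) (a * x) n / qpoch_inf q x" for n
  proof -
    have "(\<lambda>m. euler_coeff n * (a * x) ^ n * qpoch q b n * (qpoch q (b * qc ^ n) m / qpoch q qc m * x ^ m))
      sums (euler_coeff n * (a * x) ^ n * qpoch q b n * (qpoch_inf q (b * qc ^ n * x) / qpoch_inf q x))"
      by (intro sums_mult qbinomial_sums x)
    moreover have "euler_coeff n * (a * x) ^ n * qpoch q b n * (qpoch q (b * qc ^ n) m / qpoch q qc m * x ^ m)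
        = F n m" for m
      by (simp add: F_def qpoch_add)
    ultimately show ?thesis
      by (simp add: sums_iff jackson_term_def mult_ac)
  qed
  have diag: "(\<Sum>n\<le>k. F n (k - n)) = qpoch q a k * qpoch q b k / qpoch q qc k * x ^ k" for k
  proof -
    have "(\<Sum>n\<le>k. F n (k - n))
        = (\<Sum>n\<le>k. (euler_coeff n * a ^ n * (1 / qpoch q qc (k - n))) * (qpoch q b k * x ^ k))"
    proof (rule sum.cong)
      fix n assume "n \<in> {..k}"
      hence "x ^ k = x ^ n * x ^ (k - n)" by (simp flip: power_add)
      thus "F n (k - n) = (euler_coeff n * a ^ n * (1 / qpoch q qc (k - n))) * (qpoch q b k * x ^ k)"
        using \<open>n \<in> {..k}\<close> by (simp add: F_def power_mult_distrib)
    qed simp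
    thus ?thesis unfolding sum_distrib_right[symmetric] gauss_convolution by simp
  qed
  have "(\<lambda>n. jackson_term b (b * x) (a * x) n / qpoch_inf q x) sums ((\<Sum>n. jackson_term b (b * x) (a * x) n) / qpoch_inf q x)"
    using summable_norm_cancel[OF summable_norm_jackson_term] by (intro sums_divide summable_sums)
  with S2[unfolded row] have "S = (\<Sum>n. jackson_term b (b * x) (a * x) n) / qpoch_inf q x"
    by (rule sums_unique2)
  with S1[unfolded diag] show ?thesis by simp
qed

text \<open>Expanding the infinite product in each term by Euler's formula and collecting powers of \<open>x\<close> gives
  a power series that converges everywhere.\<close>

lemma jackson_series_holomorphic: "(\<lambda>x. \<Sum>n. jackson_term b (b * x) (a * x) n) holomorphic_on A"
proof -
  obtain C where C: "C > 0" "\<And>n. norm (qpoch q b n) \<le> C"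
    using qpoch_bounded by blast
  define c where "c k = (\<Sum>n\<le>k. qpoch q b n * euler_coeff n * a ^ n * euler_coeff (k - n)
      * b ^ (k - n) * qc ^ (n * (k - n)))" for k
  have sums: "(\<lambda>k. c k * x ^ k) sums (\<Sum>n. jackson_term b (b * x) (a * x) n)" for x
  proof -
    define F where "F n m = (qpoch q b n * (euler_coeff n * (a * x) ^ n)) * (euler_coeff m * (b * x * qc ^ n) ^ m)" for n m
    obtain S where S1: "(\<lambda>k. \<Sum>n\<le>k. F n (k - n)) sums S" and S2: "(\<lambda>n. \<Sum>m. F n m) sums S"
    proof (rule double_series_rearrange)
      fix n m
      have "norm ((b * x * qc ^ n) ^ m) = norm ((b * x) ^ m) * q ^ (n * m)"
        by (simp only: power_mult_distrib norm_mult norm_power norm_qc power_mult)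
      also have "\<dots> \<le> norm ((b * x) ^ m) * 1"
        by (intro mult_left_mono qpow_le_1) auto
      finally show "norm (F n m) \<le> (C * norm (euler_coeff n * (a * x) ^ n)) * norm (euler_coeff m * (b * x) ^ m)"
        unfolding F_def norm_mult[of "qpoch q b n * _"] norm_mult[of "qpoch q b n"]
          norm_mult[of "euler_coeff m"]
        using C by (intro mult_mono order_refl) auto
    qed (use C summable_norm_euler in \<open>auto intro: summable_mult\<close>)
    have row: "(\<Sum>m. F n m) = jackson_term b (b * x) (a * x) n" for n
      unfolding F_def jackson_term_def
      by (subst suminf_mult[OF summable_norm_cancel[OF summable_norm_euler]])
         (simp add: sums_unique[OF euler_sums] mult_ac)
    have diag: "(\<Sum>n\<le>k. F n (k - n)) = c k * x ^ k" for k
      unfolding c_def sum_distrib_right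
    proof (rule sum.cong)
      fix n assume "n \<in> {..k}"
      hence "x ^ k = x ^ n * x ^ (k - n)" by (simp flip: power_add)
      thus "F n (k - n) = qpoch q b n * euler_coeff n * a ^ n * euler_coeff (k - n)
          * b ^ (k - n) * qc ^ (n * (k - n)) * x ^ k"
        by (simp add: F_def power_mult_distrib power_mult)
    qed simp
    from S1 S2 show ?thesis unfolding row diag by (simp add: sums_iff)
  qed
  have "(\<lambda>x. \<Sum>k. c k * x ^ k) field_differentiable at x" for x
    unfolding field_differentiable_def
    by (rule exI, rule termdiffs_strong_converges_everywhere[OF sums_summable[OF sums]])
  moreover have "(\<lambda>x. \<Sum>k. c k * x ^ k) = (\<lambda>x. \<Sum>n. jackson_term b (b * x) (a * x) n)"
    by (rule ext) (rule sums_unique[OF sums, symmetric])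
  ultimately show ?thesis
    unfolding holomorphic_on_def by (metis field_differentiable_at_within)
qed

abbreviation slit_plane :: "complex set" where
  "slit_plane \<equiv> - (complex_of_real ` {1..})"

lemma qpoch_inf_nonzero_on_slit_plane:
  assumes "x \<in> slit_plane" shows "qpoch_inf q x \<noteq> 0"
proof
  assume "qpoch_inf q x = 0"
  then obtain k where k: "x * qc ^ k = 1" by (auto simp: qpoch_inf_eq_0_iff)
  hence "x = complex_of_real (1 / q ^ k)" using q_pos by (simp add: field_simps)
  moreover have "1 / q ^ k \<ge> 1" using qpow_pos[of k] qpow_le_1[of k] by simp
  ultimately show False using assms by (metis ComplD atLeast_iff image_eqI)
qed

lemma open_slit_plane: "open slit_plane"
proof -
  have "complex_of_real ` {1..} = {z. 1 \<le> Re z} \<inter> {z. Im z = 0}"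
  proof (intro equalityI subsetI)
    fix z assume "z \<in> {z. 1 \<le> Re z} \<inter> {z. Im z = 0}"
    hence "z = of_real (Re z)" "Re z \<in> {1..}" by (auto simp: complex_eq_iff)
    thus "z \<in> complex_of_real ` {1..}" by blast
  qed auto
  moreover have "closed ({z. 1 \<le> Re z} \<inter> {z. Im z = 0})"
    by (intro closed_Int closed_halfspace_Re_ge closed_Collect_eq continuous_intros)
  ultimately show ?thesis unfolding open_closed by simp
qed

lemma connected_slit_plane: "connected slit_plane"
proof (rule starlike_imp_connected)
  have *: "t *\<^sub>R x \<in> slit_plane" if "x \<in> slit_plane" "0 \<le> t" "t \<le> 1" for t x
  proof
    assume "t *\<^sub>R x \<in> complex_of_real ` {1..}"
    then obtain r where r: "r \<ge> 1" "of_real t * x = of_real r" by (auto simp: scaleR_conv_of_real)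
    hence "t \<noteq> 0" by auto
    hence "x = of_real (r / t)" using r by (simp add: field_simps)
    moreover have "r / t \<ge> 1" using r that \<open>t \<noteq> 0\<close> by (simp add: field_simps)
    ultimately show False using that(1) by (metis ComplD atLeast_iff image_eqI)
  qed
  have "0 \<in> slit_plane" by auto
  thus "starlike slit_plane"
    unfolding starlike_def
  proof (intro bexI[of _ 0] ballI subsetI)
    fix x z assume "x \<in> slit_plane" "z \<in> closed_segment 0 x"
    then obtain t where "0 \<le> t" "t \<le> 1" "z = t *\<^sub>R x"
      by (auto simp: closed_segment_def)
    with *[OF \<open>x \<in> slit_plane\<close>] show "z \<in> slit_plane" by simp
  qed
qed

lemma slit_plane_continuation_unique:
  assumes "f holomorphic_on slit_plane" "g holomorphic_on slit_plane"
    and "\<And>x. norm x < 1 \<Longrightarrow> f x = g x" and "x \<in> slit_plane"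
  shows "f x = g x"
proof -
  have sub: "ball 0 1 \<subseteq> slit_plane" by (auto simp: subset_iff)
  show ?thesis
    by (rule analytic_continuation_open[where s = "ball 0 1" and s' = slit_plane])
       (use assms sub open_slit_plane connected_slit_plane in auto)
qed

text \<open>The choice operator in the definition of \<open>qhyp\<close> is pinned down by any one function with the
  prescribed properties.\<close>

lemma qhyp_21_eq_continuation:
  assumes "f holomorphic_on slit_plane"
    and "\<And>x. norm x < 1 \<Longrightarrow> (\<lambda>k. qpoch q a k * qpoch q b k / qpoch q qc k * x ^ k) sums f x"
    and "x \<in> slit_plane"
  shows "qhyp [a, b] [0] q x = f x"
proof -
  let ?P = "\<lambda>f. f holomorphic_on slit_plane \<and> (\<forall>x. norm x < 1 \<longrightarrow> f x = qhyp_series [a, b] [0] q x)"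
  have "qhyp_series [a, b] [0] q x = f x" if "norm x < 1" for x
    using sums_unique[OF assms(2)[OF that]] by (simp add: qhyp_series_def qpochs_def)
  hence f: "?P f" using assms(1) by auto
  hence "?P (qhyp [a, b] [0] q)"
    unfolding qhyp_def by simp (rule someI[of ?P])
  thus ?thesis
    using slit_plane_continuation_unique[of "qhyp [a, b] [0] q" f x] f assms(3) by auto
qed

text \<open>The right-hand side continues the series because the only zeros of its denominator lie on the cut.\<close>

theorem qhyp_21_eq_jackson:
  assumes "x \<in> slit_plane"
  shows "qhyp [a, b] [0] q x = (\<Sum>n. jackson_term b (b * x) (a * x) n) / qpoch_inf q x"
proof (rule qhyp_21_eq_continuation[OF _ _ assms])
  show "(\<lambda>x. (\<Sum>n. jackson_term b (b * x) (a * x) n) / qpoch_inf q x) holomorphic_on slit_plane"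
    using qpoch_inf_nonzero_on_slit_plane
    by (intro holomorphic_intros jackson_series_holomorphic) auto
qed (rule jackson_transformation)

section \<open>The Gaussian and theta kernels\<close>

abbreviation L :: real where "L \<equiv> ln q"

lemma L_neg: "L < 0"
  using q_pos q_less_1 by simp

lemma exp_L [simp]: "exp (complex_of_real L) = qc"
  using q_pos by (subst exp_of_real) simp

text \<open>The theta kernel has its poles where \<open>exp l\<close> is a negative real number; the Gaussian kernel is
  entire.\<close>

abbreviation kernel_domain :: "kernel \<Rightarrow> complex \<Rightarrow> bool" where
  "kernel_domain e l \<equiv> e = Kernel_theta \<longrightarrow> \<bar>Im l\<bar> < pi"

text \<open>Multiplied out so as to hold at the zeros of theta, too.\<close>

lemma theta_q_step: "theta_q q (qc * \<tau>) * \<tau> = theta_q q \<tau>" if "\<tau> \<noteq> 0"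
proof -
  have "qpoch_inf q (- qc / (qc * \<tau>)) = (1 + 1 / \<tau>) * qpoch_inf q (- qc / \<tau>)"
    using qpoch_inf_step[of "- 1 / \<tau>"] q_pos by simp
  moreover have "qpoch_inf q (- \<tau>) = (1 + \<tau>) * qpoch_inf q (- (qc * \<tau>))"
    using qpoch_inf_step[of "- \<tau>"] by (simp add: mult.commute)
  moreover have "(1 + 1 / \<tau>) * \<tau> = 1 + \<tau>" using that by (simp add: field_simps)
  ultimately show ?thesis by (simp add: theta_q_def qpochs_inf_def mult_ac)
qed

lemma theta_q_reflect: "theta_q q (qc / \<tau>) = theta_q q \<tau>" if "\<tau> \<noteq> 0"
  using that q_pos by (simp add: theta_q_def qpochs_inf_def mult_ac)

lemma exp_not_neg_real:
  assumes "\<bar>Im l\<bar> < pi" "c > 0" shows "exp l \<noteq> - complex_of_real c"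
proof
  assume *: "exp l = - complex_of_real c"
  have "Im l = 0"
  proof -
    have "Im (exp l) = 0" unfolding * by simp
    hence "sin (Im l) = 0" by (simp add: Im_exp)
    thus ?thesis using assms(1) sin_eq_0_pi by (metis abs_less_iff minus_less_iff)
  qed
  hence "Re (exp l) = exp (Re l)" by (simp add: Re_exp)
  hence "- c = exp (Re l)" unfolding * by simp
  with assms(2) exp_gt_zero[of "Re l"] show False by linarith
qed

lemma theta_q_nonzero: "theta_q q (exp l) \<noteq> 0" if "\<bar>Im l\<bar> < pi"
proof -
  have "qpoch_inf q qc \<noteq> 0"
    using q_pos q_less_1 by (intro qpoch_inf_nonzero_if_norm_less_1) simp
  moreover have "qpoch_inf q (- exp l) \<noteq> 0"
  proof
    assume "qpoch_inf q (- exp l) = 0"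
    then obtain k where k: "- exp l * qc ^ k = 1" by (auto simp: qpoch_inf_eq_0_iff)
    hence "exp l = - complex_of_real (1 / q ^ k)"
      using q_pos by (simp add: field_simps) (metis add.inverse_inverse)
    with exp_not_neg_real[OF that, of "1 / q ^ k"] qpow_pos show False by simp
  qed
  moreover have "qpoch_inf q (- qc / exp l) \<noteq> 0"
  proof
    assume "qpoch_inf q (- qc / exp l) = 0"
    then obtain k where k: "- qc / exp l * qc ^ k = 1" by (auto simp: qpoch_inf_eq_0_iff)
    hence "exp l = - complex_of_real (q * q ^ k)"
      by (simp add: field_simps) 
    with exp_not_neg_real[OF that, of "q * q ^ k"] qpow_pos q_pos show False by simp
  qed
  ultimately show ?thesis by (simp add: theta_q_def qpochs_inf_def)
qed

lemma kappa_step: "kappa q e (l + of_real L) = exp l * kappa q e l"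
proof (cases e)
  case Kernel_E
  have "(l + of_real L - of_real (ln (sqrt q))) ^ 2 / (2 * of_real L)
      = l + (l - of_real (ln (sqrt q))) ^ 2 / (2 * of_real L)"
    using L_neg q_pos by (simp add: ln_sqrt power2_eq_square field_simps)
  thus ?thesis by (simp add: Kernel_E E_q_def exp_add)
next
  case Kernel_theta
  have "theta_q q (exp l * qc) * exp l = theta_q q (exp l)"
    using theta_q_step[of "exp l"] by (simp add: mult.commute)
  hence "1 / theta_q q (exp l * qc) = exp l / theta_q q (exp l)"
    by (cases "theta_q q (exp l * qc) = 0") (auto simp: field_simps)
  thus ?thesis by (simp add: Kernel_theta exp_add divide_inverse mult_ac)
qed

lemma kappa_shift: "kappa q e (l + of_nat n * of_real L) = qc ^ (n choose 2) * exp l ^ n * kappa q e l"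
proof (induction n)
  case (Suc n)
  have "kappa q e (l + of_nat (Suc n) * of_real L)
      = exp (l + of_nat n * of_real L) * kappa q e (l + of_nat n * of_real L)"
    using kappa_step[of e "l + of_nat n * of_real L"] by (simp add: algebra_simps)
  also have "exp (l + of_nat n * of_real L) = exp l * qc ^ n"
    by (simp add: exp_add exp_of_nat_mult)
  finally show ?case
    by (simp add: Suc.IH choose_two_Suc power_add mult_ac)
qed (simp add: numeral_2_eq_2)

lemma kappa_reflect: "kappa q e (of_real L - l) = kappa q e l"
proof (cases e)
  case Kernel_E
  have "(of_real L - l - of_real (ln (sqrt q))) ^ 2 = (l - complex_of_real (ln (sqrt q))) ^ 2"
    using q_pos by (simp add: ln_sqrt power2_eq_square algebra_simps)
  thus ?thesis by (simp add: Kernel_E E_q_def)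
next
  case Kernel_theta
  thus ?thesis using theta_q_reflect[of "exp l"] by (simp add: exp_diff)
qed

lemma kappa_nonzero: "kernel_domain e l \<Longrightarrow> kappa q e l \<noteq> 0"
  using L_neg pi_gt_zero theta_q_nonzero[of l]
  by (cases e) (auto simp: E_q_def C_q_def)

lemma kappa_holomorphic:
  assumes "f holomorphic_on A" "\<And>x. x \<in> A \<Longrightarrow> kernel_domain e (f x)"
  shows "(\<lambda>x. kappa q e (f x)) holomorphic_on A"
proof (cases e)
  case Kernel_E
  show ?thesis unfolding Kernel_E kappa.simps E_q_def using L_neg
    by (intro holomorphic_intros assms) auto
next
  case Kernel_theta
  have "theta_q q (exp (f x)) \<noteq> 0" if "x \<in> A" for x
    using assms(2)[OF that] Kernel_theta by (intro theta_q_nonzero) auto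
  moreover have "(\<lambda>x. theta_q q (exp (f x))) holomorphic_on A"
    unfolding theta_q_def qpochs_inf_def
    by (simp, intro holomorphic_intros assms) auto
  ultimately show ?thesis unfolding Kernel_theta kappa.simps using L_neg
    by (intro holomorphic_intros) auto
qed

lemma kappa_continuous:
  assumes "continuous_on A f" "\<And>x. x \<in> A \<Longrightarrow> kernel_domain e (f x)"
  shows "continuous_on A (\<lambda>x. kappa q e (f x))"
proof -
  have "(\<lambda>l. kappa q e l) holomorphic_on {l. kernel_domain e l}"
    by (intro kappa_holomorphic holomorphic_on_ident) auto
  from continuous_on_compose2[OF holomorphic_on_imp_continuous_on[OF this] assms(1)] assms(2)
  show ?thesis by blast
qed

text \<open>The entire function \<open>\<gamma>(l) = exp ((l - L/2)^2 / (2L))\<close> satisfies the same functional equation as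
  the kernel, so their quotient has period \<open>L\<close> and is bounded on closed strips by compactness.\<close>

lemma kappa_gaussian_bound:
  assumes \<beta>: "0 \<le> \<beta>" "e = Kernel_theta \<longrightarrow> \<beta> < pi"
  shows "\<exists>M>0. \<forall>l. \<bar>Im l\<bar> \<le> \<beta> \<longrightarrow> norm (kappa q e l) \<le> M * exp ((Re l - L / 2)\<^sup>2 / (2 * L))"
proof -
  define \<gamma> where "\<gamma> l = exp ((l - of_real L / 2)\<^sup>2 / (2 * of_real L))" for l :: complex
  define \<rho> where "\<rho> l = kappa q e l / \<gamma> l" for l
  have gamma_step: "\<gamma> (l + of_real L) = exp l * \<gamma> l" for l
  proof -
    have "(l + of_real L - of_real L / 2) ^ 2 / (2 * of_real L)
        = l + (l - of_real L / 2) ^ 2 / (2 * complex_of_real L)"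
      using L_neg q_pos by (simp add: power2_eq_square field_simps)
    thus ?thesis by (simp add: \<gamma>_def exp_add)
  qed
  have per: "\<rho> (l + of_real L) = \<rho> l" for l
    by (simp add: \<rho>_def gamma_step kappa_step)
  define K where "K = cbox (Complex L (- \<beta>)) (Complex 0 \<beta>)"
  have "continuous_on K \<rho>"
    unfolding \<rho>_def \<gamma>_def using L_neg \<beta>
    by (intro continuous_intros kappa_continuous) (auto simp: K_def in_cbox_complex_iff)
  hence "bounded (\<rho> ` K)"
    by (intro compact_imp_bounded compact_continuous_image) (auto simp: K_def compact_cbox)
  then obtain M where M: "M > 0" "\<And>l. l \<in> K \<Longrightarrow> norm (\<rho> l) \<le> M"
    by (auto simp: bounded_pos)
  have "norm (kappa q e l) \<le> (M * exp (\<beta>\<^sup>2 / (- 2 * L))) * exp ((Re l - L / 2)\<^sup>2 / (2 * L))"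
    if "\<bar>Im l\<bar> \<le> \<beta>" for l
  proof -
    \<comment> \<open>since \<open>L < 0\<close>, translating by \<open>-n L\<close> puts the real part into \<open>[L, 0]\<close>\<close>
    define n where "n = \<lfloor>Re l / L\<rfloor>"
    have "of_int n \<le> Re l / L" "Re l / L \<le> of_int n + 1" unfolding n_def by linarith+
    hence "Re l \<le> of_int n * L" "(of_int n + 1) * L \<le> Re l"
      using L_neg by (simp_all add: field_simps)
    hence "l + of_int (- n) * of_real L \<in> K"
      using that by (auto simp: K_def in_cbox_complex_iff algebra_simps)
    hence "norm (\<rho> l) \<le> M" using M(2) periodic_int[of \<rho>, OF per, of l "- n"] by metis
    hence "norm (kappa q e l) \<le> M * norm (\<gamma> l)"
      by (simp add: \<rho>_def norm_divide \<gamma>_def field_simps)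
    also have "norm (\<gamma> l) = exp ((Im l)\<^sup>2 / (- 2 * L)) * exp ((Re l - L / 2)\<^sup>2 / (2 * L))"
    proof -
      have "Re ((l - of_real L / 2)\<^sup>2 / (2 * of_real L)) = ((Re l - L / 2)\<^sup>2 - (Im l)\<^sup>2) / (2 * L)"
      proof -
        have "(l - of_real L / 2)\<^sup>2 / (2 * of_real L) = (l - of_real (L / 2))\<^sup>2 / of_real (2 * L)"
          by simp
        thus ?thesis by (simp only: Re_divide_of_real) (simp add: power2_eq_square)
      qed
      also have "\<dots> = (Im l)\<^sup>2 / (- 2 * L) + (Re l - L / 2)\<^sup>2 / (2 * L)"
        by (simp add: diff_divide_distrib)
      finally show ?thesis by (simp only: \<gamma>_def norm_exp_eq_Re exp_add)
    qed
    also have "\<dots> \<le> exp (\<beta>\<^sup>2 / (- 2 * L)) * exp ((Re l - L / 2)\<^sup>2 / (2 * L))"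
    proof -
      have "(Im l)\<^sup>2 \<le> \<beta>\<^sup>2" using that by (simp add: abs_le_square_iff[symmetric])
      hence "(Im l)\<^sup>2 / (- 2 * L) \<le> \<beta>\<^sup>2 / (- 2 * L)"
        using L_neg by (intro divide_right_mono) auto
      thus ?thesis by simp
    qed
    finally show ?thesis using M(1) by (simp add: mult_ac mult_left_mono)
  qed
  thus ?thesis using M(1) by (intro exI[of _ "M * exp (\<beta>\<^sup>2 / (- 2 * L))"]) auto
qed

text \<open>Completing the square turns the product into a multiple of a normal density of variance \<open>-L\<close>.\<close>

lemma integrable_gaussian_exp: "integrable lborel (\<lambda>x. exp ((x - d)\<^sup>2 / (2 * L)) * exp (m * x))"
proof -
  define \<sigma> where "\<sigma> = sqrt (- L)"
  have \<sigma>: "\<sigma> > 0" "\<sigma>\<^sup>2 = - L" using L_neg by (auto simp: \<sigma>_def)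
  define d' where "d' = d - m * L"
  have "exp ((x - d)\<^sup>2 / (2 * L)) * exp (m * x)
      = (exp (m * d - m\<^sup>2 * L / 2) * sqrt (2 * pi * \<sigma>\<^sup>2)) * normal_density d' \<sigma> x" for x
  proof -
    have "(x - d)\<^sup>2 / (2 * L) + m * x = (m * d - m\<^sup>2 * L / 2) + - (x - d')\<^sup>2 / (2 * \<sigma>\<^sup>2)"
      using L_neg q_pos unfolding \<sigma>(2) d'_def by (simp add: power2_eq_square field_simps)
    thus ?thesis using \<sigma>(1) by (simp add: normal_density_def flip: exp_add)
  qed
  thus ?thesis using \<sigma>(1) by simp
qed

lemma integrable_gaussian_exp_abs:
  "integrable lborel (\<lambda>x. exp (m * \<bar>x\<bar>) * exp ((x - d)\<^sup>2 / (2 * L)))"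
proof (rule Bochner_Integration.integrable_bound)
  show "integrable lborel (\<lambda>x. exp ((x - d)\<^sup>2 / (2 * L)) * exp (m * x)
      + exp ((x - d)\<^sup>2 / (2 * L)) * exp (- m * x))"
    by (intro Bochner_Integration.integrable_add integrable_gaussian_exp)
  show "AE x in lborel. norm (exp (m * \<bar>x\<bar>) * exp ((x - d)\<^sup>2 / (2 * L)))
      \<le> norm (exp ((x - d)\<^sup>2 / (2 * L)) * exp (m * x) + exp ((x - d)\<^sup>2 / (2 * L)) * exp (- m * x))"
  proof (intro AE_I2)
    fix x :: real
    have "exp (m * \<bar>x\<bar>) \<le> exp (m * x) + exp (- m * x)"
      by (cases "x \<ge> 0") auto
    from mult_right_mono[OF this, of "exp ((x - d)\<^sup>2 / (2 * L))"]
    show "norm (exp (m * \<bar>x\<bar>) * exp ((x - d)\<^sup>2 / (2 * L)))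
      \<le> norm (exp ((x - d)\<^sup>2 / (2 * L)) * exp (m * x) + exp ((x - d)\<^sup>2 / (2 * L)) * exp (- m * x))"
      by (simp add: algebra_simps)
  qed
qed simp

lemma integrable_exp_kappa:
  assumes "kernel_domain e w"
  shows "integrable lborel (\<lambda>u. exp (m * \<bar>u\<bar>) * norm (kappa q e (of_real u - w)))"
proof -
  obtain M where M: "M > 0" "\<And>l. \<bar>Im l\<bar> \<le> \<bar>Im w\<bar> \<Longrightarrow> norm (kappa q e l) \<le> M * exp ((Re l - L / 2)\<^sup>2 / (2 * L))"
    using kappa_gaussian_bound[of "\<bar>Im w\<bar>" e] assms by auto
  show ?thesis
  proof (rule Bochner_Integration.integrable_bound)
    show "integrable lborel (\<lambda>u. M * (exp (m * \<bar>u\<bar>) * exp ((u - (Re w + L / 2))\<^sup>2 / (2 * L))))"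
      by (intro integrable_mult_right integrable_gaussian_exp_abs)
    have "continuous_on UNIV (\<lambda>u::real. kappa q e (of_real u - w))"
      using assms by (intro kappa_continuous continuous_intros) auto
    from borel_measurable_continuous_onI[OF this]
    show "(\<lambda>u. exp (m * \<bar>u\<bar>) * norm (kappa q e (of_real u - w))) \<in> borel_measurable lborel"
      by measurable
    show "AE u in lborel. norm (exp (m * \<bar>u\<bar>) * norm (kappa q e (of_real u - w)))
        \<le> norm (M * (exp (m * \<bar>u\<bar>) * exp ((u - (Re w + L / 2))\<^sup>2 / (2 * L))))"
      using M(1) M(2)[of "of_real _ - w"] by (intro AE_I2) (auto simp: algebra_simps)
  qed
qed

section \<open>Polynomial growth and termwise rescaling\<close>

lemma qpoch_inf_minus_pos_nonzero: "t > 0 \<Longrightarrow> qpoch_inf q (- complex_of_real t) \<noteq> 0"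
  by (rule qpoch_inf_nonzero_on_slit_plane) (auto simp: complex_eq_iff)

text \<open>The factor shared by the integrands, called \<open>G\<close> below.\<close>

definition q_ratio :: "complex \<Rightarrow> real \<Rightarrow> complex" where
  "q_ratio b t = qpoch_inf q (- (b * of_real t)) / qpoch_inf q (- of_real t)"

text \<open>For the parameter \<open>b\<close> of \<open>q_ratio\<close> this is \<open>G(q^-n t)/G(t)\<close>; for parameter 0 it is the part
  of that quotient that stems from the denominator of \<open>G\<close>. The powers of \<open>q\<close> are cleared to make all
  exponents positive.\<close>

definition q_backward :: "complex \<Rightarrow> real \<Rightarrow> nat \<Rightarrow> complex" where
  "q_backward b t n = (\<Prod>k<n. (b * of_real t + qc ^ Suc k) / (of_real t + qc ^ Suc k))"

lemma q_backward_scaled: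
  assumes "t > 0"
  shows "q_backward c (q ^ n * t) n = qpoch q (- (c * of_real t)) n / qpoch q (- of_real t) n"
proof -
  have "q_backward c (q ^ n * t) n
      = (\<Prod>k<n. (c * of_real (q ^ n * t) + qc ^ (n - k)) / (of_real (q ^ n * t) + qc ^ (n - k)))"
    unfolding q_backward_def
    by (subst prod.nat_diff_reindex[symmetric]) (auto intro!: prod.cong simp: Suc_diff_Suc simp del: power_Suc)
  also have "\<dots> = (\<Prod>k<n. (1 - (- (c * of_real t)) * qc ^ k) / (1 - (- of_real t) * qc ^ k))"
  proof (rule prod.cong)
    fix k assume "k \<in> {..<n}"
    hence "n = (n - k) + k" by simp
    hence eq: "qc ^ n = qc ^ (n - k) * qc ^ k" by (metis power_add)
    have nz: "qc ^ (n - k) \<noteq> 0" using q_pos by simp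
    have cancel: "(x * a) / (x * b) = a / b" if "x \<noteq> 0" for x a b :: complex using that by simp
    have "c * of_real (q ^ n * t) + qc ^ (n - k) = qc ^ (n - k) * (1 - (- (c * of_real t)) * qc ^ k)"
      by (simp add: eq algebra_simps)
    moreover have "of_real (q ^ n * t) + qc ^ (n - k) = qc ^ (n - k) * (1 - (- of_real t) * qc ^ k)"
      by (simp add: eq algebra_simps)
    ultimately show "(c * of_real (q ^ n * t) + qc ^ (n - k)) / (of_real (q ^ n * t) + qc ^ (n - k))
        = (1 - (- (c * of_real t)) * qc ^ k) / (1 - (- of_real t) * qc ^ k)"
      by (simp only: cancel[OF nz])
  qed simp
  finally show ?thesis by (simp add: qpoch_def prod_dividef)
qed

lemma q_ratio_scaled:
  assumes "t > 0"
  shows "q_ratio b (q ^ n * t) = qpoch_inf q (- (b * of_real t) * qc ^ n) * qpoch q (- of_real t) n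
           / qpoch_inf q (- of_real t)"
  using qpoch_inf_minus_pos_nonzero[OF assms] qpoch_inf_split[of "- of_real t" n]
  by (simp add: q_ratio_def mult_ac)

text \<open>The value at \<open>q^n t\<close> of the terms that stand under the integral sign after the rescaling. For \<open>c = b\<close>
  the right-hand side is just \<open>G(t)\<close>, for \<open>c = 0\<close> it is \<open>(-btq^n;q)\<^sub>\<infinity>/(-t;q)\<^sub>\<infinity>\<close>.\<close>

lemma q_ratio_backward_scaled:
  assumes "t > 0"
  shows "q_ratio b (q ^ n * t) * q_backward c (q ^ n * t) n
     = qpoch q (- (c * of_real t)) n * qpoch_inf q (- (b * of_real t) * qc ^ n) / qpoch_inf q (- of_real t)"
proof -
  have "qpoch q (- of_real t) n \<noteq> 0"
    using qpoch_inf_minus_pos_nonzero[OF assms] qpoch_inf_split[of "- of_real t" n] by auto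
  thus ?thesis by (simp add: q_ratio_scaled[OF assms] q_backward_scaled[OF assms])
qed

text \<open>If \<open>\<beta> q^p \<le> 1\<close>, then all but the first \<open>p\<close> factors of the numerator are dominated by factors of the
  denominator.\<close>

lemma norm_q_ratio_le:
  assumes "0 \<le> \<beta>"
  shows "\<exists>p. \<forall>b t. norm b \<le> \<beta> \<longrightarrow> 0 < t \<longrightarrow> norm (q_ratio b t) \<le> (1 + \<beta> * t) ^ p"
proof -
  have "(\<lambda>p. \<beta> * q ^ p) \<longlonglongrightarrow> \<beta> * 0"
    using q_pos q_less_1 by (intro tendsto_intros LIMSEQ_power_zero) auto
  hence "\<forall>\<^sub>F p in sequentially. \<beta> * q ^ p < 1" by (intro order_tendstoD) auto
  then obtain p where p: "\<beta> * q ^ p \<le> 1" by (meson eventually_sequentially less_imp_le order_refl)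
  have "norm (q_ratio b t) \<le> (1 + \<beta> * t) ^ p" if b: "norm b \<le> \<beta>" and t: "0 < t" for b t
  proof -
    have num: "norm (qpoch q (- (b * of_real t)) (p + n)) \<le> (1 + \<beta> * t) ^ p * norm (qpoch q (- of_real t) n)" for n
    proof -
      have "norm (qpoch q (- (b * of_real t)) (p + n)) \<le> (\<Prod>k<p + n. 1 + \<beta> * t * q ^ k)"
        unfolding qpoch_def prod_norm[symmetric]
      proof (intro prod_mono conjI norm_ge_zero)
        fix k
        have "norm (1 - - (b * of_real t) * qc ^ k) \<le> 1 + norm (b * of_real t * qc ^ k)"
          using norm_triangle_ineq[of 1 "b * of_real t * qc ^ k"] by simp
        also have "norm (b * of_real t * qc ^ k) = norm b * t * q ^ k"
          using t by (simp only: norm_mult norm_qc_power) simp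
        also have "\<dots> \<le> \<beta> * t * q ^ k" using b t q_pos by (intro mult_right_mono) auto
        finally show "norm (1 - - (b * of_real t) * qc ^ k) \<le> 1 + \<beta> * t * q ^ k" by simp
      qed
      also have "\<dots> = (\<Prod>k<p. 1 + \<beta> * t * q ^ k) * (\<Prod>k<n. 1 + \<beta> * t * q ^ (p + k))"
        by (rule prod_lessThan_add)
      also have "\<dots> \<le> (\<Prod>k<p. 1 + \<beta> * t) * (\<Prod>k<n. 1 + t * q ^ k)"
      proof (intro mult_mono prod_mono prod_nonneg conjI ballI)
        show "1 + \<beta> * t * q ^ k \<le> 1 + \<beta> * t" for k
          using mult_left_mono[OF qpow_le_1[of k], of "\<beta> * t"] assms t by simp
        show "1 + \<beta> * t * q ^ (p + k) \<le> 1 + t * q ^ k" for k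
          using mult_right_mono[OF p, of "t * q ^ k"] t q_pos by (simp add: power_add mult_ac)
      qed (use assms t q_pos in auto)
      also have "(\<Prod>k<n. 1 + t * q ^ k) = norm (qpoch q (- of_real t) n)"
      proof -
        have "norm (1 - - of_real t * qc ^ k) = 1 + t * q ^ k" for k
        proof -
          have "1 - - of_real t * qc ^ k = complex_of_real (1 + t * q ^ k)" by simp
          thus ?thesis using t q_pos by (simp only: norm_of_real) (simp add: add_pos_pos less_imp_le)
        qed
        thus ?thesis unfolding qpoch_def prod_norm[symmetric] by simp
      qed
      finally show ?thesis by simp
    qed
    have "norm (qpoch_inf q (- (b * of_real t))) \<le> (1 + \<beta> * t) ^ p * norm (qpoch_inf q (- of_real t))"
    proof (rule LIMSEQ_le)
      show "(\<lambda>n. norm (qpoch q (- (b * of_real t)) (p + n))) \<longlonglongrightarrow> norm (qpoch_inf q (- (b * of_real t)))"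
        using LIMSEQ_ignore_initial_segment[OF tendsto_norm[OF qpoch_tendsto], of "- (b * of_real t)" p]
        by (simp add: add.commute)
      show "(\<lambda>n. (1 + \<beta> * t) ^ p * norm (qpoch q (- of_real t) n))
          \<longlonglongrightarrow> (1 + \<beta> * t) ^ p * norm (qpoch_inf q (- of_real t))"
        by (intro tendsto_intros qpoch_tendsto)
    qed (use num in auto)
    thus ?thesis
      using qpoch_inf_minus_pos_nonzero[OF t] by (simp add: q_ratio_def norm_divide divide_le_eq)
  qed
  thus ?thesis by blast
qed

text \<open>Up to the factor \<open>\<rho>^n\<close> the numerator is dominated by \<open>\<Prod>(t + q^(k+1)/\<rho>)\<close>. If \<open>q^p \<le> \<rho>\<close>, its \<open>k\<close>-th
  factor is dominated by the factor with index \<open>k - p\<close> of the denominator, so the shifted products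
  cancel and only \<open>p\<close> factors on either side remain. The exponent \<open>p\<close> does not depend on \<open>n\<close>, which
  is what makes the series over \<open>n\<close> converge.\<close>

lemma norm_q_backward_le:
  assumes \<rho>: "norm b \<le> \<rho>" "0 < \<rho>"
  shows "\<exists>p. \<forall>t n. 0 < t \<longrightarrow> norm (q_backward b t n) \<le> \<rho> ^ n * (1 + 1 / (\<rho> * t)) ^ p"
proof -
  have "(\<lambda>p. q ^ p) \<longlonglongrightarrow> 0"
    using q_pos q_less_1 by (intro LIMSEQ_power_zero) auto
  hence "\<forall>\<^sub>F p in sequentially. q ^ p < \<rho>" using \<rho> by (intro order_tendstoD) auto
  then obtain p where p: "q ^ p \<le> \<rho>" by (meson eventually_sequentially less_imp_le order_refl)
  have "norm (q_backward b t n) \<le> \<rho> ^ n * (1 + 1 / (\<rho> * t)) ^ p" if t: "0 < t" for t n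
  proof -
    define s where "s k = t + q ^ Suc k" for k
    define a where "a k = t + q ^ Suc k / \<rho>" for k
    have s_pos: "s k > 0" and a_pos: "a k > 0" and s_ge: "t \<le> s k" for k
      using t q_pos \<rho> by (auto simp: s_def a_def intro!: add_pos_pos)
    have a_le: "a k \<le> t + 1 / \<rho>" for k
      using qpow_le_1[of "Suc k"] \<rho> by (simp add: a_def divide_right_mono del: power_Suc)
    have a_shift: "a (p + k) \<le> s k" for k
    proof -
      have "q ^ Suc k * q ^ p \<le> q ^ Suc k * \<rho>" using p q_pos by (intro mult_left_mono) auto
      hence "q ^ Suc (p + k) / \<rho> \<le> q ^ Suc k"
        using \<rho> by (simp add: divide_le_eq power_add mult_ac)
      thus ?thesis by (simp add: a_def s_def del: power_Suc)
    qed
    have one: "1 + 1 / (\<rho> * t) = (t + 1 / \<rho>) / t" using t \<rho> by (simp add: field_simps)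
    have ratio: "(\<Prod>k<n. a k) / (\<Prod>k<n. s k) \<le> (1 + 1 / (\<rho> * t)) ^ p"
    proof (cases "n \<le> p")
      case True
      have "(\<Prod>k<n. a k) / (\<Prod>k<n. s k) = (\<Prod>k<n. a k / s k)" by (simp add: prod_dividef)
      also have "\<dots> \<le> (\<Prod>k<n. (t + 1 / \<rho>) / t)"
        using a_le s_ge t a_pos s_pos by (intro prod_mono conjI frac_le) (auto simp: less_imp_le intro: order_trans[OF less_imp_le[OF a_pos]])
      also have "\<dots> = (1 + 1 / (\<rho> * t)) ^ n" by (simp add: one)
      also have "\<dots> \<le> (1 + 1 / (\<rho> * t)) ^ p"
        using True t \<rho> by (intro power_increasing) auto
      finally show ?thesis .
    next
      case False
      then obtain m where m: "n = p + m" using le_Suc_ex by (metis nat_le_linear)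
      have "(\<Prod>k<n. a k) = (\<Prod>k<p. a k) * (\<Prod>k<m. a (p + k))"
        unfolding m by (rule prod_lessThan_add)
      also have "\<dots> \<le> (\<Prod>k<p. t + 1 / \<rho>) * (\<Prod>k<m. s k)"
        using a_le a_shift a_pos s_pos
        by (intro mult_mono prod_mono prod_nonneg conjI ballI) (auto simp: less_imp_le intro: order_trans[OF less_imp_le[OF a_pos]])
      finally have A: "(\<Prod>k<n. a k) \<le> (t + 1 / \<rho>) ^ p * (\<Prod>k<m. s k)" by simp
      have "(\<Prod>k<m. s k) * (\<Prod>k<p. t) \<le> (\<Prod>k<m. s k) * (\<Prod>k<p. s (m + k))"
        using s_pos s_ge t by (intro mult_left_mono prod_mono prod_nonneg) (auto simp: less_imp_le)
      also have "\<dots> = (\<Prod>k<n. s k)"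
        unfolding m by (subst add.commute, rule prod_lessThan_add[symmetric])
      finally have S: "(\<Prod>k<m. s k) * t ^ p \<le> (\<Prod>k<n. s k)" by simp
      have sm: "(\<Prod>k<m. s k) > 0" using s_pos by (intro prod_pos) auto
      have "(\<Prod>k<n. a k) / (\<Prod>k<n. s k) \<le> ((t + 1 / \<rho>) ^ p * (\<Prod>k<m. s k)) / ((\<Prod>k<m. s k) * t ^ p)"
        using A S sm t \<rho> a_pos by (intro frac_le) (auto intro!: mult_nonneg_nonneg)
      also have "\<dots> = (1 + 1 / (\<rho> * t)) ^ p"
      proof -
        have "x * S / (S * y) = x / y" if "S > 0" for x y S :: real using that by simp
        from this[OF sm] show ?thesis by (simp only: one power_divide)
      qed
      finally show ?thesis .
    qed
    have "norm (q_backward b t n) = (\<Prod>k<n. norm (b * of_real t + qc ^ Suc k) / s k)"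
    proof -
      have "norm (of_real t + qc ^ Suc k) = s k" for k
      proof -
        have "of_real t + qc ^ Suc k = complex_of_real (s k)" by (simp add: s_def)
        thus ?thesis using s_pos[of k] by (simp only: norm_of_real abs_of_pos)
      qed
      thus ?thesis unfolding q_backward_def prod_norm[symmetric] norm_divide by simp
    qed
    also have "\<dots> \<le> (\<Prod>k<n. \<rho> * a k / s k)"
    proof (intro prod_mono conjI divide_right_mono)
      fix k
      have "norm (b * of_real t + qc ^ Suc k) \<le> norm (b * of_real t) + norm (qc ^ Suc k)"
        by (rule norm_triangle_ineq)
      also have "\<dots> = norm b * t + q ^ Suc k"
        using t by (simp only: norm_qc_power norm_mult) simp
      also have "\<dots> \<le> \<rho> * t + q ^ Suc k"
        using \<rho> t by (intro add_right_mono mult_right_mono) auto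
      also have "\<dots> = \<rho> * a k" using \<rho> by (simp add: a_def algebra_simps)
      finally show "norm (b * of_real t + qc ^ Suc k) \<le> \<rho> * a k" .
    qed (use s_pos in \<open>auto simp: less_imp_le\<close>)
    also have "\<dots> = \<rho> ^ n * ((\<Prod>k<n. a k) / (\<Prod>k<n. s k))"
      by (simp add: prod.distrib prod_dividef)
    also have "\<dots> \<le> \<rho> ^ n * (1 + 1 / (\<rho> * t)) ^ p"
      using ratio \<rho> by (intro mult_left_mono) auto
    finally show ?thesis .
  qed
  thus ?thesis by blast
qed

lemma power_one_plus_exp_le:
  assumes "0 \<le> \<beta>"
  shows "(1 + \<beta> * exp u) ^ p \<le> (1 + \<beta>) ^ p * exp (real p * \<bar>u\<bar>)"
    and "(1 + \<beta> / exp u) ^ p \<le> (1 + \<beta>) ^ p * exp (real p * \<bar>u\<bar>)"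
proof -
  have "1 + \<beta> * exp v \<le> (1 + \<beta>) * exp \<bar>v\<bar>" for v :: real
    using assms mult_left_mono[of "exp v" "exp \<bar>v\<bar>" \<beta>] one_le_exp_iff[of "\<bar>v\<bar>"]
    by (simp add: algebra_simps add_mono)
  from power_mono[OF this] have *: "(1 + \<beta> * exp v) ^ p \<le> (1 + \<beta>) ^ p * exp (real p * \<bar>v\<bar>)" for v
    using assms by (simp add: power_mult_distrib exp_of_nat_mult)
  show "(1 + \<beta> * exp u) ^ p \<le> (1 + \<beta>) ^ p * exp (real p * \<bar>u\<bar>)" by (rule *)
  show "(1 + \<beta> / exp u) ^ p \<le> (1 + \<beta>) ^ p * exp (real p * \<bar>u\<bar>)"
    using *[of "- u"] by (simp add: exp_minus field_simps)
qed

lemma measurable_kappa: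
  assumes "kernel_domain e w"
  shows "(\<lambda>u::real. kappa q e (of_real u - w)) \<in> borel_measurable borel"
proof -
  have "continuous_on UNIV (\<lambda>u::real. kappa q e (of_real u - w))"
    using assms by (intro kappa_continuous continuous_intros) auto
  thus ?thesis by (rule borel_measurable_continuous_onI)
qed

lemma measurable_q_ratio: "(\<lambda>u. q_ratio b (c * exp u)) \<in> borel_measurable borel" if "c > 0"
proof -
  have "continuous_on UNIV (\<lambda>u. q_ratio b (c * exp u))"
    unfolding q_ratio_def using qpoch_inf_minus_pos_nonzero that
    by (intro continuous_intros) (auto simp del: of_real_mult)
  thus ?thesis by (rule borel_measurable_continuous_onI)
qed

lemma measurable_q_backward: "(\<lambda>u. q_backward b (exp u) n) \<in> borel_measurable borel"
proof -
  have "of_real (exp u) + qc ^ Suc k \<noteq> 0" for u k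
  proof -
    have "of_real (exp u) + qc ^ Suc k = complex_of_real (exp u + q ^ Suc k)" by simp
    moreover have "exp u + q ^ Suc k > 0" using q_pos by (intro add_pos_pos) auto
    ultimately show ?thesis by (metis of_real_eq_0_iff less_irrefl)
  qed
  hence "continuous_on UNIV (\<lambda>u. q_backward b (exp u) n)"
    unfolding q_backward_def by (intro continuous_intros) auto
  thus ?thesis by (rule borel_measurable_continuous_onI)
qed

text \<open>The rescaling that leads to the third formula, for both of its sides at once: \<open>f n u = g n (u + n L)\<close>
  by the functional equation of the kernel. The terms \<open>g n\<close> are the ones with a geometric bound, of ratio
  \<open>|az| \<rho>\<close>. They are taken with \<open>\<beta> = 0\<close> and \<open>c n = (b;q)\<^sub>n/(q;q)\<^sub>n\<close> for \<open>U\<close> itself, where \<open>\<rho>\<close> may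
  be arbitrarily small, and with \<open>\<beta> = b\<close> and \<open>c n = 1/(q;q)\<^sub>n\<close> for the other side, where
  \<open>\<rho> \<ge> |b|\<close>.\<close>

lemma backward_series_transfer:
  fixes a b z w \<beta> :: complex and c :: "nat \<Rightarrow> complex"
  assumes z: "z = exp w" and dom: "kernel_domain e w"
    and \<rho>: "norm \<beta> \<le> \<rho>" "0 < \<rho>" "norm (a * z) * \<rho> < 1"
    and c: "\<And>n. norm (c n) \<le> C"
  defines "g \<equiv> \<lambda>n u. c n * (a * z) ^ n * (q_ratio b (exp u) * q_backward \<beta> (exp u) n)
                       * kappa q e (of_real u - w)"
  defines "f \<equiv> \<lambda>n u. c n * qc ^ (n choose 2) * (a * of_real (exp u)) ^ n
        * (qpoch q (- (\<beta> * of_real (exp u))) n * qpoch_inf q (- (b * of_real (exp u)) * qc ^ n)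
           / qpoch_inf q (- of_real (exp u))) * kappa q e (of_real u - w)"
  assumes summable_f: "\<And>u. summable (\<lambda>n. norm (f n u))"
  shows "integrable lborel (\<lambda>u. \<Sum>n. f n u)" and "integrable lborel (\<lambda>u. \<Sum>n. g n u)"
    and "integral\<^sup>L lborel (\<lambda>u. \<Sum>n. f n u) = integral\<^sup>L lborel (\<lambda>u. \<Sum>n. g n u)"
proof -
  obtain p1 where p1: "\<And>t. 0 < t \<Longrightarrow> norm (q_ratio b t) \<le> (1 + norm b * t) ^ p1"
    using norm_q_ratio_le[of "norm b"] by auto
  obtain p2 where p2: "\<And>t n. 0 < t \<Longrightarrow> norm (q_backward \<beta> t n) \<le> \<rho> ^ n * (1 + 1 / (\<rho> * t)) ^ p2"
    using norm_q_backward_le[OF \<rho>(1,2)] by auto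
  have C0: "0 \<le> C" using c[of 0] norm_ge_zero order_trans by blast
  define K where "K = C * (1 + norm b) ^ p1 * (1 + 1 / \<rho>) ^ p2"
  define h where "h u = exp (real (p1 + p2) * \<bar>u\<bar>) * norm (kappa q e (of_real u - w))" for u :: real
  note [measurable] = measurable_kappa[OF dom] measurable_q_ratio[of 1, simplified] measurable_q_backward
  have meas: "g n \<in> borel_measurable borel" for n
    unfolding g_def by measurable
  have bound: "norm (g n u) \<le> (K * (norm (a * z) * \<rho>) ^ n) * h u" for n u
  proof -
    have "norm (g n u) = norm (c n) * norm (a * z) ^ n * (norm (q_ratio b (exp u)) * norm (q_backward \<beta> (exp u) n))
        * norm (kappa q e (of_real u - w))"
      by (simp add: g_def norm_mult norm_power power_mult_distrib)
    also have "\<dots> \<le> C * norm (a * z) ^ n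
        * (((1 + norm b) ^ p1 * exp (real p1 * \<bar>u\<bar>)) * (\<rho> ^ n * ((1 + 1 / \<rho>) ^ p2 * exp (real p2 * \<bar>u\<bar>))))
        * norm (kappa q e (of_real u - w))"
    proof (intro mult_right_mono mult_mono)
      show "norm (q_ratio b (exp u)) \<le> (1 + norm b) ^ p1 * exp (real p1 * \<bar>u\<bar>)"
        using order_trans[OF p1 power_one_plus_exp_le(1)[of "norm b" u p1]] by simp
      have "norm (q_backward \<beta> (exp u) n) \<le> \<rho> ^ n * (1 + (1 / \<rho>) / exp u) ^ p2"
        using p2[of "exp u" n] by (simp add: divide_divide_eq_left)
      also have "\<dots> \<le> \<rho> ^ n * ((1 + 1 / \<rho>) ^ p2 * exp (real p2 * \<bar>u\<bar>))"
        using \<rho> by (intro mult_left_mono power_one_plus_exp_le(2)) auto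
      finally show "norm (q_backward \<beta> (exp u) n) \<le> \<rho> ^ n * ((1 + 1 / \<rho>) ^ p2 * exp (real p2 * \<bar>u\<bar>))" .
    qed (use c C0 \<rho> in auto)
    also have "\<dots> = (K * (norm (a * z) * \<rho>) ^ n) * h u"
      by (simp add: K_def h_def exp_add algebra_simps)
    finally show ?thesis .
  qed
  have A: "summable (\<lambda>n. K * (norm (a * z) * \<rho>) ^ n)"
    using \<rho> by (intro summable_mult summable_geometric) (auto simp: norm_mult)
  have h: "integrable lborel h"
    unfolding h_def by (rule integrable_exp_kappa[OF dom])
  have fg: "f n u = g n (real n * L + 1 * u)" for n u
  proof -
    have e: "exp (real n * L + 1 * u) = q ^ n * exp u"
      using q_pos by (simp add: exp_add exp_of_nat_mult)
    have k: "kappa q e (of_real (real n * L + 1 * u) - w)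
        = qc ^ (n choose 2) * (of_real (exp u) / z) ^ n * kappa q e (of_real u - w)"
      using kappa_shift[of e "of_real u - w" n]
      by (simp add: z exp_diff exp_of_real algebra_simps)
    have zn: "(a * z) ^ n * (of_real (exp u) / z) ^ n = (a * of_real (exp u)) ^ n"
      using z by (simp add: power_mult_distrib[symmetric])
    show ?thesis
      unfolding f_def g_def e k q_ratio_backward_scaled[OF exp_gt_zero] zn[symmetric]
      by (simp only: mult_ac times_divide_eq_right times_divide_eq_left)
  qed
  note * = integral_series_affine[OF meas bound A h fg _ summable_f]
  show "integrable lborel (\<lambda>u. \<Sum>n. f n u)" and "integrable lborel (\<lambda>u. \<Sum>n. g n u)"
    and "integral\<^sup>L lborel (\<lambda>u. \<Sum>n. f n u) = integral\<^sup>L lborel (\<lambda>u. \<Sum>n. g n u)"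
    using *(1,2,4) by auto
qed

section \<open>The first three representations\<close>

text \<open>The integrand of \<open>U\<close> as a function of \<open>u = ln t\<close>, the factor \<open>1/t\<close> being absorbed into \<open>du\<close>.\<close>

definition U_log :: "kernel \<Rightarrow> complex \<Rightarrow> complex \<Rightarrow> complex \<Rightarrow> real \<Rightarrow> complex" where
  "U_log e a b w u = qhyp [a, b] [0] q (- of_real (exp u)) * kappa q e (of_real u - w)"

lemma qhyp_21_neg:
  assumes "t > 0"
  shows "qhyp [a, b] [0] q (- of_real t)
     = (\<Sum>n. jackson_term b (- (b * of_real t)) (- (a * of_real t)) n) / qpoch_inf q (- of_real t)"
proof -
  have "- complex_of_real t \<in> slit_plane" using assms by (auto simp: complex_eq_iff)
  from qhyp_21_eq_jackson[OF this, of a b] show ?thesis by simp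
qed

lemma prod_qpow: "(\<Prod>k<n. qc ^ k) = qc ^ (n choose 2)"
  by (induction n) (simp_all add: choose_two_Suc power_add numeral_2_eq_2)

text \<open>The case \<open>C = -q/t\<close>, \<open>p = by\<close>, \<open>r = -qy/t\<close> of \<open>jackson_sums\<close>.\<close>

lemma backward_identity:
  assumes t: "t > 0" and y: "norm (b * y) < 1"
  shows "(\<lambda>n. qpoch q b n / qpoch q qc n * y ^ n * q_backward 0 t n)
      sums (qpoch_inf q (b * y) * (\<Sum>n. 1 / qpoch q qc n * y ^ n * q_backward b t n))"
    and "summable (\<lambda>n. 1 / qpoch q qc n * y ^ n * q_backward b t n)"
proof -
  define C where "C = - (qc / of_real t)"
  define r where "r = - (y * qc / of_real t)"
  have t0: "complex_of_real t \<noteq> 0" using t by simp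
  have den: "of_real t + qc ^ Suc k = of_real t * (1 - C * qc ^ k)" for k
    using t by (simp add: C_def field_simps)
  have den_nz: "1 - C * qc ^ k \<noteq> 0" for k
  proof -
    have "1 - C * qc ^ k = complex_of_real (1 + q / t * q ^ k)" by (simp add: C_def)
    moreover have "1 + q / t * q ^ k > 0" using t q_pos by (intro add_pos_pos) auto
    ultimately show ?thesis by (metis of_real_eq_0_iff less_irrefl)
  qed
  have C: "qpoch q C n \<noteq> 0" for n
    using den_nz by (auto simp: qpoch_def)
  have bw: "q_backward \<beta> t n = (\<Prod>k<n. (\<beta> * of_real t + qc ^ Suc k) / of_real t) / qpoch q C n" for \<beta> n
    unfolding q_backward_def qpoch_def den prod_dividef[symmetric]
    by (intro prod.cong refl) (simp add: field_simps)
  have u: "(\<Prod>k<n. b * y - r * qc ^ k) / (qpoch q qc n * qpoch q C n)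
      = 1 / qpoch q qc n * y ^ n * q_backward b t n" for n
  proof -
    have "b * y - r * qc ^ k = y * ((b * of_real t + qc ^ Suc k) / of_real t)" for k
      using t by (simp add: r_def field_simps)
    hence "(\<Prod>k<n. b * y - r * qc ^ k) = y ^ n * (\<Prod>k<n. (b * of_real t + qc ^ Suc k) / of_real t)"
      by (simp only: prod.distrib prod_constant card_lessThan)
    thus ?thesis unfolding bw by simp
  qed
  have v: "(-1) ^ n * qc ^ (n choose 2) * (\<Prod>k<n. r - C * (b * y) * qc ^ k) / (qpoch q qc n * qpoch q C n)
      = qpoch q b n / qpoch q qc n * y ^ n * q_backward 0 t n" for n
  proof -
    have "r - C * (b * y) * qc ^ k = (- 1) * y * (qc / of_real t) * (1 - b * qc ^ k)" for k
      by (simp add: r_def C_def algebra_simps)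
    hence "(\<Prod>k<n. r - C * (b * y) * qc ^ k) = (-1) ^ n * y ^ n * (qc / of_real t) ^ n * qpoch q b n"
      by (simp only: prod.distrib prod_constant card_lessThan qpoch_def)
    hence "(-1) ^ n * qc ^ (n choose 2) * (\<Prod>k<n. r - C * (b * y) * qc ^ k)
        = ((-1) ^ n * (-1) ^ n) * (qc ^ (n choose 2) * (y ^ n * (qc / of_real t) ^ n * qpoch q b n))"
      by (simp only: mult_ac)
    moreover have "(-1) ^ n * (-1) ^ n = (1 :: complex)" by (simp flip: power_mult_distrib)
    moreover have "(\<Prod>k<n. (0 * of_real t + qc ^ Suc k) / of_real t) = qc ^ (n choose 2) * (qc / of_real t) ^ n"
    proof -
      have "(0 * of_real t + qc ^ Suc k) / of_real t = qc ^ k * (qc / of_real t)" for k by simp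
      thus ?thesis by (simp only: prod.distrib prod_qpow prod_constant card_lessThan)
    qed
    ultimately show ?thesis unfolding bw by (simp add: mult_ac)
  qed
  show "(\<lambda>n. qpoch q b n / qpoch q qc n * y ^ n * q_backward 0 t n)
      sums (qpoch_inf q (b * y) * (\<Sum>n. 1 / qpoch q qc n * y ^ n * q_backward b t n))"
    using jackson_sums[OF C y, of r] unfolding u v .
  show "summable (\<lambda>n. 1 / qpoch q qc n * y ^ n * q_backward b t n)"
    using summable_norm_cancel[OF summable_jackson_lhs[OF C y, of r]] unfolding u .
qed

text \<open>Integrability of the integrand of \<open>U\<close> is not visible from Jackson's series, whose terms grow too fast
  when they are estimated one by one at fixed \<open>t\<close>; it comes out of the rescaled series.\<close>

lemma U_log_backward:
  assumes z: "z = exp w" and dom: "kernel_domain e w"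
  shows "integrable lborel (U_log e a b w)"
    and "integral\<^sup>L lborel (U_log e a b w) = (LBINT u. (\<Sum>n. qpoch q b n / qpoch q qc n * (a * z) ^ n
           * (q_ratio b (exp u) * q_backward 0 (exp u) n) * kappa q e (of_real u - w)))"
proof -
  define f where "f n u = qpoch q b n / qpoch q qc n * qc ^ (n choose 2) * (a * of_real (exp u)) ^ n
        * (qpoch q (- (0 * of_real (exp u))) n * qpoch_inf q (- (b * of_real (exp u)) * qc ^ n)
           / qpoch_inf q (- of_real (exp u))) * kappa q e (of_real u - w)" for n u
  obtain C where C: "\<And>n. norm (qpoch q b n / qpoch q qc n) \<le> C"
    using qpoch_ratio_bounded by blast
  have f_eq: "f n u = jackson_term b (- (b * of_real (exp u))) (- (a * of_real (exp u))) n
      * (kappa q e (of_real u - w) / qpoch_inf q (- of_real (exp u)))" for n u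
  proof -
    have sign: "(-1) ^ n * ((-1) ^ n * x) = x" for x :: complex
      by (simp flip: power_mult_distrib mult.assoc)
    show ?thesis
      unfolding f_def jackson_term_def euler_coeff_def power_minus[of "a * _"]
      using sign by (simp add: mult_ac)
  qed
  have summable_f: "summable (\<lambda>n. norm (f n u))" for u
    unfolding f_eq norm_mult by (intro summable_mult2 summable_norm_jackson_term)
  have sum_f: "(\<Sum>n. f n u) = U_log e a b w u" for u
    unfolding f_eq U_log_def qhyp_21_neg[OF exp_gt_zero]
    by (subst suminf_mult2[OF summable_norm_cancel[OF summable_norm_jackson_term], symmetric]) simp
  \<comment> \<open>any positive value with \<open>|az| \<rho> < 1\<close>\<close>
  define \<rho> where "\<rho> = 1 / (2 * (norm (a * z) + 1))"
  have \<rho>: "norm (0 :: complex) \<le> \<rho>" "0 < \<rho>" "norm (a * z) * \<rho> < 1"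
    by (auto simp: \<rho>_def field_simps add_pos_nonneg intro: add_nonneg_pos)
  note * = backward_series_transfer[where b = b and c = "\<lambda>n. qpoch q b n / qpoch q qc n", OF z dom \<rho> C, folded f_def, OF summable_f, unfolded sum_f]
  show "integrable lborel (U_log e a b w)" using *(1) by simp
  show "integral\<^sup>L lborel (U_log e a b w) = (LBINT u. (\<Sum>n. qpoch q b n / qpoch q qc n * (a * z) ^ n
           * (q_ratio b (exp u) * q_backward 0 (exp u) n) * kappa q e (of_real u - w)))"
    using *(3) by simp
qed

text \<open>Rescaling turns both sides into series in \<open>az\<close> under the integral sign, and
  \<open>backward_identity\<close> compares these pointwise.\<close>

lemma U_log_third_form:
  fixes a b z w :: complex
  assumes z: "z = exp w" and dom: "kernel_domain e w" and abz: "norm (a * b * z) < 1"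
  defines "F \<equiv> \<lambda>u. qpoch_inf q (- (a * of_real (exp u))) * q_ratio b (exp u) * kappa q e (of_real u - w)"
  shows "integrable lborel F"
    and "integral\<^sup>L lborel (U_log e a b w) = qpoch_inf q (a * b * z) * integral\<^sup>L lborel F"
proof -
  define f where "f n u = 1 / qpoch q qc n * qc ^ (n choose 2) * (a * of_real (exp u)) ^ n
        * (qpoch q (- (b * of_real (exp u))) n * qpoch_inf q (- (b * of_real (exp u)) * qc ^ n)
           / qpoch_inf q (- of_real (exp u))) * kappa q e (of_real u - w)" for n u
  obtain C where C: "\<And>n. norm (1 / qpoch q qc n) \<le> C"
    using qpoch_ratio_bounded[of 0] by auto
  have f_eq: "f n u = euler_coeff n * (- (a * of_real (exp u))) ^ n
      * (q_ratio b (exp u) * kappa q e (of_real u - w))" for n u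
  proof -
    have sign: "(-1) ^ n * ((-1) ^ n * x) = x" for x :: complex
      by (simp flip: power_mult_distrib mult.assoc)
    show ?thesis
      unfolding f_def euler_coeff_def power_minus[of "a * _"] q_ratio_def qpoch_inf_split[of _ n, symmetric]
      using sign by (simp add: mult_ac)
  qed
  have summable_f: "summable (\<lambda>n. norm (f n u))" for u
    unfolding f_eq norm_mult[of "euler_coeff _ * _"] by (intro summable_mult2 summable_norm_euler)
  have sum_f: "(\<Sum>n. f n u) = F u" for u
    using sums_mult2[OF euler_sums[of "- (a * of_real (exp u))"], of "q_ratio b (exp u) * kappa q e (of_real u - w)"]
    by (simp add: f_eq sums_iff F_def mult.assoc)
  \<comment> \<open>\<open>\<rho> = |b|\<close> is the natural choice but must be positive\<close>
  obtain \<rho> where \<rho>: "norm b \<le> \<rho>" "0 < \<rho>" "norm (a * z) * \<rho> < 1"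
  proof (cases "b = 0")
    case True
    have "norm (a * z) * (1 / (2 * (norm (a * z) + 1))) < 1" "0 < 1 / (2 * (norm (a * z) + 1))"
      by (auto simp: field_simps add_pos_nonneg intro: add_nonneg_pos)
    with that[of "1 / (2 * (norm (a * z) + 1))"] True show ?thesis by simp
  next
    case False
    with that[of "norm b"] abz show ?thesis by (simp add: norm_mult mult_ac)
  qed
  note * = backward_series_transfer[where b = b and c = "\<lambda>n. 1 / qpoch q qc n", OF z dom \<rho> C, folded f_def, OF summable_f, unfolded sum_f]
  show "integrable lborel F" using *(1) by simp
  have pt: "(\<Sum>n. qpoch q b n / qpoch q qc n * (a * z) ^ n
           * (q_ratio b (exp u) * q_backward 0 (exp u) n) * kappa q e (of_real u - w))
      = qpoch_inf q (a * b * z) * (\<Sum>n. 1 / qpoch q qc n * (a * z) ^ n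
           * (q_ratio b (exp u) * q_backward b (exp u) n) * kappa q e (of_real u - w))" for u
  proof -
    have n: "norm (b * (a * z)) < 1" using abz by (simp add: mult_ac)
    let ?K = "q_ratio b (exp u) * kappa q e (of_real u - w)"
    have 1: "(\<lambda>n. 1 / qpoch q qc n * (a * z) ^ n * (q_ratio b (exp u) * q_backward b (exp u) n)
        * kappa q e (of_real u - w)) sums ((\<Sum>n. 1 / qpoch q qc n * (a * z) ^ n * q_backward b (exp u) n) * ?K)"
      using sums_mult2[OF summable_sums[OF backward_identity(2)[OF exp_gt_zero n, of u]], of ?K]
      by (simp only: mult_ac)
    have 2: "(\<lambda>n. qpoch q b n / qpoch q qc n * (a * z) ^ n * (q_ratio b (exp u) * q_backward 0 (exp u) n)
        * kappa q e (of_real u - w)) sums (qpoch_inf q (b * (a * z))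
          * (\<Sum>n. 1 / qpoch q qc n * (a * z) ^ n * q_backward b (exp u) n) * ?K)"
      using sums_mult2[OF backward_identity(1)[OF exp_gt_zero n, of u], of ?K]
      by (simp only: mult_ac)
    show ?thesis
      unfolding sums_unique[OF 1, symmetric] sums_unique[OF 2, symmetric] by (simp only: mult_ac)
  qed
  show "integral\<^sup>L lborel (U_log e a b w) = qpoch_inf q (a * b * z) * integral\<^sup>L lborel F"
    unfolding U_log_backward(2)[OF z dom] pt using *(2,3)
    by (simp add: integral_mult_right)
qed

lemma countable_qpoch_zeros: "countable {u :: real. qpoch_inf q (c * of_real (exp u)) = 0}"
proof (rule countable_subset)
  show "{u :: real. qpoch_inf q (c * of_real (exp u)) = 0} \<subseteq> range (\<lambda>k. ln (1 / (norm c * q ^ k)))"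
  proof
    fix u :: real assume "u \<in> {u. qpoch_inf q (c * of_real (exp u)) = 0}"
    then obtain k where "c * of_real (exp u) * qc ^ k = 1" by (auto simp: qpoch_inf_eq_0_iff)
    from arg_cong[OF this, of norm] have *: "norm c * q ^ k * exp u = 1"
      by (simp add: norm_mult norm_power q_pos less_imp_le mult_ac del: of_real_exp)
    hence "exp u = 1 / (norm c * q ^ k)" by (metis mult_eq_0_iff nonzero_eq_divide_eq mult.commute zero_neq_one)
    hence "u = ln (1 / (norm c * q ^ k))" by (metis ln_exp)
    thus "u \<in> range (\<lambda>k. ln (1 / (norm c * q ^ k)))" by blast
  qed
qed simp

lemma countable_qpoch_zeros_inverse: "countable {u :: real. qpoch_inf q (c / of_real (exp u)) = 0}"
proof -
  have "{u :: real. qpoch_inf q (c / of_real (exp u)) = 0}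
      = uminus ` {u :: real. qpoch_inf q (c * of_real (exp u)) = 0}"
  proof (intro equalityI subsetI)
    fix u :: real assume "u \<in> {u. qpoch_inf q (c / of_real (exp u)) = 0}"
    thus "u \<in> uminus ` {u :: real. qpoch_inf q (c * of_real (exp u)) = 0}"
      by (intro image_eqI[of _ _ "- u"]) (auto simp: exp_minus divide_inverse)
  qed (auto simp: exp_minus divide_inverse)
  thus ?thesis using countable_qpoch_zeros by simp
qed

lemma U_log_first_form:
  fixes a b w :: complex
  assumes dom: "kernel_domain e w"
  defines "F \<equiv> \<lambda>u. qpoch_inf q (- (b * of_real (exp u))) / qpoch_inf q (- of_real (exp u))
     * qhyp [b] [- (b * of_real (exp u))] q (- (a * of_real (exp u))) * kappa q e (of_real u - w)"
  shows "integrable lborel F" and "integral\<^sup>L lborel (U_log e a b w) = integral\<^sup>L lborel F"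
proof -
  have eq: "U_log e a b w u = F u" if "u \<notin> {u :: real. qpoch_inf q (- b * of_real (exp u)) = 0}" for u
    using that qhyp_11_eq_jackson_series[of "- (b * of_real (exp u))" b "- (a * of_real (exp u))"]
    by (simp add: U_log_def F_def qhyp_21_neg[OF exp_gt_zero] flip: mult.assoc del: of_real_exp)
  note * = lborel_discrete_difference[where F = "U_log e a b w" and H = F, OF countable_qpoch_zeros[of "- b"] eq]
  show "integrable lborel F" and "integral\<^sup>L lborel (U_log e a b w) = integral\<^sup>L lborel F"
    using U_log_backward(1)[OF refl dom] * by auto
qed

text \<open>The case \<open>C = -bt\<close>, \<open>p = a\<close>, \<open>r = -at\<close> of \<open>jackson_sums\<close>, combined with Jackson's
  transformation.\<close>

lemma forward_identity:
  assumes t: "t > 0" and a: "norm a < 1" and nz: "qpoch_inf q (- (b * of_real t)) \<noteq> 0"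
  shows "qpoch_inf q a * (\<Sum>n. a ^ n / qpoch q qc n * q_ratio b (q ^ n * t)) = qhyp [a, b] [0] q (- of_real t)"
proof -
  define c where "c = - (b * complex_of_real t)"
  define r where "r = - (a * complex_of_real t)"
  have split: "qpoch_inf q c = qpoch q c n * qpoch_inf q (c * qc ^ n)" for n
    by (rule qpoch_inf_split)
  have C: "qpoch q c n \<noteq> 0" for n
    using nz split[of n] by (auto simp: c_def)
  have C': "qpoch_inf q (c * qc ^ n) \<noteq> 0" for n
    using nz split[of n] by (auto simp: c_def)
  have u: "(\<Prod>k<n. a - r * qc ^ k) / (qpoch q qc n * qpoch q c n)
      = (a ^ n / qpoch q qc n * q_ratio b (q ^ n * t)) / q_ratio b t" for n
  proof -
    have "a - r * qc ^ k = a * (1 - (- of_real t) * qc ^ k)" for k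
      by (simp add: r_def algebra_simps)
    hence "(\<Prod>k<n. a - r * qc ^ k) = a ^ n * qpoch q (- of_real t) n"
      by (simp add: prod.distrib qpoch_def)
    moreover have "q_ratio b (q ^ n * t) / q_ratio b t = qpoch q (- of_real t) n / qpoch q c n"
      unfolding q_ratio_scaled[OF t] using split[of n] C[of n] C'[of n] qpoch_inf_minus_pos_nonzero[OF t]
      by (simp add: q_ratio_def c_def field_simps)
    ultimately show ?thesis
      by (metis (no_types, lifting) times_divide_eq_left times_divide_eq_right divide_divide_eq_left)
  qed
  have v: "(-1) ^ n * qc ^ (n choose 2) * (\<Prod>k<n. r - c * a * qc ^ k) / (qpoch q qc n * qpoch q c n)
      = jackson_term b c r n / qpoch_inf q c" for n
  proof -
    have "r - c * a * qc ^ k = r * (1 - b * qc ^ k)" for k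
      by (simp add: r_def c_def algebra_simps)
    hence "(\<Prod>k<n. r - c * a * qc ^ k) = r ^ n * qpoch q b n"
      by (simp add: prod.distrib qpoch_def)
    thus ?thesis using split[of n] C[of n] C'[of n]
      by (simp add: jackson_term_def euler_coeff_def mult_ac)
  qed
  have ratio_nz: "q_ratio b t \<noteq> 0"
    using nz qpoch_inf_minus_pos_nonzero[OF t] by (simp add: q_ratio_def)
  have sm: "summable (\<lambda>n. (a ^ n / qpoch q qc n * q_ratio b (q ^ n * t)) / q_ratio b t)"
    using summable_norm_cancel[OF summable_jackson_lhs[OF C a, of r]] unfolding u .
  have sm': "summable (\<lambda>n. a ^ n / qpoch q qc n * q_ratio b (q ^ n * t))"
    using summable_mult2[OF sm, of "q_ratio b t"] ratio_nz by simp
  have "(\<lambda>n. jackson_term b c r n / qpoch_inf q c) sums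
      (qpoch_inf q a * (\<Sum>n. (a ^ n / qpoch q qc n * q_ratio b (q ^ n * t)) / q_ratio b t))"
    using jackson_sums[OF C a, of r] unfolding u v .
  moreover have "(\<lambda>n. jackson_term b c r n / qpoch_inf q c) sums ((\<Sum>n. jackson_term b c r n) / qpoch_inf q c)"
    by (intro sums_divide summable_sums summable_norm_cancel[OF summable_norm_jackson_term])
  ultimately have "qpoch_inf q a * ((\<Sum>n. a ^ n / qpoch q qc n * q_ratio b (q ^ n * t)) / q_ratio b t)
      = (\<Sum>n. jackson_term b c r n) / qpoch_inf q c"
    unfolding suminf_divide[OF sm', of "q_ratio b t"] by (rule sums_unique2)
  thus ?thesis
    using ratio_nz nz by (simp add: qhyp_21_neg[OF t] q_ratio_def c_def r_def field_simps)
qed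

text \<open>The bound is found for the terms \<open>g n\<close> of \<open>forward_identity\<close>, which decay like \<open>|a|^n\<close>. Their
  rescaled versions \<open>f n\<close> are the terms of Euler's expansion of \<open>(-aqz/t;q)\<^sub>\<infinity>\<close>.\<close>

lemma U_log_second_form:
  fixes a b z w :: complex
  assumes z: "z = exp w" and dom: "kernel_domain e w" and a: "norm a < 1"
  defines "F \<equiv> \<lambda>u. qpoch_inf q (- (a * qc * z / of_real (exp u))) * q_ratio b (exp u) * kappa q e (of_real u - w)"
  shows "integrable lborel F"
    and "integral\<^sup>L lborel (U_log e a b w) = qpoch_inf q a * integral\<^sup>L lborel F"
proof -
  define g where "g n u = a ^ n / qpoch q qc n * q_ratio b (q ^ n * exp u) * kappa q e (of_real u - w)" for n u
  define f where "f n u = euler_coeff n * (- (a * qc * z / of_real (exp u))) ^ n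
      * (q_ratio b (exp u) * kappa q e (of_real u - w))" for n u
  obtain C where C: "C > 0" "\<And>n. norm (1 / qpoch q qc n) \<le> C"
    using qpoch_ratio_bounded[of 0] by auto
  obtain p where p: "\<And>t. 0 < t \<Longrightarrow> norm (q_ratio b t) \<le> (1 + norm b * t) ^ p"
    using norm_q_ratio_le[of "norm b"] by auto
  define h where "h u = exp (real p * \<bar>u\<bar>) * norm (kappa q e (of_real u - w))" for u :: real
  have meas: "g n \<in> borel_measurable borel" for n
  proof -
    note [measurable] = measurable_kappa[OF dom] measurable_q_ratio[OF qpow_pos]
    show ?thesis unfolding g_def by measurable
  qed
  have bound: "norm (g n u) \<le> (C * (1 + norm b) ^ p * norm a ^ n) * h u" for n u
  proof -
    have "norm (q_ratio b (q ^ n * exp u)) \<le> (1 + norm b * (q ^ n * exp u)) ^ p"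
      using p[of "q ^ n * exp u"] qpow_pos by simp
    also have "\<dots> \<le> (1 + norm b * exp u) ^ p"
      using qpow_le_1[of n] qpow_pos[of n]
      by (intro power_mono add_left_mono mult_left_mono) (auto intro!: add_nonneg_nonneg mult_nonneg_nonneg)
    also have "\<dots> \<le> (1 + norm b) ^ p * exp (real p * \<bar>u\<bar>)"
      by (rule power_one_plus_exp_le) simp
    finally have r: "norm (q_ratio b (q ^ n * exp u)) \<le> (1 + norm b) ^ p * exp (real p * \<bar>u\<bar>)" .
    have "norm (g n u) = norm (1 / qpoch q qc n) * norm a ^ n * norm (q_ratio b (q ^ n * exp u))
        * norm (kappa q e (of_real u - w))"
      by (simp add: g_def norm_mult norm_divide norm_power)
    also have "\<dots> \<le> C * norm a ^ n * ((1 + norm b) ^ p * exp (real p * \<bar>u\<bar>)) * norm (kappa q e (of_real u - w))"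
      using C r by (intro mult_right_mono mult_mono) auto
    finally show ?thesis by (simp add: h_def mult_ac)
  qed
  have A: "summable (\<lambda>n. C * (1 + norm b) ^ p * norm a ^ n)"
    using a by (intro summable_mult summable_geometric) auto
  have h: "integrable lborel h"
    unfolding h_def by (rule integrable_exp_kappa[OF dom])
  have gf: "g n u = f n (u + real n * L)" for n u
  proof -
    have e: "exp (u + real n * L) = q ^ n * exp u"
      using q_pos by (simp add: exp_add exp_of_nat_mult)
    have k: "kappa q e (of_real (u + real n * L) - w)
        = qc ^ (n choose 2) * (of_real (exp u) / z) ^ n * kappa q e (of_real u - w)"
      using kappa_shift[of e "of_real u - w" n]
      by (simp add: z exp_diff exp_of_real algebra_simps)
    have "qc ^ (n choose 2) * qc ^ (n choose 2) * qc ^ n = qc ^ (n * n)"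
    proof -
      have "(n choose 2) + (n choose 2) + n = n * n"
        by (induction n) (auto simp: choose_two_Suc numeral_2_eq_2)
      thus ?thesis by (metis power_add)
    qed
    hence qq: "qc ^ (n choose 2) * qc ^ (n choose 2) * qc ^ n = (qc ^ n) ^ n" by (simp add: power_mult)
    have z0: "z \<noteq> 0" using z by simp
    have "(-1) ^ n * (- (a * qc * z / of_real (q ^ n * exp u))) ^ n * (of_real (exp u) / z) ^ n
        = (a * qc / qc ^ n) ^ n"
      unfolding power_mult_distrib[symmetric] using z0 q_pos by (intro arg_cong[of _ _ "\<lambda>x. x ^ n"]) (simp add: field_simps)
    also have "\<dots> = a ^ n * qc ^ n / (qc ^ n) ^ n"
      by (simp add: power_mult_distrib power_divide)
    finally have main: "(-1) ^ n * (- (a * qc * z / of_real (q ^ n * exp u))) ^ n * (of_real (exp u) / z) ^ n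
        = a ^ n * qc ^ n / (qc ^ n) ^ n" .
    have "f n (u + real n * L) = (qc ^ (n choose 2) * qc ^ (n choose 2)) / qpoch q qc n
        * ((-1) ^ n * (- (a * qc * z / of_real (q ^ n * exp u))) ^ n * (of_real (exp u) / z) ^ n)
        * (q_ratio b (q ^ n * exp u) * kappa q e (of_real u - w))"
      unfolding f_def e k euler_coeff_def by (simp only: mult_ac times_divide_eq_right times_divide_eq_left)
    also have "\<dots> = (qc ^ (n choose 2) * qc ^ (n choose 2) * qc ^ n) / (qc ^ n) ^ n * (a ^ n / qpoch q qc n)
        * (q_ratio b (q ^ n * exp u) * kappa q e (of_real u - w))"
      unfolding main by (simp only: mult_ac times_divide_eq_right times_divide_eq_left divide_divide_eq_left)
    also have "\<dots> = g n u"
      unfolding qq g_def using q_pos by (simp add: mult_ac)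
    finally show ?thesis ..
  qed
  have fg: "f n u = g n (- real n * L + 1 * u)" for n u
    by (simp add: gf)
  have summable_f: "summable (\<lambda>n. norm (f n u))" for u
    unfolding f_def norm_mult[of "euler_coeff _ * _"] by (intro summable_mult2 summable_norm_euler)
  have sum_f: "(\<Sum>n. f n u) = F u" for u
    using sums_mult2[OF euler_sums[of "- (a * qc * z / of_real (exp u))"], of "q_ratio b (exp u) * kappa q e (of_real u - w)"]
    by (simp add: f_def sums_iff F_def mult.assoc)
  note * = integral_series_affine[OF meas bound A h fg _ summable_f, unfolded sum_f, simplified]
  show "integrable lborel F" using *(1) by simp
  have summable_g: "summable (\<lambda>n. a ^ n / qpoch q qc n * q_ratio b (q ^ n * exp u))"
    if "kappa q e (of_real u - w) \<noteq> 0" for u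
  proof -
    have "summable (\<lambda>n. norm (g n u))"
      by (rule summable_comparison_test'[OF summable_mult2[OF A, of "h u"]]) (use bound in auto)
    from summable_mult2[OF summable_norm_cancel[OF this], of "1 / kappa q e (of_real u - w)"]
    show ?thesis using that by (simp add: g_def)
  qed
  have pt: "U_log e a b w u = qpoch_inf q a * (\<Sum>n. g n u)"
    if "u \<notin> {u :: real. qpoch_inf q (- b * of_real (exp u)) = 0}" for u
  proof -
    have k: "kappa q e (of_real u - w) \<noteq> 0" using dom by (intro kappa_nonzero) auto
    have "(\<Sum>n. g n u) = (\<Sum>n. a ^ n / qpoch q qc n * q_ratio b (q ^ n * exp u)) * kappa q e (of_real u - w)"
      unfolding g_def by (rule suminf_mult2[OF summable_g[OF k], symmetric])
    thus ?thesis
      using forward_identity[OF exp_gt_zero a, of b u] that by (simp add: U_log_def flip: mult.assoc)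
  qed
  have "integral\<^sup>L lborel (U_log e a b w) = (LBINT u. qpoch_inf q a * (\<Sum>n. g n u))"
    by (rule lborel_discrete_difference(2)[OF countable_qpoch_zeros[of "- b"] pt])
  also have "\<dots> = qpoch_inf q a * integral\<^sup>L lborel F"
    using * by (simp add: integral_mult_right)
  finally show "integral\<^sup>L lborel (U_log e a b w) = qpoch_inf q a * integral\<^sup>L lborel F" .
qed

text \<open>Multiplied by \<open>(-t/(az);q)\<^sub>\<infinity>\<close>, the product \<open>(-aqz/t;q)\<^sub>\<infinity> \<kappa>(t/z)\<close> becomes a function \<open>H\<close> with
  \<open>H(qt) = a H(t)\<close>. For small \<open>t\<close> it is bounded by a multiple of the integrand, so it would be integrable
  near 0. But for \<open>|a| \<ge> 1\<close> the integral of \<open>|H|\<close> over \<open>(0, \<delta>)\<close> is then at least the one over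
  \<open>(0, \<delta>/q)\<close>, so that \<open>H\<close> vanishes almost everywhere on \<open>(\<delta>, \<delta>/q)\<close>, although it has only countably
  many zeros.\<close>

lemma second_form_not_integrable:
  fixes a b z w :: complex
  assumes z: "z = exp w" and dom: "kernel_domain e w" and a: "1 \<le> norm a"
  defines "F \<equiv> \<lambda>u. qpoch_inf q (- (a * qc * z / of_real (exp u))) * q_ratio b (exp u) * kappa q e (of_real u - w)"
  shows "\<not> integrable lborel F"
proof
  assume int: "integrable lborel F"
  have z0: "z \<noteq> 0" using z by simp
  have a0: "a \<noteq> 0" using a by auto
  define P where "P u = qpoch_inf q (- 1 / (a * z) * of_real (exp u))" for u :: real
  define H where "H u = qpoch_inf q (- (a * qc * z) / of_real (exp u)) * P u * kappa q e (of_real u - w)" for u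
  have H_step: "H (u + L) = a * H u" for u
  proof -
    define t where "t = complex_of_real (exp u)"
    have t0: "t \<noteq> 0" by (simp add: t_def)
    have e: "complex_of_real (exp (u + L)) = qc * t"
      using q_pos by (simp add: t_def exp_add)
    have k: "kappa q e (of_real (u + L) - w) = (t / z) * kappa q e (of_real u - w)"
      using kappa_step[of e "of_real u - w"] by (simp add: z t_def exp_diff exp_of_real algebra_simps)
    have p1: "qpoch_inf q (- (a * qc * z) / (qc * t)) = (1 + a * z / t) * qpoch_inf q (- (a * qc * z) / t)"
      using qpoch_inf_step[of "- (a * z) / t"] q_pos by (simp add: mult_ac)
    have p2: "P u = (1 + t / (a * z)) * qpoch_inf q (- 1 / (a * z) * (qc * t))"
      using qpoch_inf_step[of "- 1 / (a * z) * t"] by (simp add: P_def t_def mult_ac)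
    have alg: "(1 + a * z / t) * (t / z) = a * (1 + t / (a * z))"
      using t0 z0 a0 by (simp add: field_simps)
    have "H (u + L) = ((1 + a * z / t) * (t / z)) * (qpoch_inf q (- (a * qc * z) / t)
        * qpoch_inf q (- 1 / (a * z) * (qc * t)) * kappa q e (of_real u - w))"
      unfolding H_def k P_def e p1 by (simp only: mult_ac)
    also have "\<dots> = a * H u"
      unfolding alg H_def p2 t_def[symmetric] by (simp only: mult_ac)
    finally show ?thesis .
  qed
  have H_nz: "H u \<noteq> 0"
    if "u \<notin> {u :: real. qpoch_inf q (- (a * qc * z) / of_real (exp u)) = 0}
           \<union> {u :: real. qpoch_inf q (- 1 / (a * z) * of_real (exp u)) = 0}" for u
    using that kappa_nonzero[of e "of_real u - w"] dom by (simp add: H_def P_def)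
  \<comment> \<open>keeps \<open>|b t| < 1\<close>, hence \<open>(-bt;q)\<^sub>\<infinity> \<noteq> 0\<close>, for \<open>0 \<le> t \<le> \<delta>\<close>\<close>
  define \<delta> where "\<delta> = 1 / (norm b + 1)"
  have \<delta>: "\<delta> > 0" "norm b * \<delta> < 1"
    using add_nonneg_pos[OF norm_ge_zero[of b] zero_less_one] by (auto simp: \<delta>_def)
  \<comment> \<open>the quotient of \<open>H\<close> by the integrand, continuous up to \<open>t = 0\<close>\<close>
  define \<psi> where "\<psi> t = qpoch_inf q (- 1 / (a * z) * of_real t) * qpoch_inf q (- of_real t)
      / qpoch_inf q (- (b * of_real t))" for t :: real
  have den: "qpoch_inf q (- (b * of_real t)) \<noteq> 0" if "0 \<le> t" "t \<le> \<delta>" for t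
  proof (rule qpoch_inf_nonzero_if_norm_less_1)
    have "norm (- (b * of_real t)) = norm b * t" using that by (simp add: norm_mult)
    also have "\<dots> \<le> norm b * \<delta>" using that by (intro mult_left_mono) auto
    finally show "norm (- (b * of_real t)) < 1" using \<delta> by simp
  qed
  have "continuous_on {0..\<delta>} \<psi>"
    unfolding \<psi>_def using den by (intro continuous_intros) auto
  hence "bounded (\<psi> ` {0..\<delta>})"
    by (intro compact_imp_bounded compact_continuous_image) auto
  then obtain B where B: "B > 0" "\<And>t. t \<in> {0..\<delta>} \<Longrightarrow> norm (\<psi> t) \<le> B"
    by (auto simp: bounded_pos)
  define u0 where "u0 = ln \<delta>"
  have HF: "norm (H u) \<le> B * norm (F u)" if "u \<le> u0" for u
  proof -
    have t: "exp u \<in> {0..\<delta>}" using that \<delta> by (simp add: u0_def ln_ge_iff)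
    have "H u = \<psi> (exp u) * F u"
      using den[of "exp u"] t qpoch_inf_minus_pos_nonzero[of "exp u"]
      by (simp add: H_def F_def P_def \<psi>_def q_ratio_def)
    thus ?thesis using B(2)[OF t] by (simp add: norm_mult mult_right_mono)
  qed
  have contH: "continuous_on UNIV H"
    unfolding H_def P_def using dom by (intro continuous_intros kappa_continuous) auto
  note [measurable] = borel_measurable_continuous_onI[OF contH]
  have intH: "integrable lborel (\<lambda>u. indicator {..u0} u * norm (H u))"
  proof (rule Bochner_Integration.integrable_bound[OF integrable_mult_right[OF integrable_norm[OF int], of B]])
    show "AE u in lborel. norm (indicator {..u0} u * norm (H u)) \<le> norm (B * norm (F u))"
      using HF B(1) by (intro AE_I2) (auto simp: indicator_def)
  qed measurable
  have shift: "indicator {..u0} (L + 1 * u) * norm (H (L + 1 * u))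
      = norm a * (indicator {..u0 - L} u * norm (H u))" for u
    using H_step[of u] by (auto simp: indicator_def norm_mult add.commute)
  have intH': "integrable lborel (\<lambda>u. norm a * (indicator {..u0 - L} u * norm (H u)))"
    using lborel_integrable_real_affine[OF intH, of 1 L] unfolding shift by simp
  have eq: "(LBINT u. norm a * (indicator {..u0 - L} u * norm (H u))) = (LBINT u. indicator {..u0} u * norm (H u))"
    using lborel_integral_real_affine[of 1 "\<lambda>u. indicator {..u0} u * norm (H u)" L] unfolding shift by simp
  define d where "d u = norm a * (indicator {..u0 - L} u * norm (H u)) - indicator {..u0} u * norm (H u)" for u
  have "integral\<^sup>L lborel d = 0"
    unfolding d_def using intH intH' eq by simp
  moreover have d_nonneg: "0 \<le> d u" for u
    using mult_right_mono[OF a, of "norm (H u)"] L_neg by (auto simp: d_def indicator_def)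
  moreover have "integrable lborel d" unfolding d_def using intH intH' by simp
  ultimately have AE0: "AE u in lborel. d u = 0"
    using integral_nonneg_eq_0_iff_AE[of lborel d] by simp
  have AEnz: "AE u in lborel. H u \<noteq> 0"
  proof -
    have "AE u in lborel. u \<notin> {u :: real. qpoch_inf q (- (a * qc * z) / of_real (exp u)) = 0}
           \<union> {u :: real. qpoch_inf q (- 1 / (a * z) * of_real (exp u)) = 0}"
      by (intro AE_not_in countable_imp_null_set_lborel countable_Un
            countable_qpoch_zeros countable_qpoch_zeros_inverse)
    thus ?thesis by eventually_elim (rule H_nz)
  qed
  have "AE u in lborel. u \<notin> {u0<..<u0 - L}"
    using AE0 AEnz
  proof eventually_elim
    case (elim u)
    show ?case
    proof
      assume "u \<in> {u0<..<u0 - L}"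
      hence "d u = norm a * norm (H u)" by (auto simp: d_def indicator_def)
      with elim a0 show False by simp
    qed
  qed
  hence "emeasure lborel {u0<..<u0 - L} = 0"
    using AE_iff_measurable[of "{u0<..<u0 - L}" lborel "\<lambda>u. u \<notin> {u0<..<u0 - L}"]
    by (auto simp: set_eq_iff)
  moreover have "emeasure lborel {u0<..<u0 - L} = ennreal (- L)"
    using L_neg by (subst emeasure_lborel_Ioo) auto
  ultimately show False using L_neg by (simp add: ennreal_eq_0_iff)
qed

section \<open>The Stieltjes-type representation\<close>

lemma minus_pos_in_slit_plane: "t > 0 \<Longrightarrow> - complex_of_real t \<in> slit_plane"
  by (auto simp: complex_eq_iff)

text \<open>With \<open>r = |exp l|\<close> and \<open>\<theta> = Im l\<close>, the square of the norm exceeds \<open>cos^2(\<theta>/2) (1 + r)^2\<close> by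
  \<open>sin^2(\<theta>/2) (1 - r)^2\<close>.\<close>

lemma norm_one_plus_exp_ge:
  assumes "\<bar>Im l\<bar> \<le> \<eta>" "\<eta> < pi"
  shows "cos (\<eta> / 2) \<le> norm (1 + exp l)"
proof -
  define r where "r = exp (Re l)"
  have r: "r > 0" by (simp add: r_def)
  have "cos (Im l / 2) = cos (\<bar>Im l\<bar> / 2)"
    by (simp add: abs_if)
  moreover have "cos (\<eta> / 2) \<le> cos (\<bar>Im l\<bar> / 2)"
    using assms by (intro cos_monotone_0_pi_le) auto
  ultimately have c: "cos (\<eta> / 2) \<le> cos (Im l / 2)" by simp
  have c0: "0 \<le> cos (\<eta> / 2)" using assms by (intro cos_ge_zero) auto
  have "(cos (\<eta> / 2))\<^sup>2 \<le> (cos (Im l / 2))\<^sup>2" using c c0 by (intro power_mono) auto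
  also have "\<dots> = (1 + cos (Im l)) / 2"
    using cos_double_cos[of "Im l / 2"] by simp
  also have "\<dots> \<le> (1 + cos (Im l)) / 2 * (1 + r)\<^sup>2"
    using mult_left_mono[OF one_le_power[of "1 + r" 2], of "(1 + cos (Im l)) / 2"]
      r cos_ge_minus_one[of "Im l"] by simp
  also have "\<dots> \<le> (1 + cos (Im l)) / 2 * (1 + r)\<^sup>2 + (1 - cos (Im l)) / 2 * (1 - r)\<^sup>2"
    using cos_le_one[of "Im l"] by simp
  also have "\<dots> = 1 + 2 * r * cos (Im l) + r\<^sup>2"
    by (simp add: power2_eq_square field_simps)
  also have "\<dots> = (norm (1 + exp l))\<^sup>2"
  proof -
    have "(1 + r * cos (Im l))\<^sup>2 + (r * sin (Im l))\<^sup>2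
        = 1 + 2 * r * cos (Im l) + r\<^sup>2 * ((cos (Im l))\<^sup>2 + (sin (Im l))\<^sup>2)"
      by algebra
    thus ?thesis
      unfolding cmod_power2 by (simp add: Re_exp Im_exp r_def)
  qed
  finally show ?thesis by (rule power2_le_imp_le) simp
qed

lemma gaussian_tendsto_0:
  shows "((\<lambda>x. M * exp ((x - d)\<^sup>2 / (2 * L))) \<longlongrightarrow> 0) at_top"
    and "((\<lambda>x. M * exp ((x - d)\<^sup>2 / (2 * L))) \<longlongrightarrow> 0) at_bot"
proof -
  have *: "((\<lambda>x. M * exp ((x - d)\<^sup>2 / (2 * L))) \<longlongrightarrow> 0) F"
    if "filterlim (\<lambda>x. (x - d)\<^sup>2) at_top F" for F
  proof -
    have "filterlim (\<lambda>x. (1 / (2 * L)) * (x - d)\<^sup>2) at_bot F"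
      using L_neg that
      by (intro filterlim_tendsto_neg_mult_at_bot[OF tendsto_const]) (auto simp: divide_less_0_iff)
    hence "filterlim (\<lambda>x. (x - d)\<^sup>2 / (2 * L)) at_bot F" by simp
    from tendsto_mult_right_zero[OF filterlim_compose[OF exp_at_bot this], of M] show ?thesis .
  qed
  have top: "filterlim (\<lambda>x. (x - d)\<^sup>2) at_top at_top" for d :: real
    by (intro filterlim_pow_at_top filterlim_tendsto_add_at_top[OF tendsto_const filterlim_ident, of "- d", simplified]) auto
  show "((\<lambda>x. M * exp ((x - d)\<^sup>2 / (2 * L))) \<longlongrightarrow> 0) at_top" by (rule *[OF top])
  have eq: "(- x - d)\<^sup>2 = (x - (- d))\<^sup>2" for x :: real
    by (simp add: power2_eq_square algebra_simps)
  have "filterlim (\<lambda>x. (x - d)\<^sup>2) at_top at_bot"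
    unfolding at_bot_mirror filterlim_filtermap eq by (rule top)
  thus "((\<lambda>x. M * exp ((x - d)\<^sup>2 / (2 * L))) \<longlongrightarrow> 0) at_bot" by (rule *)
qed

text \<open>In terms of \<open>t = exp u\<close>, the ray of integration is rotated by \<open>arg z\<close>. In logarithmic coordinates
  this is a translation by \<open>Re w\<close> followed by a vertical shift of the line by \<open>Im w\<close>, during which
  neither a zero of the denominator nor a pole of the kernel is met.\<close>

lemma stieltjes_kernel_rotation:
  fixes s :: real
  assumes w: "\<bar>Im w\<bar> < pi"
  shows "(LBINT u. kappa q e (of_real u - w) / (1 + exp (of_real (u + s))))
       = (LBINT u. kappa q e (of_real u) / (1 + exp (of_real (u + s) + w)))"
proof -
  define \<eta> where "\<eta> = - Im w"
  define g where "g v = kappa q e v / (1 + exp (v + w + of_real s))" for v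
  define S where "S = {v :: complex. \<bar>Im v\<bar> < pi \<and> \<bar>Im (v + w)\<bar> < pi}"
  have S_eq: "S = {v. Im v < pi} \<inter> {v. Im v > - pi} \<inter> {v. Im v < pi + \<eta>} \<inter> {v. Im v > \<eta> - pi}"
    by (auto simp: S_def \<eta>_def abs_less_iff)
  have S: "open S" "convex S"
    unfolding S_eq
    by (intro open_Int open_halfspace_Im_lt open_halfspace_Im_gt)
       (intro convex_Int convex_halfspace_Im_lt convex_halfspace_Im_gt)
  have eta: "\<bar>\<eta>\<bar> < pi" using w by (simp add: \<eta>_def)
  have in_strip: "\<bar>s' * \<eta>\<bar> \<le> \<bar>\<eta>\<bar>" "\<bar>s' * \<eta> + Im w\<bar> \<le> \<bar>\<eta>\<bar>" if "s' \<in> {0..1}" for s'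
  proof -
    show "\<bar>s' * \<eta>\<bar> \<le> \<bar>\<eta>\<bar>" using that by (auto simp: abs_mult mult_left_le_one_le)
    have "s' * \<eta> + Im w = (s' - 1) * \<eta>" by (simp add: \<eta>_def algebra_simps)
    thus "\<bar>s' * \<eta> + Im w\<bar> \<le> \<bar>\<eta>\<bar>" using that by (auto simp: abs_mult mult_left_le_one_le)
  qed
  define c where "c = cos (\<bar>\<eta>\<bar> / 2)"
  have c: "c > 0" unfolding c_def using eta pi_gt_zero by (intro cos_gt_zero_pi) auto
  have den: "norm (1 + exp (v + w + of_real s)) \<ge> c" if "\<bar>Im (v + w)\<bar> \<le> \<bar>\<eta>\<bar>" for v
    unfolding c_def using that eta by (intro norm_one_plus_exp_ge) auto
  obtain M where M: "M > 0" "\<And>l. \<bar>Im l\<bar> \<le> \<bar>\<eta>\<bar> \<Longrightarrow> norm (kappa q e l) \<le> M * exp ((Re l - L / 2)\<^sup>2 / (2 * L))"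
    using kappa_gaussian_bound[of "\<bar>\<eta>\<bar>" e] eta by auto
  have hol: "g holomorphic_on S"
    unfolding g_def
  proof (intro holomorphic_intros kappa_holomorphic)
    fix v assume "v \<in> S"
    hence "\<bar>Im (v + w + of_real s)\<bar> < pi" by (simp add: S_def)
    from exp_not_neg_real[OF this, of 1] show "1 + exp (v + w + of_real s) \<noteq> 0"
      by (metis add.inverse_unique of_real_1 zero_less_one)
  qed (auto simp: S_def)
  define h where "h x = M / c * exp ((x - L / 2)\<^sup>2 / (2 * L))" for x
  have "(LBINT x. g (Complex x 0)) = (LBINT x. g (Complex x \<eta>))"
  proof (rule contour_shift_horizontal[OF hol S])
    fix x s' :: real assume s': "s' \<in> {0..1}"
    show "Complex x (s' * \<eta>) \<in> S" using in_strip[OF s'] eta by (simp add: S_def)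
    have "norm (g (Complex x (s' * \<eta>))) \<le> (M * exp ((x - L / 2)\<^sup>2 / (2 * L))) / c"
      unfolding g_def norm_divide
      using M(2)[of "Complex x (s' * \<eta>)"] den[of "Complex x (s' * \<eta>)"] in_strip[OF s'] c M(1)
      by (intro frac_le) auto
    thus "norm (g (Complex x (s' * \<eta>))) \<le> h x" by (simp add: h_def)
  next
    show "integrable lborel h"
      unfolding h_def using integrable_gaussian_exp[of "L / 2" 0] by simp
    show "(h \<longlongrightarrow> 0) at_top" "(h \<longlongrightarrow> 0) at_bot"
      unfolding h_def by (rule gaussian_tendsto_0)+
  qed
  also have "(LBINT x. g (Complex x 0)) = (LBINT u. kappa q e (of_real u) / (1 + exp (of_real (u + s) + w)))"
    by (simp add: g_def Complex_eq add_ac)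
  also have "(LBINT x. g (Complex x \<eta>)) = (LBINT u. kappa q e (of_real u - w) / (1 + exp (of_real (u + s))))"
  proof -
    have "(LBINT u. kappa q e (of_real u - w) / (1 + exp (of_real (u + s))))
        = (LBINT x. kappa q e (of_real (Re w + 1 * x) - w) / (1 + exp (of_real (Re w + 1 * x + s))))"
      by (subst lborel_integral_real_affine[of 1 _ "Re w"]) auto
    also have "\<dots> = (LBINT x. g (Complex x \<eta>))"
    proof (rule Bochner_Integration.integral_cong)
      fix x :: real
      have "of_real (Re w + 1 * x) - w = Complex x \<eta>" "of_real (Re w + 1 * x + s) = Complex x \<eta> + w + of_real s"
        by (auto simp: complex_eq_iff \<eta>_def)
      thus "kappa q e (of_real (Re w + 1 * x) - w) / (1 + exp (of_real (Re w + 1 * x + s))) = g (Complex x \<eta>)"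
        by (simp only: g_def)
    qed simp
    finally show ?thesis ..
  qed
  finally show ?thesis ..
qed

text \<open>The Taylor coefficients of \<open>(qy;q)\<^sub>\<infinity>/((ay;q)\<^sub>\<infinity> (by;q)\<^sub>\<infinity>)\<close> at 0, as the convolution of two
  \<open>q\<close>-binomial series. Up to a constant, they are the numerators in the partial fraction expansion of
  the \<open>2\<phi>1\<close>.\<close>

definition res_coeff :: "complex \<Rightarrow> complex \<Rightarrow> nat \<Rightarrow> complex" where
  "res_coeff a b j = (\<Sum>i\<le>j. (qpoch q (qc / a) i / qpoch q qc i * a ^ i) * (b ^ (j - i) / qpoch q qc (j - i)))"

lemma res_coeff_generating_function:
  assumes a: "a \<noteq> 0" "norm a < 1" and b: "norm b < 1"
  shows summable_res_coeff: "summable (\<lambda>j. norm (res_coeff a b j))"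
    and res_coeff_sums: "norm y \<le> 1 \<Longrightarrow> (\<lambda>j. res_coeff a b j * y ^ j)
           sums (qpoch_inf q (qc * y) / (qpoch_inf q (a * y) * qpoch_inf q (b * y)))"
proof -
  define A where "A y i = qpoch q (qc / a) i / qpoch q qc i * (a * y) ^ i" for y i
  define B where "B y i = qpoch q 0 i / qpoch q qc i * (b * y) ^ i" for y i
  have le: "norm (d * y) < 1" if "norm d < 1" "norm y \<le> 1" for d y :: complex
    using mult_left_mono[OF that(2) norm_ge_zero[of d]] that(1) unfolding norm_mult by linarith
  have ab: "norm (a * y) < 1" "norm (b * y) < 1" if "norm y \<le> 1" for y
    using le a b that by auto
  have sA: "summable (\<lambda>i. norm (A y i))" and sB: "summable (\<lambda>i. norm (B y i))" if "norm y \<le> 1" for y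
    unfolding A_def B_def using ab[OF that] by (intro summable_qbinomial; simp)+
  have conv: "(\<Sum>i\<le>j. A y i * B y (j - i)) = res_coeff a b j * y ^ j" for y j
    unfolding res_coeff_def sum_distrib_right
  proof (rule sum.cong)
    fix i assume "i \<in> {..j}"
    hence "y ^ j = y ^ i * y ^ (j - i)" by (simp flip: power_add)
    thus "A y i * B y (j - i) = (qpoch q (qc / a) i / qpoch q qc i * a ^ i) * (b ^ (j - i) / qpoch q qc (j - i)) * y ^ j"
      by (simp add: A_def B_def power_mult_distrib)
  qed simp
  show "summable (\<lambda>j. norm (res_coeff a b j))"
  proof (rule summable_comparison_test')
    show "summable (\<lambda>j. \<Sum>i\<le>j. norm (A 1 i) * norm (B 1 (j - i)))"
      using summable_Cauchy_product[of "\<lambda>i. norm (A 1 i)" "\<lambda>i. norm (B 1 i)"] sA[of 1] sB[of 1] by simp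
    fix j
    have "norm (res_coeff a b j) = norm (\<Sum>i\<le>j. A 1 i * B 1 (j - i))"
      unfolding conv by simp
    also have "\<dots> \<le> (\<Sum>i\<le>j. norm (A 1 i) * norm (B 1 (j - i)))"
      by (rule order_trans[OF norm_sum]) (simp add: norm_mult)
    finally show "norm (norm (res_coeff a b j)) \<le> (\<Sum>i\<le>j. norm (A 1 i) * norm (B 1 (j - i)))" by simp
  qed
  show "(\<lambda>j. res_coeff a b j * y ^ j) sums (qpoch_inf q (qc * y) / (qpoch_inf q (a * y) * qpoch_inf q (b * y)))"
    if y: "norm y \<le> 1"
  proof -
    have "(\<lambda>j. \<Sum>i\<le>j. A y i * B y (j - i)) sums ((\<Sum>i. A y i) * (\<Sum>i. B y i))"
      by (rule Cauchy_product_sums[OF sA[OF y] sB[OF y]])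
    moreover have "(\<Sum>i. A y i) = qpoch_inf q (qc * y) / qpoch_inf q (a * y)"
      using sums_unique[OF qbinomial_sums[OF ab(1)[OF y], of "qc / a"]] a by (simp add: A_def)
    moreover have "(\<Sum>i. B y i) = 1 / qpoch_inf q (b * y)"
      using sums_unique[OF qbinomial_sums[OF ab(2)[OF y], of 0]] by (simp add: B_def)
    ultimately show ?thesis unfolding conv by simp
  qed
qed

text \<open>The Taylor series at \<open>y = q^k\<close> interpolates the coefficients of the \<open>2\<phi>1\<close>.\<close>

lemma res_coeff_at_qpow:
  assumes a: "a \<noteq> 0" "norm a < 1" and b: "norm b < 1"
  shows "(\<lambda>j. qpoch_inf q a * qpoch_inf q b / qpoch_inf q qc * (res_coeff a b j * (qc ^ k) ^ j))
     sums (qpoch q a k * qpoch q b k / qpoch q qc k)"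
proof -
  have nz: "qpoch_inf q a \<noteq> 0" "qpoch_inf q b \<noteq> 0" "qpoch_inf q qc \<noteq> 0"
    using a b q_pos q_less_1 by (auto intro!: qpoch_inf_nonzero_if_norm_less_1)
  have "norm (qc ^ k) \<le> 1" using qpow_le_1 by simp
  from sums_mult[OF res_coeff_sums[OF a b this], of "qpoch_inf q a * qpoch_inf q b / qpoch_inf q qc"]
  have "(\<lambda>j. qpoch_inf q a * qpoch_inf q b / qpoch_inf q qc * (res_coeff a b j * (qc ^ k) ^ j))
     sums (qpoch_inf q a * qpoch_inf q b / qpoch_inf q qc *
       (qpoch_inf q (qc * qc ^ k) / (qpoch_inf q (a * qc ^ k) * qpoch_inf q (b * qc ^ k))))" .
  also have "qpoch_inf q a * qpoch_inf q b / qpoch_inf q qc *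
       (qpoch_inf q (qc * qc ^ k) / (qpoch_inf q (a * qc ^ k) * qpoch_inf q (b * qc ^ k)))
     = qpoch q a k * qpoch q b k / qpoch q qc k"
    using nz qpoch_inf_split[of a k] qpoch_inf_split[of b k] qpoch_inf_split[of qc k] by simp
  finally show ?thesis .
qed

text \<open>A lower bound that is uniform in \<open>s = q^j\<close>; it holds by compactness since \<open>1 = s x\<close> with \<open>0 \<le> s \<le> 1\<close>
  puts \<open>x\<close> on the cut.\<close>

lemma slit_plane_denominator_bound:
  assumes "x0 \<in> slit_plane"
  obtains d c where "d > 0" "c > 0" "cball x0 d \<subseteq> slit_plane"
    "\<And>x s. x \<in> cball x0 d \<Longrightarrow> s \<in> {0..1} \<Longrightarrow> c \<le> norm (1 - complex_of_real s * x)"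
proof -
  obtain d where d: "d > 0" "cball x0 d \<subseteq> slit_plane"
    using open_slit_plane assms open_contains_cball by blast
  let ?K = "{0..1 :: real} \<times> cball x0 d"
  have cont: "continuous_on ?K (\<lambda>p. norm (1 - complex_of_real (fst p) * snd p))"
    by (intro continuous_intros)
  have "compact ?K" by (intro compact_Times) auto
  moreover have "?K \<noteq> {}" using d by auto
  ultimately obtain p where p: "p \<in> ?K"
    "\<And>p'. p' \<in> ?K \<Longrightarrow> norm (1 - complex_of_real (fst p) * snd p) \<le> norm (1 - complex_of_real (fst p') * snd p')"
    using continuous_attains_inf[OF _ _ cont] by blast
  have "1 - complex_of_real (fst p) * snd p \<noteq> 0"
  proof
    assume "1 - complex_of_real (fst p) * snd p = 0"
    hence eq: "complex_of_real (fst p) * snd p = 1" by simp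
    have s: "0 \<le> fst p" "fst p \<le> 1" using p(1) by auto
    have "fst p \<noteq> 0" using eq by auto
    hence "snd p = complex_of_real (1 / fst p)" using eq by (simp add: field_simps)
    moreover have "1 / fst p \<ge> 1" using s \<open>fst p \<noteq> 0\<close> by simp
    ultimately have "snd p \<notin> slit_plane" by (metis ComplD atLeast_iff image_eqI)
    thus False using p(1) d(2) by auto
  qed
  thus thesis using that[of d "norm (1 - complex_of_real (fst p) * snd p)"] d p(2) by force
qed

text \<open>In the disc, insert \<open>res_coeff_at_qpow\<close> into the series and sum over \<open>k\<close> first, which gives geometric
  series. The partial fraction series converges locally uniformly off the cut, hence is the
  continuation.\<close>

theorem qhyp_21_partial_fractions:
  assumes a: "a \<noteq> 0" "norm a < 1" and b: "norm b < 1" and x: "x \<in> slit_plane"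
  shows "qhyp [a, b] [0] q x
    = (\<Sum>j. qpoch_inf q a * qpoch_inf q b / qpoch_inf q qc * res_coeff a b j / (1 - qc ^ j * x))"
proof -
  define K0 where "K0 = qpoch_inf q a * qpoch_inf q b / qpoch_inf q qc"
  define r where "r j = K0 * res_coeff a b j" for j
  have sr: "summable (\<lambda>j. norm (r j))"
    unfolding r_def norm_mult by (intro summable_mult summable_res_coeff a b)
  have "qhyp [a, b] [0] q x = (\<Sum>j. r j / (1 - qc ^ j * x))"
  proof (rule qhyp_21_eq_continuation[OF _ _ x])
    show "(\<lambda>x. \<Sum>j. r j / (1 - qc ^ j * x)) holomorphic_on slit_plane"
    proof (rule holomorphic_uniform_sequence[OF open_slit_plane])
      fix n
      show "(\<lambda>x. \<Sum>j<n. r j / (1 - qc ^ j * x)) holomorphic_on slit_plane"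
      proof (intro holomorphic_intros)
        fix j x assume "x \<in> slit_plane"
        then obtain d c where "d > 0" "c > 0"
          "\<And>x' s. x' \<in> cball x d \<Longrightarrow> s \<in> {0..1} \<Longrightarrow> c \<le> norm (1 - complex_of_real s * x')"
          using slit_plane_denominator_bound by metis
        from this(1,2) this(3)[of x "q ^ j"] show "1 - qc ^ j * x \<noteq> 0"
          using qpow_pos[of j] qpow_le_1[of j] by auto
      qed
    next
      fix x0 assume "x0 \<in> slit_plane"
      then obtain d c where dc: "d > 0" "c > 0" "cball x0 d \<subseteq> slit_plane"
          "\<And>x s. x \<in> cball x0 d \<Longrightarrow> s \<in> {0..1} \<Longrightarrow> c \<le> norm (1 - complex_of_real s * x)"
        using slit_plane_denominator_bound by metis
      have "uniform_limit (cball x0 d) (\<lambda>n x. \<Sum>j<n. r j / (1 - qc ^ j * x)) (\<lambda>x. \<Sum>j. r j / (1 - qc ^ j * x)) sequentially"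
      proof (rule Weierstrass_m_test)
        show "summable (\<lambda>j. norm (r j) / c)" using sr by (rule summable_divide)
        fix j x assume "x \<in> cball x0 d"
        from dc(4)[OF this, of "q ^ j"] have "c \<le> norm (1 - qc ^ j * x)"
          using qpow_pos[of j] qpow_le_1[of j] by simp
        thus "norm (r j / (1 - qc ^ j * x)) \<le> norm (r j) / c"
          using dc(2) by (simp add: norm_divide frac_le)
      qed
      thus "\<exists>d>0. cball x0 d \<subseteq> slit_plane \<and> uniform_limit (cball x0 d)
          (\<lambda>n x. \<Sum>j<n. r j / (1 - qc ^ j * x)) (\<lambda>x. \<Sum>j. r j / (1 - qc ^ j * x)) sequentially"
        using dc by blast
    qed
  next
    fix x :: complex assume x: "norm x < 1"
    define F where "F j k = r j * ((qc ^ k) ^ j * x ^ k)" for j k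
    obtain S where S1: "(\<lambda>j. \<Sum>k. F j k) sums S" and S2: "(\<lambda>k. \<Sum>j. F j k) sums S"
    proof (rule double_series_rearrange)
      fix j k
      have "norm ((qc ^ k) ^ j) \<le> 1"
        unfolding norm_power[of "qc ^ k"] norm_qc_power using qpow_le_1[of "k * j"] by (simp add: power_mult)
      from mult_right_mono[OF this, of "norm x ^ k"]
      show "norm (F j k) \<le> norm (r j) * norm x ^ k"
        by (simp add: F_def norm_mult mult_left_mono norm_power)
    qed (use sr x in \<open>auto intro!: summable_geometric\<close>)
    have rows: "(\<Sum>k. F j k) = r j / (1 - qc ^ j * x)" for j
    proof -
      have "norm (qc ^ j * x) < 1"
        using mult_right_mono[OF qpow_le_1[of j] norm_ge_zero[of x]] x
        unfolding norm_mult norm_qc_power by linarith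
      from sums_mult[OF geometric_sums[OF this], of "r j"]
      have "(\<lambda>k. r j * (qc ^ j * x) ^ k) sums (r j / (1 - qc ^ j * x))" by simp
      moreover have "r j * (qc ^ j * x) ^ k = F j k" for k
        by (simp add: F_def power_mult_distrib flip: power_mult) (simp add: mult.commute)
      ultimately show ?thesis by (simp add: sums_iff)
    qed
    have cols: "(\<Sum>j. F j k) = qpoch q a k * qpoch q b k / qpoch q qc k * x ^ k" for k
      using sums_unique[OF sums_mult2[OF res_coeff_at_qpow[OF a b, of k], of "x ^ k"]]
      by (simp add: F_def r_def K0_def mult_ac)
    show "(\<lambda>k. qpoch q a k * qpoch q b k / qpoch q qc k * x ^ k) sums (\<Sum>j. r j / (1 - qc ^ j * x))"
      using S2 unfolding cols sums_unique[OF S1[unfolded rows]] .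
  qed
  thus ?thesis by (simp add: r_def K0_def)
qed

text \<open>The weights \<open>q^(j choose 2)\<close> that the kernel contributes turn the product of two \<open>q\<close>-binomial series
  into a \<open>1\<phi>1\<close>: as \<open>(n + m choose 2) = (n choose 2) + (m choose 2) + n m\<close>, the sum over \<open>m\<close> is
  Euler's expansion at \<open>-bqt q^n\<close>.\<close>

lemma res_coeff_theta_sum:
  assumes a: "a \<noteq> 0" "norm a < 1" and b: "norm b < 1" and t: "t > 0"
  shows "(\<lambda>j. res_coeff a b j * (qc ^ (j choose 2) * (qc * of_real t) ^ j))
     sums (\<Sum>n. jackson_term (qc / a) (- (b * qc * of_real t)) (- (a * qc * of_real t)) n)"
    and "summable (\<lambda>j. norm (res_coeff a b j * (qc ^ (j choose 2) * (qc * of_real t) ^ j)))"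
proof -
  define A where "A n = qpoch q (qc / a) n / qpoch q qc n * a ^ n" for n
  define B where "B m = b ^ m / qpoch q qc m" for m
  define \<theta> where "\<theta> N = qc ^ (N choose 2) * (qc * of_real t) ^ N" for N
  have "summable (\<lambda>N. q ^ (N choose 2) * (q * t) ^ N)"
    using t q_pos by (intro summable_q_gauss) auto
  hence "Bseq (\<lambda>N. q ^ (N choose 2) * (q * t) ^ N)"
    by (intro convergent_imp_Bseq) (auto simp: convergent_def dest: summable_LIMSEQ_zero)
  then obtain M where M: "M > 0" "\<And>N. norm (q ^ (N choose 2) * (q * t) ^ N) \<le> M"
    by (auto simp: Bseq_def)
  have M': "norm (\<theta> N) \<le> M" for N
  proof -
    have "\<theta> N = complex_of_real (q ^ (N choose 2) * (q * t) ^ N)" by (simp add: \<theta>_def)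
    thus ?thesis using M(2)[of N] by (metis norm_of_real real_norm_def)
  qed
  have sA: "summable (\<lambda>n. norm (A n))"
    unfolding A_def by (rule summable_qbinomial[OF a(2)])
  have sB: "summable (\<lambda>n. norm (B n))"
    using summable_qbinomial[OF b, of 0] by (simp add: B_def)
  define F where "F n m = A n * B m * \<theta> (n + m)" for n m
  obtain S where S1: "(\<lambda>k. \<Sum>n\<le>k. F n (k - n)) sums S" and S2: "(\<lambda>n. \<Sum>m. F n m) sums S"
  proof (rule double_series_rearrange)
    show "norm (F n m) \<le> norm (A n) * (M * norm (B m))" for n m
      using mult_left_mono[OF M'[of "n + m"], of "norm (A n) * norm (B m)"]
      by (simp add: F_def norm_mult mult_ac)
  qed (use sA sB M in \<open>auto intro: summable_mult\<close>)
  have diag: "(\<Sum>n\<le>k. F n (k - n)) = res_coeff a b k * \<theta> k" for k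
    unfolding res_coeff_def sum_distrib_right by (intro sum.cong) (auto simp: F_def A_def B_def)
  have row: "(\<Sum>m. F n m) = jackson_term (qc / a) (- (b * qc * of_real t)) (- (a * qc * of_real t)) n" for n
  proof -
    have choose: "(n + m choose 2) = (n choose 2) + (m choose 2) + n * m" for m
      by (induction m) (auto simp: choose_two_Suc numeral_2_eq_2)
    have th: "\<theta> (n + m) = \<theta> n * (qc ^ (m choose 2) * (qc * of_real t * qc ^ n) ^ m)" for m
      unfolding \<theta>_def choose by (simp add: power_add power_mult_distrib power_mult)
    have sign: "(-1) ^ m * ((-1) ^ m * x) = x" for x :: complex and m
      by (simp flip: power_mult_distrib mult.assoc)
    have "F n m = (A n * \<theta> n) * (euler_coeff m * (- (b * qc * of_real t) * qc ^ n) ^ m)" for m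
    proof -
      have "(- (b * qc * of_real t) * qc ^ n) ^ m = (-1) ^ m * (b ^ m * (qc * of_real t * qc ^ n) ^ m)"
        unfolding power_mult_distrib[symmetric] by (simp add: mult_ac)
      thus ?thesis
        unfolding F_def th B_def euler_coeff_def using sign[of m] by (simp add: mult_ac)
    qed
    hence "(\<Sum>m. F n m) = (A n * \<theta> n) * qpoch_inf q (- (b * qc * of_real t) * qc ^ n)"
      using sums_unique[OF sums_mult[OF euler_sums[of "- (b * qc * of_real t) * qc ^ n"], of "A n * \<theta> n"]]
      by simp
    moreover have "A n * \<theta> n = qpoch q (qc / a) n * euler_coeff n * (- (a * qc * of_real t)) ^ n"
    proof -
      have "(- (a * qc * of_real t)) ^ n = (-1) ^ n * (a ^ n * (qc * of_real t) ^ n)"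
        unfolding power_mult_distrib[symmetric] by (simp add: mult_ac)
      thus ?thesis unfolding A_def \<theta>_def euler_coeff_def using sign[of n] by (simp add: mult_ac)
    qed
    ultimately show ?thesis by (simp add: jackson_term_def)
  qed
  show "(\<lambda>j. res_coeff a b j * (qc ^ (j choose 2) * (qc * of_real t) ^ j))
     sums (\<Sum>n. jackson_term (qc / a) (- (b * qc * of_real t)) (- (a * qc * of_real t)) n)"
    using S1 S2 unfolding diag row \<theta>_def by (simp add: sums_iff)
  show "summable (\<lambda>j. norm (res_coeff a b j * (qc ^ (j choose 2) * (qc * of_real t) ^ j)))"
  proof (rule summable_comparison_test'[OF summable_mult2[OF summable_res_coeff[OF a b], of M]])
    show "norm (norm (res_coeff a b j * (qc ^ (j choose 2) * (qc * of_real t) ^ j))) \<le> norm (res_coeff a b j) * M" for j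
      using mult_left_mono[OF M'[of j] norm_ge_zero[of "res_coeff a b j"]]
      unfolding \<theta>_def norm_mult[of "res_coeff a b j"] by (simp only: real_norm_def abs_mult abs_norm_cancel)
  qed
qed

text \<open>Partial fractions, rotation of the contour in each of them, the substitution \<open>u \<mapsto> -j L - u\<close>, and
  summation by \<open>res_coeff_theta_sum\<close>.\<close>

lemma U_log_fourth_form:
  fixes a b z w :: complex and e :: kernel
  assumes z: "z = exp w" and w: "\<bar>Im w\<bar> < pi"
    and a: "a \<noteq> 0" "norm a < 1" and b: "norm b < 1"
  defines "F \<equiv> \<lambda>u. qpoch_inf q (- (b * qc * of_real (exp u)))
      * qhyp [qc / a] [- (b * qc * of_real (exp u))] q (- (a * qc * of_real (exp u)))
      / (of_real (exp u) + z) * kappa q e (of_real (L + u)) * of_real (exp u)"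
  shows "integrable lborel F"
    and "integral\<^sup>L lborel (U_log e a b w) = qpoch_inf q a * qpoch_inf q b / qpoch_inf q qc * integral\<^sup>L lborel F"
proof -
  define K0 where "K0 = qpoch_inf q a * qpoch_inf q b / qpoch_inf q qc"
  define r where "r = res_coeff a b"
  have sr: "summable (\<lambda>j. norm (r j))"
    unfolding r_def by (intro summable_res_coeff a b)
  have qexp: "qc ^ j * of_real (exp u) = exp (complex_of_real (u + real j * L))" for j u
    using q_pos by (simp add: exp_add exp_of_nat_mult exp_of_real mult.commute)
  have dom: "kernel_domain e w" using w by simp
  have meas_k: "(\<lambda>u::real. kappa q e (of_real u)) \<in> borel_measurable borel"
    using measurable_kappa[of e 0] by simp
  have int_k: "integrable lborel (\<lambda>u. norm (kappa q e (of_real u - w)))" if "kernel_domain e w" for w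
    using integrable_exp_kappa[OF that, of 0] by simp
  \<comment> \<open>\<open>g0 j\<close> is the \<open>j\<close>-th partial fraction on the positive ray, \<open>g j\<close> below on the ray through \<open>z\<close>, and \<open>f j\<close> the latter after the substitution\<close>
  define g0 where "g0 j u = r j * (kappa q e (of_real u - w) / (1 + exp (of_real (u + real j * L))))" for j and u :: real
  have g0_meas: "g0 j \<in> borel_measurable borel" for j
  proof -
    note [measurable] = measurable_kappa[OF dom]
    have "continuous_on UNIV (\<lambda>u. exp (complex_of_real (u + real j * L)))" by (intro continuous_intros)
    from borel_measurable_continuous_onI[OF this] show ?thesis unfolding g0_def by measurable
  qed
  have g0_bound: "norm (g0 j u) \<le> norm (r j) * norm (kappa q e (of_real u - w))" for j u
  proof -
    have "1 \<le> norm (1 + exp (complex_of_real (u + real j * L)))"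
      using norm_one_plus_exp_ge[of "of_real (u + real j * L)" 0] by simp
    from frac_le[OF norm_ge_zero order_refl zero_less_one this, of "kappa q e (of_real u - w)"]
    show ?thesis unfolding g0_def norm_mult[of "r j"] norm_divide
      by (intro mult_left_mono) auto
  qed
  have summable_g0: "summable (\<lambda>j. norm (g0 j u))" for u
    by (rule summable_comparison_test'[OF summable_mult2[OF sr, of "norm (kappa q e (of_real u - w))"]])
       (use g0_bound in auto)
  have sums0: "(\<lambda>j. integral\<^sup>L lborel (g0 j)) sums integral\<^sup>L lborel (\<lambda>u. \<Sum>j. g0 j u)"
    by (rule integral_series_affine(3)[where f = g0 and \<tau> = "\<lambda>_. 0" and c = 1, OF g0_meas g0_bound sr int_k[OF dom]])
       (use summable_g0 in auto)
  have U_eq: "U_log e a b w u = K0 * (\<Sum>j. g0 j u)" for u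
  proof -
    have "- complex_of_real (exp u) \<in> slit_plane"
      by (rule minus_pos_in_slit_plane) simp
    from qhyp_21_partial_fractions[OF a b this]
    have *: "qhyp [a, b] [0] q (- of_real (exp u)) = (\<Sum>j. K0 * r j / (1 + exp (of_real (u + real j * L))))"
      by (simp add: K0_def r_def qexp del: of_real_exp of_real_add)
    have "K0 * (\<Sum>j. g0 j u) = (\<Sum>j. K0 * g0 j u)"
      by (rule suminf_mult[OF summable_norm_cancel[OF summable_g0], symmetric])
    also have "\<dots> = (\<Sum>j. K0 * r j / (1 + exp (of_real (u + real j * L))) * kappa q e (of_real u - w))"
      by (simp add: g0_def mult_ac)
    also have "\<dots> = U_log e a b w u"
      unfolding U_log_def *
    proof (cases "kappa q e (of_real u - w) = 0")
      case False
      have "summable (\<lambda>j. (K0 / kappa q e (of_real u - w)) * g0 j u)"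
        by (intro summable_mult summable_norm_cancel[OF summable_g0])
      hence "summable (\<lambda>j. K0 * r j / (1 + exp (of_real (u + real j * L))))"
        using False by (simp add: g0_def mult_ac)
      from suminf_mult2[OF this] show "(\<Sum>j. K0 * r j / (1 + exp (of_real (u + real j * L))) * kappa q e (of_real u - w))
        = (\<Sum>j. K0 * r j / (1 + exp (of_real (u + real j * L)))) * kappa q e (of_real u - w)" by simp
    qed simp
    finally show ?thesis ..
  qed
  define g where "g j u = r j * (kappa q e (of_real u) / (1 + exp (of_real (u + real j * L) + w)))" for j and u :: real
  define f where "f j u = (kappa q e (of_real (u + L)) * (of_real (exp u) / (of_real (exp u) + z)))
      * (r j * (qc ^ (j choose 2) * (qc * of_real (exp u)) ^ j))" for j u
  define c where "c = cos (\<bar>Im w\<bar> / 2)"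
  have c: "c > 0" unfolding c_def using w pi_gt_zero by (intro cos_gt_zero_pi) auto
  have g_meas: "g j \<in> borel_measurable borel" for j
  proof -
    note [measurable] = meas_k
    have "continuous_on UNIV (\<lambda>u. exp (complex_of_real (u + real j * L) + w))" by (intro continuous_intros)
    from borel_measurable_continuous_onI[OF this] show ?thesis unfolding g_def by measurable
  qed
  have g_bound: "norm (g j u) \<le> norm (r j) * (norm (kappa q e (of_real u)) / c)" for j u
  proof -
    have "c \<le> norm (1 + exp (complex_of_real (u + real j * L) + w))"
      unfolding c_def using w by (intro norm_one_plus_exp_ge) auto
    thus ?thesis unfolding g_def norm_mult norm_divide using c
      by (intro mult_left_mono frac_le) auto
  qed
  have h: "integrable lborel (\<lambda>u. norm (kappa q e (of_real u)) / c)"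
    using int_k[of 0] by simp
  have fg: "f j u = g j (- real j * L + (-1) * u)" for j u
  proof -
    have k: "kappa q e (of_real (- real j * L + (-1) * u))
        = qc ^ (j choose 2) * (qc * of_real (exp u)) ^ j * kappa q e (of_real (u + L))"
    proof -
      have "kappa q e (of_real (- real j * L + (-1) * u)) = kappa q e (of_real L - of_real (- real j * L + (-1) * u))"
        by (rule kappa_reflect[symmetric])
      also have "of_real L - of_real (- real j * L + (-1) * u) = of_real (u + L) + of_nat j * complex_of_real L"
        by simp
      also have "kappa q e \<dots> = qc ^ (j choose 2) * exp (of_real (u + L)) ^ j * kappa q e (of_real (u + L))"
        by (rule kappa_shift)
      also have "exp (of_real (u + L)) = qc * complex_of_real (exp u)"
        using q_pos by (simp add: exp_add exp_of_real mult.commute)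
      finally show ?thesis .
    qed
    have "exp (of_real (- real j * L + (-1) * u + real j * L) + w) = z / of_real (exp u)"
      by (simp add: z exp_diff exp_of_real)
    hence d: "1 + exp (of_real (- real j * L + (-1) * u + real j * L) + w) = (of_real (exp u) + z) / of_real (exp u)"
      by (simp add: add_divide_distrib)
    show ?thesis unfolding f_def g_def k d by (simp add: mult_ac)
  qed
  have sum_f: "(\<lambda>j. f j u) sums ((kappa q e (of_real (u + L)) * (of_real (exp u) / (of_real (exp u) + z)))
      * (\<Sum>n. jackson_term (qc / a) (- (b * qc * of_real (exp u))) (- (a * qc * of_real (exp u))) n))" for u
    unfolding f_def r_def by (intro sums_mult res_coeff_theta_sum(1) a b exp_gt_zero)
  have summable_f: "summable (\<lambda>j. norm (f j u))" for u
    unfolding f_def r_def norm_mult[of "kappa q e _ * _"]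
    by (intro summable_mult res_coeff_theta_sum(2) a b exp_gt_zero)
  note * = integral_series_affine[OF g_meas g_bound sr h fg _ summable_f, simplified]
  have pt: "(\<Sum>j. f j u) = F u" if "u \<notin> {u :: real. qpoch_inf q (- (b * qc) * of_real (exp u)) = 0}" for u
    using that qhyp_11_eq_jackson_series[of "- (b * qc * of_real (exp u))" "qc / a" "- (a * qc * of_real (exp u))"]
    unfolding sums_unique[OF sum_f, symmetric] F_def by (simp add: add.commute mult_ac del: of_real_exp)
  note F = lborel_discrete_difference[where F = "\<lambda>u. \<Sum>j. f j u" and H = F, OF countable_qpoch_zeros[of "- (b * qc)"] pt]
  show "integrable lborel F" using *(1) F(1) by simp
  have "integral\<^sup>L lborel (g0 j) = integral\<^sup>L lborel (g j)" for j
    unfolding g0_def g_def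
    by (simp only: integral_mult_right_zero stieltjes_kernel_rotation[OF w, of e "real j * L"])
  hence "integral\<^sup>L lborel (\<lambda>u. \<Sum>j. g0 j u) = integral\<^sup>L lborel (\<lambda>u. \<Sum>j. g j u)"
    using sums0 *(3) sums_unique2 by simp
  also have "\<dots> = integral\<^sup>L lborel F" using *(4) F(2) by simp
  finally show "integral\<^sup>L lborel (U_log e a b w) = qpoch_inf q a * qpoch_inf q b / qpoch_inf q qc * integral\<^sup>L lborel F"
    unfolding U_eq K0_def by simp
qed

end

section \<open>The four representations of \<open>U\<close>\<close>

theorem theorem5p1:
  fixes q :: real and e :: kernel and a b z w :: complex
  assumes "0 < q" and "q < 1"
    and "exp w = z"
    and "e = Kernel_theta \<Longrightarrow> \<bar>Im w\<bar> < pi"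
  shows
    "set_integrable lborel {0<..} (U_integrand q e a b w)
     \<and>
     (let f = (\<lambda>t::real. qpoch_inf q (- b * t) / qpoch_inf q (- t)
                 * qhyp [b] [- b * t] q (- a * t)
                 * kappa q e (of_real (ln t) - w) / t)
      in set_integrable lborel {0<..} f \<and>
         U_q q e a b w = (LBINT t:{0<..}. f t))
     \<and>
     (let f = (\<lambda>t::real. qpochs_inf q [- b * t, - (a * q * z / t)] / qpoch_inf q (- t)
                 * kappa q e (of_real (ln t) - w) / t)
      in (norm a < 1 \<longrightarrow> set_integrable lborel {0<..} f) \<and>
         (norm (a * q) < 1 \<longrightarrow> set_integrable lborel {0<..} f \<longrightarrow>
            U_q q e a b w = qpoch_inf q a * (LBINT t:{0<..}. f t)))
     \<and>
     (let f = (\<lambda>t::real. qpochs_inf q [- a * t, - b * t] / qpoch_inf q (- t)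
                 * kappa q e (of_real (ln t) - w) / t)
      in norm (a * b * z) < 1 \<longrightarrow>
           set_integrable lborel {0<..} f \<and>
           U_q q e a b w = qpoch_inf q (a * b * z) * (LBINT t:{0<..}. f t))
     \<and>
     (let f = (\<lambda>t::real. qpoch_inf q (- b * q * t) * qhyp [q / a] [- b * q * t] q (- a * q * t)
                 / (t + z) * kappa q e (of_real (ln (q * t))))
      in a \<noteq> 0 \<longrightarrow> norm a < 1 \<longrightarrow> norm b < 1 \<longrightarrow> \<bar>Im w\<bar> < pi \<longrightarrow>
           set_integrable lborel {0<..} f \<and>
           U_q q e a b w =
             qpochs_inf q [a, b] / qpoch_inf q q * (LBINT t:{0<..}. f t))"
proof -
  interpret q_base q by unfold_locales (fact assms(1), fact assms(2))
  have dom: "kernel_domain e w" using assms(4) by blast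
  have z: "z = exp w" using assms(3) by simp
  have arg: "ln (exp u) = u" for u :: real by simp
  have U: "set_integrable lborel {0<..} (U_integrand q e a b w) \<longleftrightarrow> integrable lborel (U_log e a b w)"
    "U_q q e a b w = integral\<^sup>L lborel (U_log e a b w)"
    unfolding U_q_def
    by (rule exp_substitution; simp add: U_integrand_def U_log_def)+
  show ?thesis
    unfolding Let_def
  proof (intro conjI impI)
    show "set_integrable lborel {0<..} (U_integrand q e a b w)"
      using U(1) U_log_backward(1)[OF z dom] by simp
  next
    let ?f = "\<lambda>t::real. qpoch_inf q (- b * t) / qpoch_inf q (- t)
                 * qhyp [b] [- b * t] q (- a * t) * kappa q e (of_real (ln t) - w) / t"
    have sub: "qpoch_inf q (- (b * of_real (exp u))) / qpoch_inf q (- of_real (exp u))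
        * qhyp [b] [- (b * of_real (exp u))] q (- (a * of_real (exp u))) * kappa q e (of_real u - w)
      = ?f (exp u) * of_real (exp u)" for u :: real
      by simp
    show "set_integrable lborel {0<..} ?f"
      using exp_substitution(1)[OF sub] U_log_first_form(1)[OF dom, of b a] by simp
    show "U_q q e a b w = (LBINT t:{0<..}. ?f t)"
      unfolding U(2) exp_substitution(2)[OF sub] by (rule U_log_first_form(2)[OF dom])
  next
    let ?f = "\<lambda>t::real. qpochs_inf q [- b * t, - (a * q * z / t)] / qpoch_inf q (- t)
                 * kappa q e (of_real (ln t) - w) / t"
    have sub: "qpoch_inf q (- (a * of_real q * z / of_real (exp u))) * q_ratio b (exp u) * kappa q e (of_real u - w)
      = ?f (exp u) * of_real (exp u)" for u :: real
      by (simp add: qpochs_inf_def q_ratio_def)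
    show int: "set_integrable lborel {0<..} ?f" if "norm a < 1"
      using exp_substitution(1)[OF sub] U_log_second_form(1)[OF z dom that, of b] by simp
    show "U_q q e a b w = qpoch_inf q a * (LBINT t:{0<..}. ?f t)"
      if "norm (a * q) < 1" and f: "set_integrable lborel {0<..} ?f"
    proof -
      \<comment> \<open>integrability of the integrand forces \<open>|a| < 1\<close>\<close>
      have "\<not> 1 \<le> norm a"
        using f exp_substitution(1)[OF sub] second_form_not_integrable[OF z dom, of a b] by blast
      hence "norm a < 1" by simp
      thus ?thesis
        unfolding U(2) exp_substitution(2)[OF sub] by (rule U_log_second_form(2)[OF z dom])
    qed
  next
    let ?f = "\<lambda>t::real. qpochs_inf q [- a * t, - b * t] / qpoch_inf q (- t)
                 * kappa q e (of_real (ln t) - w) / t"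
    have sub: "qpoch_inf q (- (a * of_real (exp u))) * q_ratio b (exp u) * kappa q e (of_real u - w)
      = ?f (exp u) * of_real (exp u)" for u :: real
      by (simp add: qpochs_inf_def q_ratio_def)
    assume abz: "norm (a * b * z) < 1"
    show "set_integrable lborel {0<..} ?f"
      using exp_substitution(1)[OF sub] U_log_third_form(1)[OF z dom abz] by simp
    show "U_q q e a b w = qpoch_inf q (a * b * z) * (LBINT t:{0<..}. ?f t)"
      unfolding U(2) exp_substitution(2)[OF sub] by (rule U_log_third_form(2)[OF z dom abz])
  next
    let ?f = "\<lambda>t::real. qpoch_inf q (- b * q * t) * qhyp [q / a] [- b * q * t] q (- a * q * t)
                 / (t + z) * kappa q e (of_real (ln (q * t)))"
    have sub: "qpoch_inf q (- (b * of_real q * of_real (exp u)))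
        * qhyp [of_real q / a] [- (b * of_real q * of_real (exp u))] q (- (a * of_real q * of_real (exp u)))
        / (of_real (exp u) + z) * kappa q e (of_real (ln q + u)) * of_real (exp u)
      = ?f (exp u) * of_real (exp u)" for u :: real
      using q_pos by (simp add: ln_mult)
    assume a: "a \<noteq> 0" "norm a < 1" and b: "norm b < 1" and w: "\<bar>Im w\<bar> < pi"
    show "set_integrable lborel {0<..} ?f"
      using exp_substitution(1)[OF sub] U_log_fourth_form(1)[OF z w a b] by simp
    show "U_q q e a b w = qpochs_inf q [a, b] / qpoch_inf q q * (LBINT t:{0<..}. ?f t)"
      unfolding U(2) exp_substitution(2)[OF sub]
      using U_log_fourth_form(2)[OF z w a b] by (simp add: qpochs_inf_def)
  qed
qed

end
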